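(* Let $n\in[0,2]$ and let either $x=x_c(n)=1/\sqrt{2+\sqrt{2-n}}$ with $\sigma=1-\frac3{4\pi}\arccos(-n/2)$, or $x=\tilde x_c(n)=1/\sqrt{2-\sqrt{2-n}}$ with $\sigma=1-\frac3{4\pi}(2\pi-\arccos(-n/2))$. Let $\Omega$ be a discrete domain on the hexagonal lattice, with empty boundary conditions $\mathfrak b=\varnothing$ or with boundary conditions $\mathfrak b=\{b,b'\}$. Let $a,b_1,c,d,e,f$ be the six edges, listed in counterclockwise order, of a hexagonal face of $\Omega$ none of whose edges is a boundary edge. Then the loop $O(n)$ observable $T^{\mathfrak b}_{\rm edge}$ satisfies $$T^{\mathfrak b}_{\rm edge}(d)-T^{\mathfrak b}_{\rm edge}(a)=T^{\mathfrak b}_{\rm edge}(b_1)-T^{\mathfrak b}_{\rm edge}(e)=T^{\mathfrak b}_{\rm edge}(f)-T^{\mathfrak b}_{\rm edge}(c).$$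
   Context: **Domain and loop $O(n)$ model.** A discrete domain $\Omega$ is the subgraph of the regular hexagonal lattice formed by all vertices and edges lying on, or surrounded by, a given simple cycle. Edges and vertices of that cycle are called boundary edges/vertices. Let $b\ne b'$ be boundary vertices having degree three in $\Omega$. $\mathrm{Conf}(\varnothing)$ is the set of spanning subgraphs of $\Omega\setminus\{\text{boundary edges}\}$ in which every vertex has degree $0$ or $2$; $\mathrm{Conf}(\{b,b'\})$ is the set of such spanning subgraphs in which $b,b'$ have degree $1$ and every other vertex has degree $0$ or $2$ (assumed non-empty). Thus a configuration consists of disjoint loops plus, in the second case, a path from $b$ to $b'$. The loop $O(n)$ measure with boundary conditions $\mathfrak b$ on $\mathrm{Conf}(\mathfrak b)$ gives $\omega$ probability $\frac1{\mathcal Z^{\mathfrak b}}n^{\#\mathrm{loops}(\omega)}x^{\#\mathrm{edges}(\omega)}$ (with $0^0=1$); $\mathbb E$ denotes its expectation. **Rhombus weights.** As functions of $\theta$, $$u_1=\tfrac1t\sin[(\pi-\theta)(\sigma-1)]\sin[\tfrac{2\pi}3(\sigma-1)],\quad u_2=\tfrac1t\sin[\theta(\sigma-1)]\sin[\tfrac{2\pi}3(\sigma-1)],\quad v=\tfrac1t\sin[\theta(\sigma-1)]\sin[(\pi-\theta)(\sigma-1)],$$ $$w_1=\tfrac1t\sin[(\tfrac{2\pi}3-\theta)(\sigma-1)]\sin[(\pi-\theta)(\sigma-1)],\quad w_2=\tfrac1t\sin[(\theta-\tfrac\pi3)(\sigma-1)]\sin[\theta(\sigma-1)],$$ $$t=\frac{\sin^3[\frac{2\pi}3(\sigma-1)]}{\sin[\frac\pi3(\sigma-1)]}+\sin[(\theta-\tfrac\pi3)(\sigma-1)]\sin[(\tfrac{2\pi}3-\theta)(\sigma-1)].$$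 **Observable.** For a non-boundary edge $e=uv$, let $up_1,up_2,vp_3,vp_4$ be the other edges incident to $u$ and $v$, listed counterclockwise around $e$. Put $T^{\mathfrak b}_{\rm edge}(e)=c_{\rm edge}+\mathbb E[t^{[e]}(\omega)]$, where $c_{\rm edge}$ is a real constant depending only on $(n,x)$ and (all functions and derivatives evaluated at $\theta=\pi/3$) - $t^{[e]}(\omega)=u_1'/u_1$ if $\deg_\omega(u)\ne\deg_\omega(v)$; - $t^{[e]}(\omega)=u_2'/u_2$ if $up_1,uv,vp_4\in\omega$ or $up_2,uv,vp_3\in\omega$; - $t^{[e]}(\omega)=v'/v$ if $up_1,uv,vp_3\in\omega$ or $up_2,uv,vp_4\in\omega$ (here $v$ in $v'/v$ is the weight function); - $t^{[e]}(\omega)=(w_1'+w_2'\,n)/w_1$ if $up_1,up_2,vp_3,vp_4\in\omega$ and $u,v$ lie in the same connected component of $\omega$; - $t^{[e]}(\omega)=(w_1'+w_2'\,n^{-1})/w_1$ if $up_1,up_2,vp_3,vp_4\in\omega$ and $u,v$ lie in different components of $\omega$; - $t^{[e]}(\omega)=0$ otherwise (i.e. $u$ and $v$ both have degree $0$). For $n=0$, a product $n^{\#\mathrm{loops}(\omega)}\cdot n^{-1}$ occurring in the expectation is read as $n^{\#\mathrm{loops}(\omega)-1}$ (in that case $\#\mathrm{loops}(\omega)\ge1$). *)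

theory Defs
  imports "HOL-Analysis.Analysis"
begin

section \<open>The hexagonal lattice\<close>

text \<open>
  Vertices are points of the complex plane, edges are two-element sets of vertices, all edges have
  length 1.  One of the two sublattices of vertices is a triangular lattice of mesh \<open>sqrt 3\<close>
  containing 0; each of its points is joined to its translates by the three cube roots of unity.
\<close>

definition hex_sublattice :: "complex set" where
  "hex_sublattice =
     {of_real (sqrt 3) * (of_int i * cis (pi / 6) + of_int j * cis (- pi / 6)) | i j :: int. True}"

definition hex_edges :: "complex set set" where
  "hex_edges = {{p, p + cis (2 * pi * real k / 3)} | p k. p \<in> hex_sublattice \<and> k < 3}"

definition hex_vertices :: "complex set" where
  "hex_vertices = \<Union> hex_edges"

definition hex_face_centres :: "complex set" where
  "hex_face_centres = {p - 1 | p. p \<in> hex_sublattice}"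

definition hex_face_edge :: "complex \<Rightarrow> nat \<Rightarrow> complex set" where
  "hex_face_edge z k = {z + cis (real k * pi / 3), z + cis (real (k + 1) * pi / 3)}"

text \<open>The six edges of a face in counterclockwise order, starting from an arbitrary one.\<close>

definition ccw_hex_face :: "complex set list \<Rightarrow> bool" where
  "ccw_hex_face es \<longleftrightarrow>
     (\<exists>z \<in> hex_face_centres. \<exists>k. es = map (\<lambda>j. hex_face_edge z (k + j)) [0..<6])"

definition hex_cycle :: "complex set set \<Rightarrow> bool" where
  "hex_cycle C \<longleftrightarrow>
     C \<subseteq> hex_edges \<and>
     (\<exists>vs. distinct vs \<and> length vs \<ge> 3 \<and>
        C = {{vs ! i, vs ! ((i + 1) mod length vs)} | i. i < length vs})"

definition degree_in :: "complex set set \<Rightarrow> complex \<Rightarrow> nat" where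
  "degree_in \<omega> v = card {e \<in> \<omega>. v \<in> e}"

definition connected_in :: "complex set set \<Rightarrow> complex \<Rightarrow> complex \<Rightarrow> bool" where
  "connected_in \<omega> u v \<longleftrightarrow> (u, v) \<in> {(p, q). {p, q} \<in> \<omega>}\<^sup>*"


section \<open>Discrete domains and configurations\<close>

text \<open>
  A discrete domain is given by its boundary cycle \<open>C\<close>, a set of edges.  Its boundary edges are the
  elements of \<open>C\<close>, its boundary vertices those of \<open>\<Union> C\<close>.
\<close>

definition cycle_curve :: "complex set set \<Rightarrow> complex set" where
  "cycle_curve C = (\<Union>e \<in> C. convex hull e)"

definition cycle_region :: "complex set set \<Rightarrow> complex set" where
  "cycle_region C = cycle_curve C \<union> inside (cycle_curve C)"

definition domain_vertices :: "complex set set \<Rightarrow> complex set" where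
  "domain_vertices C = hex_vertices \<inter> cycle_region C"

definition domain_edges :: "complex set set \<Rightarrow> complex set set" where
  "domain_edges C = {e \<in> hex_edges. convex hull e \<subseteq> cycle_region C}"

text \<open>A spanning subgraph is identified with its set of edges.\<close>

definition conf :: "complex set set \<Rightarrow> complex set \<Rightarrow> complex set set set" where
  "conf C B =
     {\<omega>. \<omega> \<subseteq> domain_edges C - C \<and>
          (\<forall>v \<in> domain_vertices C.
             if v \<in> B then degree_in \<omega> v = 1 else degree_in \<omega> v \<in> {0, 2})}"

definition boundary_condition :: "complex set set \<Rightarrow> complex set \<Rightarrow> bool" where
  "boundary_condition C B \<longleftrightarrow>
     B = {} \<or>
     (\<exists>b b'. B = {b, b'} \<and> b \<noteq> b' \<and> b \<in> \<Union> C \<and> b' \<in> \<Union> C \<and>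
        degree_in (domain_edges C) b = 3 \<and> degree_in (domain_edges C) b' = 3 \<and>
        conf C B \<noteq> {})"

definition num_loops :: "complex set set \<Rightarrow> nat" where
  "num_loops \<omega> = card {\<gamma>. hex_cycle \<gamma> \<and> \<gamma> \<subseteq> \<omega>}"

definition partition_function ::
    "real \<Rightarrow> real \<Rightarrow> complex set set \<Rightarrow> complex set \<Rightarrow> real" where
  "partition_function n x C B = (\<Sum>\<omega> \<in> conf C B. n ^ num_loops \<omega> * x ^ card \<omega>)"


section \<open>Rhombus weights\<close>

definition wt_t :: "real \<Rightarrow> real \<Rightarrow> real" where
  "wt_t \<sigma> \<theta> =
     sin (2 * pi / 3 * (\<sigma> - 1)) ^ 3 / sin (pi / 3 * (\<sigma> - 1)) +
     sin ((\<theta> - pi / 3) * (\<sigma> - 1)) * sin ((2 * pi / 3 - \<theta>) * (\<sigma> - 1))"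

definition wt_u1 :: "real \<Rightarrow> real \<Rightarrow> real" where
  "wt_u1 \<sigma> \<theta> =
     1 / wt_t \<sigma> \<theta> * sin ((pi - \<theta>) * (\<sigma> - 1)) * sin (2 * pi / 3 * (\<sigma> - 1))"

definition wt_u2 :: "real \<Rightarrow> real \<Rightarrow> real" where
  "wt_u2 \<sigma> \<theta> =
     1 / wt_t \<sigma> \<theta> * sin (\<theta> * (\<sigma> - 1)) * sin (2 * pi / 3 * (\<sigma> - 1))"

definition wt_v :: "real \<Rightarrow> real \<Rightarrow> real" where
  "wt_v \<sigma> \<theta> =
     1 / wt_t \<sigma> \<theta> * sin (\<theta> * (\<sigma> - 1)) * sin ((pi - \<theta>) * (\<sigma> - 1))"

definition wt_w1 :: "real \<Rightarrow> real \<Rightarrow> real" where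
  "wt_w1 \<sigma> \<theta> =
     1 / wt_t \<sigma> \<theta> * sin ((2 * pi / 3 - \<theta>) * (\<sigma> - 1)) * sin ((pi - \<theta>) * (\<sigma> - 1))"

definition wt_w2 :: "real \<Rightarrow> real \<Rightarrow> real" where
  "wt_w2 \<sigma> \<theta> =
     1 / wt_t \<sigma> \<theta> * sin ((\<theta> - pi / 3) * (\<sigma> - 1)) * sin (\<theta> * (\<sigma> - 1))"

definition at_third :: "(real \<Rightarrow> real \<Rightarrow> real) \<Rightarrow> real \<Rightarrow> real" where
  "at_third f \<sigma> = f \<sigma> (pi / 3)"

definition deriv_at_third :: "(real \<Rightarrow> real \<Rightarrow> real) \<Rightarrow> real \<Rightarrow> real" where
  "deriv_at_third f \<sigma> = deriv (f \<sigma>) (pi / 3)"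


section \<open>The observable\<close>

text \<open>
  The other two neighbours of \<open>u\<close>, obtained by rotating the edge from \<open>u\<close> to \<open>v\<close> about \<open>u\<close>.  The
  other edges incident to \<open>u\<close> or \<open>v\<close>, counterclockwise around \<open>{u, v}\<close>, lead from \<open>u\<close> to
  \<open>p\<^sub>1 = nbr_ccw u v\<close> and \<open>p\<^sub>2 = nbr_cw u v\<close>, and from \<open>v\<close> to \<open>p\<^sub>3 = nbr_ccw v u\<close> and
  \<open>p\<^sub>4 = nbr_cw v u\<close>: for \<open>u = 0\<close> and \<open>v = 1\<close> these point to the upper left, lower left, lower right
  and upper right.
\<close>

definition nbr_ccw :: "complex \<Rightarrow> complex \<Rightarrow> complex" where
  "nbr_ccw u v = u + (v - u) * cis (2 * pi / 3)"

definition nbr_cw :: "complex \<Rightarrow> complex \<Rightarrow> complex" where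
  "nbr_cw u v = u + (v - u) * cis (- (2 * pi / 3))"

text \<open>
  The following conditions on an edge do not depend on which endpoint is called \<open>u\<close>, so quantifying
  over the two labellings is harmless.
\<close>

definition unequal_degrees :: "complex set \<Rightarrow> complex set set \<Rightarrow> bool" where
  "unequal_degrees e \<omega> \<longleftrightarrow> (\<exists>u v. e = {u, v} \<and> degree_in \<omega> u \<noteq> degree_in \<omega> v)"

definition same_side_turn :: "complex set \<Rightarrow> complex set set \<Rightarrow> bool" where
  "same_side_turn e \<omega> \<longleftrightarrow>
     (\<exists>u v. e = {u, v} \<and>
        ({u, nbr_ccw u v} \<in> \<omega> \<and> {u, v} \<in> \<omega> \<and> {v, nbr_cw v u} \<in> \<omega> \<or>
         {u, nbr_cw u v} \<in> \<omega> \<and> {u, v} \<in> \<omega> \<and> {v, nbr_ccw v u} \<in> \<omega>))"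

definition opposite_side_turn :: "complex set \<Rightarrow> complex set set \<Rightarrow> bool" where
  "opposite_side_turn e \<omega> \<longleftrightarrow>
     (\<exists>u v. e = {u, v} \<and>
        ({u, nbr_ccw u v} \<in> \<omega> \<and> {u, v} \<in> \<omega> \<and> {v, nbr_ccw v u} \<in> \<omega> \<or>
         {u, nbr_cw u v} \<in> \<omega> \<and> {u, v} \<in> \<omega> \<and> {v, nbr_cw v u} \<in> \<omega>))"

definition all_four :: "complex set \<Rightarrow> complex set set \<Rightarrow> bool" where
  "all_four e \<omega> \<longleftrightarrow>
     (\<exists>u v. e = {u, v} \<and>
        {u, nbr_ccw u v} \<in> \<omega> \<and> {u, nbr_cw u v} \<in> \<omega> \<and>
        {v, nbr_ccw v u} \<in> \<omega> \<and> {v, nbr_cw v u} \<in> \<omega>)"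

definition same_component :: "complex set \<Rightarrow> complex set set \<Rightarrow> bool" where
  "same_component e \<omega> \<longleftrightarrow> (\<exists>u v. e = {u, v} \<and> connected_in \<omega> u v)"

definition t_edge :: "real \<Rightarrow> real \<Rightarrow> complex set \<Rightarrow> complex set set \<Rightarrow> real" where
  "t_edge n \<sigma> e \<omega> =
     (if unequal_degrees e \<omega> then deriv_at_third wt_u1 \<sigma> / at_third wt_u1 \<sigma>
      else if same_side_turn e \<omega> then deriv_at_third wt_u2 \<sigma> / at_third wt_u2 \<sigma>
      else if opposite_side_turn e \<omega> then deriv_at_third wt_v \<sigma> / at_third wt_v \<sigma>
      else if all_four e \<omega> \<and> same_component e \<omega> then
        (deriv_at_third wt_w1 \<sigma> + deriv_at_third wt_w2 \<sigma> * n) / at_third wt_w1 \<sigma>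
      else if all_four e \<omega> \<and> \<not> same_component e \<omega> then
        (deriv_at_third wt_w1 \<sigma> + deriv_at_third wt_w2 \<sigma> * inverse n) / at_third wt_w1 \<sigma>
      else 0)"

text \<open>
  The product of \<open>n ^ num_loops \<omega>\<close> and \<open>t_edge n \<sigma> e \<omega>\<close>.  For \<open>n = 0\<close>, where HOL has
  \<open>inverse 0 = 0\<close>, the product \<open>n ^ num_loops \<omega> * inverse n\<close> is read as \<open>n ^ (num_loops \<omega> - 1)\<close>;
  it occurs only when the endpoints of \<open>e\<close> lie in different components, and then at least one of
  these is a loop, so that the subtraction does not truncate.
\<close>

definition loops_times_t_edge ::
    "real \<Rightarrow> real \<Rightarrow> complex set \<Rightarrow> complex set set \<Rightarrow> real" where
  "loops_times_t_edge n \<sigma> e \<omega> =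
     (if n = 0 \<and> all_four e \<omega> \<and> \<not> same_component e \<omega> then
        (deriv_at_third wt_w1 \<sigma> * n ^ num_loops \<omega> +
         deriv_at_third wt_w2 \<sigma> * n ^ (num_loops \<omega> - 1)) / at_third wt_w1 \<sigma>
      else n ^ num_loops \<omega> * t_edge n \<sigma> e \<omega>)"

definition expectation_t_edge ::
    "real \<Rightarrow> real \<Rightarrow> real \<Rightarrow> complex set set \<Rightarrow> complex set \<Rightarrow> complex set \<Rightarrow> real" where
  "expectation_t_edge n x \<sigma> C B e =
     (\<Sum>\<omega> \<in> conf C B. loops_times_t_edge n \<sigma> e \<omega> * x ^ card \<omega>) / partition_function n x C B"

text \<open>The additive constant is an arbitrary function \<open>c\<close> of the parameters \<open>n\<close> and \<open>x\<close>.\<close>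

definition T_edge ::
    "(real \<Rightarrow> real \<Rightarrow> real) \<Rightarrow> real \<Rightarrow> real \<Rightarrow> real \<Rightarrow>
     complex set set \<Rightarrow> complex set \<Rightarrow> complex set \<Rightarrow> real" where
  "T_edge c n x \<sigma> C B e = c n x + expectation_t_edge n x \<sigma> C B e"

end

theory Submission
  imports Defs
begin

text \<open>
  Replacing the edges of the given face by the complementary ones is an involution \<open>flip\<close> of the
  configurations, and the contributions of \<open>\<omega>\<close> and \<open>flip \<omega>\<close> to \<open>T(d) - T(a) + T(e) - T(b\<^sub>1)\<close> cancel.
  Outside the face both consist of the same loops and of strands matching the occupied legs of the
  face, where the path from \<open>b\<close> to \<open>b'\<close> is closed up through an extra vertex (the centre \<open>z\<close> of the
  face, which is not a vertex of the lattice).  Given the matching, the cancellation is an identity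
  between polynomials in \<open>1 / x\<close>, because \<open>n = 2 - (x\<^sup>-\<^sup>2 - 2)\<^sup>2\<close>.  It fails for crossing
  matchings.  That crossings do not occur follows without the Jordan curve theorem: a finite edge set
  with even degrees is the set of edges separating faces of different parity, where the parity of a
  face counts the edges of the set met by a ray.
\<close>

section \<open>Graphs of degree at most two\<close>

text \<open>The combinations based at two consecutive edges of the face suffice: they are the two
  equations claimed, and their difference is the combination based at the third edge. The extra
  vertex gives every occupied leg a partner leg: a strand starting at the face may otherwise end at
  \<open>b\<close> or \<open>b'\<close>. At most one strand visits the extra vertex, so of two
  supposedly crossing strands at least one consists of lattice edges only; closed up along the face,
  it is the even edge set whose potential separates the ends of the other. The other strand may pass
  through the extra vertex without harm, because \<open>b\<close> and \<open>b'\<close> are joined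
  along the boundary cycle, which the first strand does not meet. The cancellation can be checked on
  integer coefficients because all the ratios of weights share one factor, and because a state with
  \<open>m\<close> occupied face edges is paired with one having \<open>6 - m\<close> of them. The
  two numbers have the same parity, so beyond common factors only even powers of
  \<open>1 / x\<close> remain.\<close>

definition simple_graph :: "complex set set \<Rightarrow> bool" where
  "simple_graph \<omega> \<longleftrightarrow> finite \<omega> \<and> (\<forall>e\<in>\<omega>. \<exists>u v. e = {u, v} \<and> u \<noteq> v)"

lemma simple_graphD: "simple_graph \<omega> \<Longrightarrow> {u, v} \<in> \<omega> \<Longrightarrow> u \<noteq> v"
  unfolding simple_graph_def by fastforce

lemma simple_graph_subset: "simple_graph \<omega> \<Longrightarrow> \<eta> \<subseteq> \<omega> \<Longrightarrow> simple_graph \<eta>"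
  unfolding simple_graph_def by (meson finite_subset subsetD)

lemma bij_betw_nbrs:
  assumes "simple_graph \<omega>"
  shows "bij_betw (\<lambda>w. {v, w}) {w. {v, w} \<in> \<omega>} {e \<in> \<omega>. v \<in> e}"
proof (rule bij_betwI')
  fix e assume "e \<in> {e \<in> \<omega>. v \<in> e}"
  with assms obtain a b where "e = {a, b}" "e \<in> \<omega>" "v \<in> {a, b}"
    unfolding simple_graph_def by auto
  then show "\<exists>w\<in>{w. {v, w} \<in> \<omega>}. e = {v, w}"
    by (auto simp: insert_commute)
qed (auto simp: doubleton_eq_iff)

lemma finite_nbrs: "simple_graph \<omega> \<Longrightarrow> finite {w. {v, w} \<in> \<omega>}"
  using bij_betw_finite[OF bij_betw_nbrs] by (auto simp: simple_graph_def)

lemma degree_in_nbrs: "simple_graph \<omega> \<Longrightarrow> degree_in \<omega> v = card {w. {v, w} \<in> \<omega>}"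
  unfolding degree_in_def using bij_betw_same_card[OF bij_betw_nbrs] by metis

lemma degree_in_pos: "finite \<omega> \<Longrightarrow> degree_in \<omega> v > 0 \<longleftrightarrow> v \<in> \<Union>\<omega>"
  by (auto simp: degree_in_def card_gt_0_iff)

lemma degree_le_two_cases:
  assumes "simple_graph \<omega>" "degree_in \<omega> v \<le> 2"
    and "{v, a} \<in> \<omega>" "{v, b} \<in> \<omega>" "{v, c} \<in> \<omega>"
  shows "a = b \<or> a = c \<or> b = c"
proof (rule ccontr)
  assume *: "\<not> ?thesis"
  have "card {a, b, c} \<le> card {w. {v, w} \<in> \<omega>}"
    using assms finite_nbrs by (intro card_mono) auto
  with * assms show False by (simp add: degree_in_nbrs)
qed

lemma degree_one_unique:
  assumes "simple_graph \<omega>" "degree_in \<omega> v = 1" "{v, a} \<in> \<omega>" "{v, b} \<in> \<omega>"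
  shows "a = b"
proof -
  have "card {w. {v, w} \<in> \<omega>} = 1" using assms by (simp add: degree_in_nbrs)
  then obtain x where "{w. {v, w} \<in> \<omega>} = {x}" by (auto simp: card_1_singleton_iff)
  then have "a \<in> {x}" "b \<in> {x}" using assms(3,4) by (metis mem_Collect_eq)+
  then show ?thesis by simp
qed

lemma degree_two_other:
  assumes "simple_graph \<omega>" "degree_in \<omega> v \<ge> 2"
  obtains b where "{v, b} \<in> \<omega>" "b \<noteq> a"
proof (rule ccontr)
  assume "\<not> thesis"
  then have "{w. {v, w} \<in> \<omega>} \<subseteq> {a}" using that by auto
  then have "card {w. {v, w} \<in> \<omega>} \<le> 1"
    using card_mono[of "{a}"] by fastforce
  with assms show False by (simp add: degree_in_nbrs)
qed

section \<open>Connectivity, components and maximal paths\<close>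

lemma connected_in_refl [simp, intro]: "connected_in \<omega> u u"
  by (simp add: connected_in_def)

lemma connected_in_sym: "connected_in \<omega> u v \<Longrightarrow> connected_in \<omega> v u"
proof -
  have "sym ({(p, q). {p, q} \<in> \<omega>}\<^sup>*)"
    by (intro sym_rtrancl symI) (auto simp: insert_commute)
  then show "connected_in \<omega> u v \<Longrightarrow> connected_in \<omega> v u"
    unfolding connected_in_def by (rule symD)
qed

lemma connected_in_trans [trans]:
  "connected_in \<omega> u v \<Longrightarrow> connected_in \<omega> v w \<Longrightarrow> connected_in \<omega> u w"
  unfolding connected_in_def by (rule rtrancl_trans)

lemma connected_in_edge: "{u, v} \<in> \<omega> \<Longrightarrow> connected_in \<omega> u v"
  unfolding connected_in_def by auto

lemma connected_in_mono: "connected_in \<eta> u v \<Longrightarrow> \<eta> \<subseteq> \<omega> \<Longrightarrow> connected_in \<omega> u v"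
  unfolding connected_in_def by (erule rtrancl_mono[THEN subsetD, rotated]) auto

lemma connected_in_induct [consumes 1, case_names refl step]:
  assumes "connected_in \<omega> u v" "P u"
    and "\<And>p q. connected_in \<omega> u p \<Longrightarrow> {p, q} \<in> \<omega> \<Longrightarrow> P p \<Longrightarrow> P q"
  shows "P v"
  using assms(1) unfolding connected_in_def
  by (induction rule: rtrancl_induct) (use assms(2,3) in \<open>auto simp: connected_in_def\<close>)

lemma connected_in_Union:
  assumes "connected_in \<omega> u v" "u \<noteq> v" shows "v \<in> \<Union>\<omega>"
  using assms by (induction rule: connected_in_induct) auto

definition component :: "complex set set \<Rightarrow> complex \<Rightarrow> complex set" where
  "component \<omega> u = {v. connected_in \<omega> u v}"

lemma component_eq_iff: "component \<omega> u = component \<omega> v \<longleftrightarrow> connected_in \<omega> u v"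
  unfolding component_def using connected_in_sym connected_in_trans by blast

lemma component_subset:
  assumes "u \<in> X" "\<And>p q. p \<in> X \<Longrightarrow> {p, q} \<in> \<omega> \<Longrightarrow> q \<in> X"
  shows "component \<omega> u \<subseteq> X"
proof
  fix v assume "v \<in> component \<omega> u"
  then have "connected_in \<omega> u v" by (simp add: component_def)
  then show "v \<in> X" by (induction rule: connected_in_induct) (use assms in auto)
qed

definition path_in :: "complex set set \<Rightarrow> complex list \<Rightarrow> bool" where
  "path_in \<omega> vs \<longleftrightarrow> vs \<noteq> [] \<and> distinct vs \<and> (\<forall>i. Suc i < length vs \<longrightarrow> {vs ! i, vs ! Suc i} \<in> \<omega>)"

lemma path_in_connected:
  assumes "\<forall>i. Suc i < length vs \<longrightarrow> {vs ! i, vs ! Suc i} \<in> \<omega>" "i < length vs"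
  shows "connected_in \<omega> (vs ! 0) (vs ! i)"
  using assms(2)
proof (induction i)
  case (Suc i)
  then show ?case using assms(1) connected_in_edge connected_in_trans by (meson Suc_lessD)
qed simp

text \<open>A longest path from \<open>u\<close> cannot be prolonged. Lengths are bounded by the
  number of vertices of \<open>\<omega>\<close>, to which \<open>u\<close> is added in case it is
  isolated.\<close>

lemma maximal_path:
  assumes "simple_graph \<omega>"
  obtains vs where "path_in \<omega> vs" "vs ! 0 = u"
    "\<And>w. {last vs, w} \<in> \<omega> \<Longrightarrow> w \<in> set vs"
proof -
  define P where "P = (\<lambda>vs. path_in \<omega> vs \<and> vs ! 0 = u)"
  have fin: "finite (\<Union>\<omega> \<union> {u})" using assms unfolding simple_graph_def by auto
  have "P [u]" by (simp add: P_def path_in_def)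
  moreover have "length vs < Suc (card (\<Union>\<omega> \<union> {u}))" if "P vs" for vs
  proof -
    have "set vs \<subseteq> \<Union>\<omega> \<union> {u}"
    proof
      fix x assume "x \<in> set vs"
      then obtain i where "x = vs ! i" "i < length vs" by (auto simp: in_set_conv_nth)
      with that have "connected_in \<omega> u x" using path_in_connected unfolding P_def path_in_def by blast
      then show "x \<in> \<Union>\<omega> \<union> {u}" using connected_in_Union by blast
    qed
    then have "card (set vs) \<le> card (\<Union>\<omega> \<union> {u})" using fin by (intro card_mono)
    with that show ?thesis by (simp add: P_def path_in_def distinct_card)
  qed
  ultimately obtain vs where vs: "P vs" "\<And>ws. P ws \<Longrightarrow> length ws \<le> length vs"
    using ex_has_greatest_nat[of P "[u]" length "Suc (card (\<Union>\<omega> \<union> {u}))"] by (metis less_imp_le)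
  show ?thesis
  proof (rule that)
    show "path_in \<omega> vs" "vs ! 0 = u" using vs by (auto simp: P_def)
    fix w assume w: "{last vs, w} \<in> \<omega>"
    show "w \<in> set vs"
    proof (rule ccontr)
      assume "w \<notin> set vs"
      moreover have "vs ! i = last vs" if "Suc i = length vs" for i
        using that by (metis diff_Suc_1 last_conv_nth list.size(3) nat.distinct(1))
      ultimately have "P (vs @ [w])"
        using vs(1) w unfolding P_def path_in_def
        by (auto simp: nth_append less_Suc_eq)
      then show False using vs(2)[of "vs @ [w]"] by simp
    qed
  qed
qed

text \<open>All neighbours of the end of a maximal path lie on the path. An end of degree two has a
  neighbour besides its predecessor, and this can only be the first vertex, since both edges at an
  interior vertex already belong to the path.\<close>

lemma path_closes_up:
  assumes "simple_graph \<omega>" "\<And>v. degree_in \<omega> v \<le> 2" "degree_in \<omega> u \<ge> 1"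
  obtains vs where "path_in \<omega> vs" "vs ! 0 = u" "length vs \<ge> 2"
    "degree_in \<omega> (last vs) = 1 \<or> length vs \<ge> 3 \<and> {last vs, u} \<in> \<omega>"
proof -
  obtain vs where vs: "path_in \<omega> vs" "vs ! 0 = u"
    "\<And>w. {last vs, w} \<in> \<omega> \<Longrightarrow> w \<in> set vs"
    using maximal_path[OF assms(1)] by blast
  define m where "m = length vs - 1"
  have len: "length vs = Suc m" and last: "last vs = vs ! m"
    using vs(1) by (auto simp: path_in_def m_def last_conv_nth)
  have edge: "{vs ! i, vs ! Suc i} \<in> \<omega>" if "i < m" for i
    using vs(1) that by (auto simp: path_in_def len)
  have dist: "vs ! i = vs ! j \<longleftrightarrow> i = j" if "i \<le> m" "j \<le> m" for i j
    using vs(1) that by (auto simp: path_in_def len nth_eq_iff_index_eq)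
  obtain w0 where w0: "{u, w0} \<in> \<omega>"
    using assms(1,3) by (auto simp: degree_in_nbrs Suc_le_eq card_gt_0_iff)
  have m: "m > 0"
  proof (rule gr0I)
    assume "m = 0"
    then have "vs = [u]" using vs(2) len by (auto simp: length_Suc_conv)
    with vs(3)[of w0] w0 simple_graphD[OF assms(1) w0] show False by simp
  qed
  have deg: "degree_in \<omega> (last vs) \<ge> 1"
  proof -
    have "{vs ! m, vs ! (m - 1)} \<in> \<omega>" using edge[of "m - 1"] m by (simp add: insert_commute)
    then have "last vs \<in> \<Union>\<omega>" using last by auto
    then show ?thesis using degree_in_pos assms(1) unfolding simple_graph_def by (simp add: Suc_leI)
  qed
  have "length vs \<ge> 3 \<and> {last vs, u} \<in> \<omega>" if "degree_in \<omega> (last vs) \<noteq> 1"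
  proof -
    have "degree_in \<omega> (last vs) \<ge> 2" using that deg by simp
    then obtain w where w: "{last vs, w} \<in> \<omega>" "w \<noteq> vs ! (m - 1)"
      using degree_two_other[OF assms(1)] by metis
    then obtain i where i: "w = vs ! i" "i \<le> m"
      using vs(3) by (metis in_set_conv_nth len less_Suc_eq_le)
    have "i \<noteq> m" using w i last simple_graphD[OF assms(1)] by metis
    moreover have "i \<noteq> m - 1" using w i by auto
    ultimately have im: "i < m - 1" using i(2) by simp
    have "i = 0"
    proof (rule ccontr)
      assume "i \<noteq> 0"
      then have "{vs ! i, vs ! (i - 1)} \<in> \<omega>" "{vs ! i, vs ! Suc i} \<in> \<omega>" "{vs ! i, vs ! m} \<in> \<omega>"
        using edge[of "i - 1"] edge[of i] im w i last by (simp_all add: insert_commute)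
      then have "vs ! (i - 1) = vs ! Suc i \<or> vs ! (i - 1) = vs ! m \<or> vs ! Suc i = vs ! m"
        by (rule degree_le_two_cases[OF assms(1,2)])
      then have "i - 1 = Suc i \<or> i - 1 = m \<or> Suc i = m" using dist im \<open>i \<noteq> 0\<close> by simp
      then show False using im by linarith
    qed
    then show ?thesis using w i im vs(2) len by auto
  qed
  then show ?thesis using that[OF vs(1,2)] m len by force
qed

text \<open>A maximal path from \<open>u\<close> exhausts the component of \<open>u\<close>: its two
  ends have degree one, and its interior vertices have no further edges. Interior vertices have two
  distinct neighbours, so only the last vertex qualifies.\<close>

lemma degree_one_partner:
  assumes "simple_graph \<omega>" "\<And>v. degree_in \<omega> v \<le> 2" "degree_in \<omega> u = 1"
  shows "\<exists>!v. v \<noteq> u \<and> degree_in \<omega> v = 1 \<and> connected_in \<omega> u v"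
proof -
  obtain vs where vs: "path_in \<omega> vs" "vs ! 0 = u" "length vs \<ge> 2"
    "degree_in \<omega> (last vs) = 1 \<or> length vs \<ge> 3 \<and> {last vs, u} \<in> \<omega>"
    using path_closes_up[of \<omega> u] assms by auto
  define m where "m = length vs - 1"
  have len: "length vs = Suc m" and last: "last vs = vs ! m" and m: "m > 0"
    using vs(1,3) by (auto simp: path_in_def m_def last_conv_nth)
  have edge: "{vs ! i, vs ! Suc i} \<in> \<omega>" if "i < m" for i
    using vs(1) that by (auto simp: path_in_def len)
  have dist: "vs ! i = vs ! j \<longleftrightarrow> i = j" if "i \<le> m" "j \<le> m" for i j
    using vs(1) that by (auto simp: path_in_def len nth_eq_iff_index_eq)
  have deg: "degree_in \<omega> (last vs) = 1"
  proof (rule ccontr)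
    assume "degree_in \<omega> (last vs) \<noteq> 1"
    with vs(4) have *: "m \<ge> 2" "{u, vs ! m} \<in> \<omega>" by (auto simp: len last insert_commute)
    have "{u, vs ! 1} \<in> \<omega>" using edge[of 0] m vs(2) by simp
    with * have "vs ! m = vs ! 1" using degree_one_unique[OF assms(1,3)] by blast
    with * dist show False by simp
  qed
  have interior: "w = vs ! (i - 1) \<or> w = vs ! Suc i" if "{vs ! i, w} \<in> \<omega>" "0 < i" "i < m" for i w
  proof -
    have "{vs ! i, vs ! (i - 1)} \<in> \<omega>" "{vs ! i, vs ! Suc i} \<in> \<omega>"
      using edge[of "i - 1"] edge[of i] that by (simp_all add: insert_commute)
    moreover have "vs ! (i - 1) \<noteq> vs ! Suc i" using dist that by simp
    ultimately show ?thesis using degree_le_two_cases[OF assms(1,2)] that by metis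
  qed
  have closed: "w \<in> set vs" if "v \<in> set vs" "{v, w} \<in> \<omega>" for v w
  proof -
    obtain i where i: "v = vs ! i" "i \<le> m"
      using \<open>v \<in> set vs\<close> len by (auto simp: in_set_conv_nth less_Suc_eq_le)
    consider "i = 0" | "i = m" | "0 < i" "i < m" using i by linarith
    then show ?thesis
    proof cases
      case 1
      then have "w = vs ! 1" using degree_one_unique[OF assms(1,3)] edge[of 0] m vs(2) i that by simp
      then show ?thesis using m len by simp
    next
      case 2
      then have "{last vs, vs ! (m - 1)} \<in> \<omega>" using edge[of "m - 1"] m last by (simp add: insert_commute)
      then have "w = vs ! (m - 1)" using degree_one_unique[OF assms(1) deg] 2 i that last by metis
      then show ?thesis using len by simp
    next
      case 3
      then show ?thesis using interior[of i w] that i len by fastforce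
    qed
  qed
  have comp: "v \<in> set vs" if "connected_in \<omega> u v" for v
    using component_subset[of u "set vs" \<omega>] closed vs(2) len that unfolding component_def
    by (metis (no_types, lifting) mem_Collect_eq nth_mem subsetD zero_less_Suc)
  show ?thesis
  proof (rule ex1I)
    show "last vs \<noteq> u \<and> degree_in \<omega> (last vs) = 1 \<and> connected_in \<omega> u (last vs)"
      using dist[of m 0] m last vs deg len path_in_connected[of vs \<omega> m] by (auto simp: path_in_def)
  next
    fix v assume v: "v \<noteq> u \<and> degree_in \<omega> v = 1 \<and> connected_in \<omega> u v"
    then obtain i where i: "v = vs ! i" "i \<le> m"
      using comp[of v] len by (auto simp: in_set_conv_nth less_Suc_eq_le)
    show "v = last vs"
    proof (rule ccontr)
      assume "v \<noteq> last vs"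
      then have i': "0 < i" "i < m" using i v vs(2) last by (auto simp: le_less intro: gr0I)
      then have "{vs ! i, vs ! (i - 1)} \<in> \<omega>" "{vs ! i, vs ! Suc i} \<in> \<omega>"
        using edge[of "i - 1"] edge[of i] by (simp_all add: insert_commute)
      then have "vs ! (i - 1) = vs ! Suc i"
        using degree_one_unique[OF assms(1)] v i by metis
      with dist i' show False by simp
    qed
  qed
qed

section \<open>Loops as connected components\<close>

definition cycle_edges :: "complex list \<Rightarrow> complex set set" where
  "cycle_edges vs = {{vs ! i, vs ! ((i + 1) mod length vs)} | i. i < length vs}"

lemma hex_cycle_iff:
  "hex_cycle C \<longleftrightarrow> C \<subseteq> hex_edges \<and> (\<exists>vs. distinct vs \<and> length vs \<ge> 3 \<and> C = cycle_edges vs)"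
  by (simp add: hex_cycle_def cycle_edges_def)

lemma cycle_edges_Union: "\<Union>(cycle_edges vs) = set vs"
proof
  show "\<Union>(cycle_edges vs) \<subseteq> set vs"
    unfolding cycle_edges_def by (cases "vs = []") auto
  show "set vs \<subseteq> \<Union>(cycle_edges vs)"
  proof
    fix v assume "v \<in> set vs"
    then obtain i where i: "v = vs ! i" "i < length vs" by (auto simp: in_set_conv_nth)
    then have "{vs ! i, vs ! ((i + 1) mod length vs)} \<in> cycle_edges vs"
      unfolding cycle_edges_def by blast
    then show "v \<in> \<Union>(cycle_edges vs)" using i by blast
  qed
qed

lemma hex_cycle_finite: "hex_cycle C \<Longrightarrow> finite C"
  unfolding hex_cycle_iff cycle_edges_def by auto

lemma hex_cycle_connected:
  assumes "hex_cycle C" "u \<in> \<Union>C" "v \<in> \<Union>C"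
  shows "connected_in C u v"
proof -
  obtain vs where vs: "length vs \<ge> 3" "C = cycle_edges vs"
    using assms(1) unfolding hex_cycle_iff by blast
  have "connected_in C (vs ! 0) w" if "w \<in> \<Union>C" for w
  proof -
    obtain i where "w = vs ! i" "i < length vs"
      using \<open>w \<in> \<Union>C\<close> vs(2) cycle_edges_Union by (metis in_set_conv_nth)
    moreover have "\<forall>i. Suc i < length vs \<longrightarrow> {vs ! i, vs ! Suc i} \<in> C"
      
    proof (intro allI impI)
      fix i assume "Suc i < length vs"
      then show "{vs ! i, vs ! Suc i} \<in> C"
        unfolding vs(2) cycle_edges_def by (intro CollectI exI[of _ i]) auto
    qed
    ultimately show ?thesis using path_in_connected by blast
  qed
  then show ?thesis using assms connected_in_sym connected_in_trans by meson
qed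

lemma hex_cycle_two_edges:
  assumes "hex_cycle C" "v \<in> \<Union>C"
  obtains a b where "{v, a} \<in> C" "{v, b} \<in> C" "a \<noteq> b"
proof -
  obtain vs where vs: "distinct vs" "length vs \<ge> 3" "C = cycle_edges vs"
    using assms(1) unfolding hex_cycle_iff by blast
  let ?n = "length vs"
  obtain i where i: "v = vs ! i" "i < ?n"
    using assms(2) vs(3) cycle_edges_Union by (metis in_set_conv_nth)
  \<comment> \<open>The cyclic predecessor of \<open>i\<close>. It differs from the successor
    \<open>k\<close> because the cycle has at least three vertices.\<close>
  define j where "j = (if i = 0 then ?n - 1 else i - 1)"
  have j: "j < ?n" "(j + 1) mod ?n = i" using i vs(2) by (auto simp: j_def)
  define k where "k = (i + 1) mod ?n"
  have k: "k < ?n" "k \<noteq> j" using i vs(2) by (auto simp: j_def k_def mod_Suc)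
  have "{v, vs ! k} \<in> C" unfolding vs(3) cycle_edges_def k_def using i by auto
  moreover have "{v, vs ! j} \<in> C"
    unfolding vs(3) cycle_edges_def using i j by (intro CollectI exI[of _ j]) (simp add: insert_commute)
  moreover have "vs ! k \<noteq> vs ! j" using vs(1) j k by (simp add: nth_eq_iff_index_eq)
  ultimately show ?thesis using that by blast
qed

text \<open>A vertex of \<open>\<gamma>\<close> has two edges in \<open>\<gamma>\<close>, and the
  degree bound leaves no room for an edge of \<open>\<omega>\<close> that leaves the cycle. The
  second claim recovers \<open>\<gamma>\<close> from its vertices, which makes
  \<open>\<Union>\<close> injective on loops.\<close>

lemma hex_cycle_component:
  assumes "hex_cycle \<gamma>" "\<gamma> \<subseteq> \<omega>" "simple_graph \<omega>" "\<And>v. degree_in \<omega> v \<le> 2" "u \<in> \<Union>\<gamma>"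
  shows "component \<omega> u = \<Union>\<gamma>" "\<gamma> = {e \<in> \<omega>. e \<inter> \<Union>\<gamma> \<noteq> {}}"
    "v \<in> \<Union>\<gamma> \<Longrightarrow> degree_in \<omega> v = 2"
proof -
  have step: "{p, q} \<in> \<gamma>" if "p \<in> \<Union>\<gamma>" "{p, q} \<in> \<omega>" for p q
  proof -
    obtain a b where "{p, a} \<in> \<gamma>" "{p, b} \<in> \<gamma>" "a \<noteq> b"
      using hex_cycle_two_edges[OF assms(1) \<open>p \<in> \<Union>\<gamma>\<close>] by metis
    with degree_le_two_cases[OF assms(3,4), of p a b q] assms(2) that show ?thesis by blast
  qed
  show "component \<omega> u = \<Union>\<gamma>"
  proof
    show "component \<omega> u \<subseteq> \<Union>\<gamma>"
      by (rule component_subset) (use assms(5) step in auto)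
    show "\<Union>\<gamma> \<subseteq> component \<omega> u"
      using hex_cycle_connected[OF assms(1,5)] connected_in_mono[OF _ assms(2)]
      unfolding component_def by blast
  qed
  show "\<gamma> = {e \<in> \<omega>. e \<inter> \<Union>\<gamma> \<noteq> {}}"
  proof
    show "\<gamma> \<subseteq> {e \<in> \<omega>. e \<inter> \<Union>\<gamma> \<noteq> {}}"
    proof
      fix e assume "e \<in> \<gamma>"
      moreover from this obtain a b where "e = {a, b}"
        using assms(2,3) unfolding simple_graph_def by blast
      ultimately show "e \<in> {e \<in> \<omega>. e \<inter> \<Union>\<gamma> \<noteq> {}}" using assms(2) by auto
    qed
    show "{e \<in> \<omega>. e \<inter> \<Union>\<gamma> \<noteq> {}} \<subseteq> \<gamma>"
    proof
      fix e assume "e \<in> {e \<in> \<omega>. e \<inter> \<Union>\<gamma> \<noteq> {}}"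
      then obtain p where "e \<in> \<omega>" "p \<in> e" "p \<in> \<Union>\<gamma>" by blast
      moreover from this obtain a b where "e = {a, b}"
        using assms(3) unfolding simple_graph_def by blast
      ultimately have "\<exists>q. e = {p, q}" by (cases "p = a") auto
      with \<open>e \<in> \<omega>\<close> \<open>p \<in> \<Union>\<gamma>\<close> show "e \<in> \<gamma>" using step by blast
    qed
  qed
  assume v: "v \<in> \<Union>\<gamma>"
  obtain a b where ab: "{v, a} \<in> \<gamma>" "{v, b} \<in> \<gamma>" "a \<noteq> b"
    using hex_cycle_two_edges[OF assms(1) v] by metis
  have "card {a, b} \<le> card {w. {v, w} \<in> \<omega>}"
    using ab assms(2) finite_nbrs[OF assms(3)] by (intro card_mono) auto
  then show "degree_in \<omega> v = 2" using assms(4)[of v] ab degree_in_nbrs[OF assms(3)] by simp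
qed

lemma cycle_through:
  assumes "simple_graph \<omega>" "\<omega> \<subseteq> hex_edges" "\<And>v. degree_in \<omega> v \<le> 2"
    and "\<And>v. connected_in \<omega> u v \<Longrightarrow> degree_in \<omega> v = 2"
  obtains \<gamma> where "hex_cycle \<gamma>" "\<gamma> \<subseteq> \<omega>" "u \<in> \<Union>\<gamma>"
proof -
  have "degree_in \<omega> u \<ge> 1" using assms(4)[of u] by simp
  then obtain vs where vs: "path_in \<omega> vs" "vs ! 0 = u" "length vs \<ge> 2"
    "degree_in \<omega> (last vs) = 1 \<or> length vs \<ge> 3 \<and> {last vs, u} \<in> \<omega>"
    using path_closes_up[OF assms(1,3)] by metis
  have "connected_in \<omega> u (last vs)"
    using vs path_in_connected[of vs \<omega> "length vs - 1"]
    by (auto simp: path_in_def last_conv_nth)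
  then have *: "length vs \<ge> 3" "{last vs, u} \<in> \<omega>" using vs(4) assms(4) by auto
  have sub: "cycle_edges vs \<subseteq> \<omega>"
  proof
    fix e assume "e \<in> cycle_edges vs"
    then obtain i where i: "i < length vs" "e = {vs ! i, vs ! ((i + 1) mod length vs)}"
      by (auto simp: cycle_edges_def)
    show "e \<in> \<omega>"
    proof (cases "Suc i = length vs")
      case True
      then have "vs ! i = last vs" using vs(1) by (metis diff_Suc_1 last_conv_nth path_in_def)
      then show ?thesis using True i * vs(2) by simp
    next
      case False
      then show ?thesis using i vs(1) by (auto simp: path_in_def)
    qed
  qed
  show ?thesis
  proof (rule that[OF _ sub])
    show "hex_cycle (cycle_edges vs)"
      unfolding hex_cycle_iff using sub assms(2) vs(1) * by (auto simp: path_in_def)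
    show "u \<in> \<Union>(cycle_edges vs)"
      unfolding cycle_edges_Union using vs(1,2) by (auto simp: path_in_def)
  qed
qed

text \<open>Components, unlike embedded cycles, are easy to follow when the edges of a face are
  changed. The bijection sends a loop to its set of vertices.\<close>

lemma num_loops_eq_components:
  assumes "simple_graph \<omega>" "\<omega> \<subseteq> hex_edges" "\<And>v. degree_in \<omega> v \<le> 2"
  shows "num_loops \<omega> = card {X \<in> component \<omega> ` \<Union>\<omega>. \<forall>v\<in>X. degree_in \<omega> v = 2}"
  unfolding num_loops_def
proof (rule bij_betw_same_card[of "\<Union>"], rule bij_betwI')
  fix \<gamma> \<gamma>' assume g: "\<gamma> \<in> {\<gamma>. hex_cycle \<gamma> \<and> \<gamma> \<subseteq> \<omega>}" "\<gamma>' \<in> {\<gamma>. hex_cycle \<gamma> \<and> \<gamma> \<subseteq> \<omega>}"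
  have ne: "\<exists>u. u \<in> \<Union>\<gamma>" if "hex_cycle \<gamma>" for \<gamma>
  proof -
    obtain vs where "length vs \<ge> 3" "\<gamma> = cycle_edges vs"
      using \<open>hex_cycle \<gamma>\<close> unfolding hex_cycle_iff by blast
    moreover from this have "vs ! 0 \<in> set vs" by (intro nth_mem) linarith
    ultimately have "vs ! 0 \<in> \<Union>\<gamma>" by (simp only: cycle_edges_Union)
    then show ?thesis ..
  qed
  have "\<gamma> = {e \<in> \<omega>. e \<inter> \<Union>\<gamma> \<noteq> {}}" if "\<gamma> \<in> {\<gamma>. hex_cycle \<gamma> \<and> \<gamma> \<subseteq> \<omega>}" for \<gamma>
  proof -
    have \<gamma>: "hex_cycle \<gamma>" "\<gamma> \<subseteq> \<omega>" using that by auto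
    then obtain u where "u \<in> \<Union>\<gamma>" using ne by blast
    then show ?thesis by (rule hex_cycle_component(2)[OF \<gamma> assms(1,3)])
  qed
  from this[OF g(1)] this[OF g(2)]
  show "\<Union>\<gamma> = \<Union>\<gamma>' \<longleftrightarrow> \<gamma> = \<gamma>'" by (metis (no_types))
  obtain u where u: "u \<in> \<Union>\<gamma>" using ne g by blast
  then have "component \<omega> u = \<Union>\<gamma>" "\<And>v. v \<in> \<Union>\<gamma> \<Longrightarrow> degree_in \<omega> v = 2" "u \<in> \<Union>\<omega>"
    using hex_cycle_component[OF _ _ assms(1,3) u] g by auto
  then show "\<Union>\<gamma> \<in> {X \<in> component \<omega> ` \<Union>\<omega>. \<forall>v\<in>X. degree_in \<omega> v = 2}" by blast
next
  fix X assume "X \<in> {X \<in> component \<omega> ` \<Union>\<omega>. \<forall>v\<in>X. degree_in \<omega> v = 2}"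
  then obtain u where u: "X = component \<omega> u" "\<And>v. connected_in \<omega> u v \<Longrightarrow> degree_in \<omega> v = 2"
    by (auto simp: component_def)
  obtain \<gamma> where \<gamma>: "hex_cycle \<gamma>" "\<gamma> \<subseteq> \<omega>" "u \<in> \<Union>\<gamma>"
    using cycle_through[OF assms u(2)] by metis
  have "X = \<Union>\<gamma>" unfolding u(1) by (rule hex_cycle_component(1)[OF \<gamma>(1,2) assms(1,3) \<gamma>(3)])
  with \<gamma> show "\<exists>\<gamma>\<in>{\<gamma>. hex_cycle \<gamma> \<and> \<gamma> \<subseteq> \<omega>}. X = \<Union>\<gamma>" by auto
qed

section \<open>The hexagonal lattice in Eisenstein coordinates\<close>

definition sixth :: complex where "sixth = cis (pi / 3)"

lemma sixth_power2: "sixth ^ 2 = sixth - 1"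
  by (simp add: sixth_def complex_eq_iff power2_eq_square cos_60 sin_60)

lemma sixth_power3: "sixth ^ 3 = -1"
proof -
  have "sixth ^ 3 = sixth * sixth ^ 2" by (simp add: power3_eq_cube power2_eq_square)
  also have "\<dots> = sixth ^ 2 - sixth" unfolding sixth_power2 by (simp add: power2_eq_square[symmetric] sixth_power2 right_diff_distrib)
  finally show ?thesis by (simp add: sixth_power2)
qed

lemma sixth_power_add3: "sixth ^ (k + 3) = - (sixth ^ k)"
  by (simp add: power_add sixth_power3)

lemma sixth_power_add6: "sixth ^ (k + 6) = sixth ^ k"
  using sixth_power_add3[of "k + 3"] sixth_power_add3[of k] by (simp add: add.assoc)

lemma sixth_power_Suc_Suc: "sixth ^ Suc (Suc k) = sixth ^ Suc k - sixth ^ k"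
proof -
  have "sixth ^ Suc (Suc k) = sixth ^ k * sixth ^ 2" by (simp add: power2_eq_square)
  then show ?thesis unfolding sixth_power2 by (simp add: algebra_simps)
qed

lemma sixth_power_mod: "sixth ^ k = sixth ^ (k mod 6)"
proof -
  have "sixth ^ 6 = 1" using sixth_power_add6[of 0] by simp
  then have "sixth ^ (6 * (k div 6) + k mod 6) = sixth ^ (k mod 6)" by (simp only: power_add power_mult power_one mult_1)
  then show ?thesis by (simp only: mult_div_mod_eq)
qed

text \<open>Coordinates in the ring of Eisenstein integers.  The residue of \<open>a - b\<close> modulo 3 is
  0 on \<open>hex_sublattice\<close>, 1 on the other sublattice of vertices and 2 on the centres of the faces.\<close>

definition eis :: "int \<Rightarrow> int \<Rightarrow> complex" where
  "eis a b = of_int a + of_int b * sixth"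

lemma eis_eq_iff [simp]: "eis a b = eis c d \<longleftrightarrow> a = c \<and> b = d"
  by (auto simp: eis_def sixth_def complex_eq_iff sin_60)

lemma eis_add: "eis a b + eis c d = eis (a + c) (b + d)"
  and eis_diff: "eis a b - eis c d = eis (a - c) (b - d)"
  by (simp_all add: eis_def algebra_simps)

lemma eis_double: "2 * eis a b = eis (2 * a) (2 * b)"
  by (simp add: eis_def algebra_simps)

lemma sixth_power_eis:
  "sixth ^ 0 = eis 1 0" "sixth ^ 1 = eis 0 1" "sixth ^ 2 = eis (-1) 1"
  "sixth ^ 3 = eis (-1) 0" "sixth ^ 4 = eis 0 (-1)" "sixth ^ 5 = eis 1 (-1)"
  using sixth_power2 sixth_power3 sixth_power_add3[of 1] sixth_power_add3[of 2]
  by (simp_all add: eis_def)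

lemma sixth_power_cases:
  "sixth ^ k \<in> {eis 1 0, eis 0 1, eis (-1) 1, eis (-1) 0, eis 0 (-1), eis 1 (-1)}"
proof -
  have "k mod 6 \<in> {0, 1, 2, 3, 4, 5}" by auto
  then show ?thesis using sixth_power_eis sixth_power_mod[of k] by auto
qed

text \<open>The generators become \<open>eis 1 1\<close> and \<open>eis 2 (- 1)\<close>; they span a
  sublattice of index three, which the congruence describes.\<close>

lemma hex_sublattice_eis: "hex_sublattice = {eis a b | a b. (a - b) mod 3 = 0}"
proof -
  have 1: "of_real (sqrt 3) * cis (pi / 6) = eis 1 1" "of_real (sqrt 3) * cis (- pi / 6) = eis 2 (- 1)"
    by (simp_all add: eis_def sixth_def complex_eq_iff cos_30 sin_30 cos_60 sin_60)
  have 2: "of_real (sqrt 3) * (of_int i * cis (pi / 6) + of_int j * cis (- pi / 6)) = eis (i + 2 * j) (i - j)"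
    for i j
  proof -
    have "of_real (sqrt 3) * (of_int i * cis (pi / 6) + of_int j * cis (- pi / 6)) =
        of_int i * (of_real (sqrt 3) * cis (pi / 6)) + of_int j * (of_real (sqrt 3) * cis (- pi / 6))"
      by (simp add: algebra_simps)
    also have "\<dots> = eis (i + 2 * j) (i - j)" unfolding 1 by (simp add: eis_def algebra_simps)
    finally show ?thesis .
  qed
  have 3: "\<exists>i j. a = i + 2 * j \<and> b = i - j" if "(a - b) mod 3 = 0" for a b :: int
  proof -
    from that obtain j where "a - b = 3 * j" by (auto simp: mod_eq_0_iff_dvd elim!: dvdE)
    then show ?thesis by (intro exI[of _ "b + j"] exI[of _ j]) simp
  qed
  show ?thesis
  proof (intro set_eqI iffI)
    fix p assume "p \<in> hex_sublattice"
    then obtain i j where "p = eis (i + 2 * j) (i - j)" unfolding hex_sublattice_def 2 by blast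
    then show "p \<in> {eis a b | a b. (a - b) mod 3 = 0}" by (intro CollectI exI conjI) auto
  next
    fix p assume "p \<in> {eis a b | a b. (a - b) mod 3 = 0}"
    then obtain a b where "p = eis a b" "(a - b) mod 3 = 0" by auto
    with 3 obtain i j where "p = eis (i + 2 * j) (i - j)" by metis
    then show "p \<in> hex_sublattice" unfolding hex_sublattice_def 2 by blast
  qed
qed

lemma hex_face_centres_eis: "hex_face_centres = {eis a b | a b. (a - b) mod 3 = 2}"
proof -
  have *: "eis a b - 1 = eis (a - 1) b" for a b by (simp add: eis_def)
  have mod: "(a - b) mod 3 = 0 \<longleftrightarrow> (a - 1 - b) mod 3 = 2" for a b :: int by presburger
  show ?thesis
  proof (intro set_eqI iffI)
    fix p assume "p \<in> {eis a b | a b. (a - b) mod 3 = 2}"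
    then obtain a b where p: "p = eis a b" "(a - b) mod 3 = 2" by auto
    then have "p = eis (a + 1) b - 1" "(a + 1 - b) mod 3 = 0" using mod[of "a + 1" b] by (simp_all add: *)
    then show "p \<in> hex_face_centres" unfolding hex_face_centres_def hex_sublattice_eis
      by (intro CollectI exI[of _ "eis (a + 1) b"] conjI exI[of _ "a + 1"] exI[of _ b]) auto
  next
    fix p assume "p \<in> hex_face_centres"
    then obtain a b where "p = eis a b - 1" "(a - b) mod 3 = 0"
      unfolding hex_face_centres_def hex_sublattice_eis by auto
    then show "p \<in> {eis a b | a b. (a - b) mod 3 = 2}" using mod[of a b] unfolding *
      by (intro CollectI exI[of _ "a - 1"] exI[of _ b]) auto
  qed
qed

lemma cis_third: "cis (2 * pi / 3) = eis (-1) 1" "cis (4 * pi / 3) = eis 0 (-1)"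
proof -
  have *: "cis (real k * pi / 3) = sixth ^ k" for k
    using Complex.DeMoivre[of "pi / 3" k] by (simp add: sixth_def)
  show "cis (2 * pi / 3) = eis (-1) 1" "cis (4 * pi / 3) = eis 0 (-1)"
    using *[of 2] *[of 4] sixth_power_eis by simp_all
qed

lemma hex_edges_eis:
  "hex_edges = {e. \<exists>a b. (a - b) mod 3 = 0 \<and>
     e \<in> {{eis a b, eis (a + 1) b}, {eis a b, eis (a - 1) (b + 1)}, {eis a b, eis a (b - 1)}}}"
proof -
  have "hex_edges = (\<Union>p\<in>hex_sublattice. {{p, p + 1}, {p, p + eis (-1) 1}, {p, p + eis 0 (-1)}})"
  proof (intro set_eqI iffI)
    fix e assume "e \<in> hex_edges"
    then obtain p k where e: "e = {p, p + cis (2 * pi * real k / 3)}" "p \<in> hex_sublattice" "k < 3"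
      unfolding hex_edges_def by blast
    then have "k = 0 \<or> k = 1 \<or> k = 2" by auto
    then show "e \<in> (\<Union>p\<in>hex_sublattice. {{p, p + 1}, {p, p + eis (-1) 1}, {p, p + eis 0 (-1)}})"
      using e cis_third by (auto intro!: bexI[of _ p])
  next
    fix e assume "e \<in> (\<Union>p\<in>hex_sublattice. {{p, p + 1}, {p, p + eis (-1) 1}, {p, p + eis 0 (-1)}})"
    then obtain p where p: "p \<in> hex_sublattice" "e \<in> {{p, p + 1}, {p, p + eis (-1) 1}, {p, p + eis 0 (-1)}}"
      by blast
    have "\<exists>k<3. e = {p, p + cis (2 * pi * real k / 3)}"
      using p(2) cis_third by (auto intro: exI[of _ 0] exI[of _ 1] exI[of _ 2])
    then show "e \<in> hex_edges" unfolding hex_edges_def using p(1) by blast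
  qed
  moreover have "(\<Union>p\<in>{eis a b | a b. Q a b}. F p) = {e. \<exists>a b. Q a b \<and> e \<in> F (eis a b)}"
    for Q and F :: "complex \<Rightarrow> complex set set" by auto
  moreover have "eis a b + 1 = eis (a + 1) b" "eis a b + eis (-1) 1 = eis (a - 1) (b + 1)"
    "eis a b + eis 0 (-1) = eis a (b - 1)" for a b by (simp_all add: eis_def algebra_simps)
  ultimately show ?thesis unfolding hex_sublattice_eis by simp
qed

text \<open>The edges leave a vertex of residue 0 in the directions of the cube roots of unity, and
  a vertex of residue 1 in the opposite directions.\<close>

lemma hex_edge_iff:
  "{eis a b, w} \<in> hex_edges \<longleftrightarrow>
     (a - b) mod 3 = 0 \<and> w \<in> {eis (a + 1) b, eis (a - 1) (b + 1), eis a (b - 1)} \<or>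
     (a - b) mod 3 = 1 \<and> w \<in> {eis (a - 1) b, eis (a + 1) (b - 1), eis a (b + 1)}"
  (is "?L \<longleftrightarrow> ?R")
proof
  assume ?L
  then obtain c d where cd: "(c - d) mod 3 = 0"
    "{eis a b, w} \<in> {{eis c d, eis (c + 1) d}, {eis c d, eis (c - 1) (d + 1)}, {eis c d, eis c (d - 1)}}"
    unfolding hex_edges_eis mem_Collect_eq by (elim exE conjE) (rule that)
  have *: "(c + 1 - d) mod 3 = 1" "(c - 1 - (d + 1)) mod 3 = 1" "(c - (d - 1)) mod 3 = 1"
    using cd(1) by presburger+
  consider "{eis a b, w} = {eis c d, eis (c + 1) d}" | "{eis a b, w} = {eis c d, eis (c - 1) (d + 1)}"
    | "{eis a b, w} = {eis c d, eis c (d - 1)}" using cd(2) by blast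
  then show ?R
    by cases (use cd(1) * in \<open>elim doubleton_eq_iff[THEN iffD1, THEN disjE]; simp\<close>)+
next
  have sub: "{eis c d, eis (c + 1) d} \<in> hex_edges" "{eis c d, eis (c - 1) (d + 1)} \<in> hex_edges"
    "{eis c d, eis c (d - 1)} \<in> hex_edges" if "(c - d) mod 3 = 0" for c d
    unfolding hex_edges_eis
    by (rule CollectI, rule exI[of _ c], rule exI[of _ d], rule conjI[OF that], simp only: insert_iff simp_thms)+
  assume ?R
  then show ?L
  proof
    assume "(a - b) mod 3 = 0 \<and> w \<in> {eis (a + 1) b, eis (a - 1) (b + 1), eis a (b - 1)}"
    then show ?L using sub[of a b] by (elim conjE insertE emptyE) simp_all
  next
    assume *: "(a - b) mod 3 = 1 \<and> w \<in> {eis (a - 1) b, eis (a + 1) (b - 1), eis a (b + 1)}"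
    from * have m: "(a - b) mod 3 = 1" ..
    have "(a - 1 - b) mod 3 = 0" "(a + 1 - (b - 1)) mod 3 = 0" "(a - (b + 1)) mod 3 = 0"
      using m by presburger+
    from sub(1)[OF this(1)] sub(2)[OF this(2)] sub(3)[OF this(3)]
    have "{eis (a - 1) b, eis a b} \<in> hex_edges" "{eis (a + 1) (b - 1), eis a b} \<in> hex_edges"
      "{eis a (b + 1), eis a b} \<in> hex_edges" by simp_all
    with * show ?L by (elim conjE insertE emptyE) (simp_all add: insert_commute)
  qed
qed

lemma hex_edges_simple: "e \<in> hex_edges \<Longrightarrow> \<exists>u v. e = {u, v} \<and> u \<noteq> v"
proof -
  assume "e \<in> hex_edges"
  then obtain c d where
    "e \<in> {{eis c d, eis (c + 1) d}, {eis c d, eis (c - 1) (d + 1)}, {eis c d, eis c (d - 1)}}"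
    unfolding hex_edges_eis mem_Collect_eq by (elim exE conjE) (rule that)
  then show "\<exists>u v. e = {u, v} \<and> u \<noteq> v"
    by (elim insertE emptyE) (metis add_cancel_right_right diff_add_cancel eis_eq_iff zero_neq_one)+
qed

section \<open>Corners, legs and neighbours of a face\<close>

definition corner :: "complex \<Rightarrow> nat \<Rightarrow> complex" where
  "corner z k = z + sixth ^ k"

definition outer :: "complex \<Rightarrow> nat \<Rightarrow> complex" where
  "outer z k = z + 2 * sixth ^ k"

definition leg :: "complex \<Rightarrow> nat \<Rightarrow> complex set" where
  "leg z k = {corner z k, outer z k}"

text \<open>The reflection of \<open>z\<close> in edge \<open>k\<close>, hence the centre of the
  neighbouring face.\<close>

definition across :: "complex \<Rightarrow> nat \<Rightarrow> complex" where
  "across z k = z + sixth ^ k + sixth ^ Suc k"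

lemma hex_face_edge_corner: "hex_face_edge z k = {corner z k, corner z (Suc k)}"
proof -
  have "cis (real k * pi / 3) = sixth ^ k" for k
    using Complex.DeMoivre[of "pi / 3" k] by (simp add: sixth_def)
  from this[of k] this[of "Suc k"] show ?thesis by (simp add: hex_face_edge_def corner_def)
qed

text \<open>Rotation by 60 degrees in coordinates. The exponent \<open>k + 5\<close> stands for
  \<open>k - 1\<close> throughout, which avoids truncated subtraction.\<close>

lemma sixth_power_step:
  assumes "sixth ^ k = eis p q"
  shows "sixth ^ Suc k = eis (- q) (p + q)" "sixth ^ (k + 5) = eis (p + q) (- p)"
    "2 * sixth ^ k = eis (2 * p) (2 * q)"
proof -
  have "sixth * eis p q = of_int p * sixth + of_int q * sixth ^ 2"
    by (simp add: eis_def power2_eq_square algebra_simps)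
  then show "sixth ^ Suc k = eis (- q) (p + q)"
    using assms by (simp add: sixth_power2 eis_def algebra_simps)
  have "sixth ^ (k + 5) = eis p q * eis 1 (-1)" by (simp only: power_add sixth_power_eis assms)
  also have "\<dots> = of_int p + (of_int q - of_int p) * sixth - of_int q * sixth ^ 2"
    by (simp add: eis_def power2_eq_square algebra_simps)
  also have "\<dots> = eis (p + q) (- p)" by (simp add: sixth_power2 eis_def algebra_simps)
  finally show "sixth ^ (k + 5) = eis (p + q) (- p)" .
  show "2 * sixth ^ k = eis (2 * p) (2 * q)" by (simp add: assms eis_def algebra_simps)
qed

lemma corner_eis:
  assumes "z \<in> hex_face_centres"
  obtains a b p q where "z = eis a b" "(a - b) mod 3 = 2" "sixth ^ k = eis p q"
    "(p, q) \<in> {(1, 0), (0, 1), (-1, 1), (-1, 0), (0, -1), (1, -1)}"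
    "corner z k = eis (a + p) (b + q)"
    "corner z (Suc k) = eis (a - q) (b + p + q)"
    "corner z (k + 5) = eis (a + p + q) (b - p)"
    "outer z k = eis (a + 2 * p) (b + 2 * q)"
proof -
  obtain a b where z: "z = eis a b" "(a - b) mod 3 = 2"
    using assms unfolding hex_face_centres_eis by auto
  obtain p q where pq: "sixth ^ k = eis p q"
    "(p, q) \<in> {(1, 0), (0, 1), (-1, 1), (-1, 0), (0, -1), (1, -1)}"
    using sixth_power_cases[of k] by blast
  show ?thesis
  proof (rule that[OF z pq])
    show "outer z k = eis (a + 2 * p) (b + 2 * q)"
      by (simp only: outer_def sixth_power_step(3)[OF pq(1)] z(1) eis_add)
  qed (simp_all only: corner_def sixth_power_step(1,2)[OF pq(1)] pq(1) z(1) eis_add, simp_all add: algebra_simps)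
qed

lemma hex_edge_at_corner_iff:
  assumes "z \<in> hex_face_centres"
  shows "{corner z k, w} \<in> hex_edges \<longleftrightarrow> w \<in> {corner z (Suc k), corner z (k + 5), outer z k}"
proof (rule corner_eis[OF assms, of k])
  fix a b p q
  assume *: "(a - b) mod 3 = 2"
    "(p, q) \<in> {(1, 0), (0, 1), (-1, 1), (-1, 0), (0, -1), (1, -1::int)}"
    "corner z k = eis (a + p) (b + q)"
    "corner z (Suc k) = eis (a - q) (b + p + q)"
    "corner z (k + 5) = eis (a + p + q) (b - p)"
    "outer z k = eis (a + 2 * p) (b + 2 * q)"
  \<comment> \<open>The corners of a face alternate between the two sublattices of vertices.\<close>
  have "(p, q) \<in> {(1, 0), (-1, 1), (0, -1)} \<and> (a + p - (b + q)) mod 3 = 0 \<or>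
    (p, q) \<in> {(0, 1), (-1, 0), (1, -1)} \<and> (a + p - (b + q)) mod 3 = 1"
  proof -
    have "(a + 1 - (b + 0)) mod 3 = 0" "(a + -1 - (b + 0)) mod 3 = 1" "(a + 0 - (b + 1)) mod 3 = 1"
     "(a + 0 - (b + -1)) mod 3 = 0" "(a + -1 - (b + 1)) mod 3 = 0" "(a + 1 - (b + -1)) mod 3 = 1"
      using *(1) by presburger+
    with *(2) show ?thesis by (elim insertE emptyE) (simp_all only: prod.inject insert_iff simp_thms)
  qed
  then show ?thesis
  proof (elim disjE conjE)
    assume pq: "(p, q) \<in> {(1, 0), (-1, 1), (0, -1)}" and "(a + p - (b + q)) mod 3 = 0"
    then have "{corner z k, w} \<in> hex_edges \<longleftrightarrow>
        w \<in> {eis (a + p + 1) (b + q), eis (a + p - 1) (b + q + 1), eis (a + p) (b + q - 1)}"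
      unfolding *(3) hex_edge_iff by simp
    then show ?thesis unfolding *(4-6) using pq by (elim insertE emptyE) (auto simp: algebra_simps)
  next
    assume pq: "(p, q) \<in> {(0, 1), (-1, 0), (1, -1)}" and "(a + p - (b + q)) mod 3 = 1"
    then have "{corner z k, w} \<in> hex_edges \<longleftrightarrow>
        w \<in> {eis (a + p - 1) (b + q), eis (a + p + 1) (b + q - 1), eis (a + p) (b + q + 1)}"
      unfolding *(3) hex_edge_iff by simp
    then show ?thesis unfolding *(4-6) using pq by (elim insertE emptyE) (auto simp: algebra_simps)
  qed
qed

lemma corner_neighbours_distinct:
  "corner z (Suc k) \<noteq> corner z (k + 5)" "corner z (Suc k) \<noteq> outer z k" "corner z (k + 5) \<noteq> outer z k"
  "corner z k \<noteq> corner z (Suc k)" "corner z k \<noteq> corner z (k + 5)" "corner z k \<noteq> outer z k"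
proof -
  obtain p q where pq: "sixth ^ k = eis p q"
    "(p, q) \<in> {(1, 0), (0, 1), (-1, 1), (-1, 0), (0, -1), (1, -1)}"
    using sixth_power_cases[of k] by blast
  show "corner z (Suc k) \<noteq> corner z (k + 5)" "corner z (Suc k) \<noteq> outer z k" "corner z (k + 5) \<noteq> outer z k"
    "corner z k \<noteq> corner z (Suc k)" "corner z k \<noteq> corner z (k + 5)" "corner z k \<noteq> outer z k"
    unfolding corner_def outer_def add_left_cancel sixth_power_step[OF pq(1)] pq(1) eis_eq_iff
    using pq(2) by (auto simp: eis_double)
qed

lemma corner_add6: "corner z (k + 6) = corner z k"
  by (simp only: corner_def sixth_power_add6)

lemma corner_mod6: "corner z k = corner z (k mod 6)"
  using sixth_power_mod[of k] by (simp add: corner_def)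

lemma outer_mod6: "outer z k = outer z (k mod 6)"
  using sixth_power_mod[of k] by (simp add: outer_def)

lemma less_6_cases: "(k::nat) < 6 \<longleftrightarrow> k = 0 \<or> k = 1 \<or> k = 2 \<or> k = 3 \<or> k = 4 \<or> k = 5"
  by auto

lemma corner_eq_iff: "k < 6 \<Longrightarrow> l < 6 \<Longrightarrow> corner z k = corner z l \<longleftrightarrow> k = l"
proof -
  have *: "sixth ^ k = eis ([1, 0, -1, -1, 0, 1] ! k) ([0, 1, 1, 0, -1, -1] ! k)" if "k < 6" for k
    using that sixth_power_eis unfolding less_6_cases by (elim disjE) simp_all
  assume "k < 6" "l < 6"
  then show ?thesis unfolding corner_def add_left_cancel *[OF \<open>k < 6\<close>] *[OF \<open>l < 6\<close>] eis_eq_iff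
    unfolding less_6_cases by (elim disjE) simp_all
qed

lemma outer_not_corner: "outer z k \<noteq> corner z l"
proof -
  have "2 * sixth ^ k \<noteq> sixth ^ l"
    using sixth_power_cases[of k] sixth_power_cases[of l] sixth_power_step(3)[of k] by auto
  then show ?thesis by (simp add: corner_def outer_def)
qed

lemma hex_edges_at_corner:
  assumes "z \<in> hex_face_centres"
  shows "{e \<in> hex_edges. corner z k \<in> e} = {hex_face_edge z k, hex_face_edge z (k + 5), leg z k}"
proof -
  have 1: "e = {corner z k, w} \<longrightarrow> e \<in> hex_edges \<longleftrightarrow> w \<in> {corner z (Suc k), corner z (k + 5), outer z k}" for e w
    using hex_edge_at_corner_iff[OF assms] by simp
  have "Suc (k + 5) = k + 6" by simp
  then have 2: "corner z (Suc (k + 5)) = corner z k" by (simp only: corner_add6)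
  show ?thesis
  proof (intro set_eqI iffI)
    fix e assume "e \<in> {e \<in> hex_edges. corner z k \<in> e}"
    moreover from this obtain u v where "e = {u, v}" using hex_edges_simple by blast
    ultimately have "e = {corner z k, u} \<or> e = {corner z k, v}" "e \<in> hex_edges" by auto
    then obtain w where "e = {corner z k, w}" "e \<in> hex_edges" by metis
    with 1[of e w] show "e \<in> {hex_face_edge z k, hex_face_edge z (k + 5), leg z k}"
      unfolding hex_face_edge_corner leg_def 2 by (auto simp: insert_commute)
  next
    fix e assume "e \<in> {hex_face_edge z k, hex_face_edge z (k + 5), leg z k}"
    then obtain w where "e = {corner z k, w}" "w \<in> {corner z (Suc k), corner z (k + 5), outer z k}"
      unfolding hex_face_edge_corner leg_def 2 by (auto simp: insert_commute)
    with 1[of e w] show "e \<in> {e \<in> hex_edges. corner z k \<in> e}" by simp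
  qed
qed

lemma degree_in_corner:
  assumes "z \<in> hex_face_centres" "J \<subseteq> hex_edges"
  shows "degree_in J (corner z k) =
    of_bool (hex_face_edge z k \<in> J) + of_bool (hex_face_edge z (k + 5) \<in> J) + of_bool (leg z k \<in> J)"
proof -
  have d: "hex_face_edge z k \<noteq> hex_face_edge z (k + 5)" "hex_face_edge z k \<noteq> leg z k"
    "hex_face_edge z (k + 5) \<noteq> leg z k"
    using corner_neighbours_distinct[of z k] corner_add6[of z k]
    unfolding hex_face_edge_corner leg_def by (auto simp: doubleton_eq_iff)
  have "{e \<in> J. corner z k \<in> e} = J \<inter> {hex_face_edge z k, hex_face_edge z (k + 5), leg z k}"
    using hex_edges_at_corner[OF assms(1), of k] assms(2) by blast
  then show ?thesis using d by (auto simp: degree_in_def Int_insert_right)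
qed

section \<open>Potentials of even edge sets\<close>

lemma across_centre: "z \<in> hex_face_centres \<Longrightarrow> across z k \<in> hex_face_centres"
proof (rule corner_eis[of z k])
  fix a b p q
  assume *: "z = eis a b" "(a - b) mod 3 = 2" "sixth ^ k = eis p q"
    "(p, q) \<in> {(1, 0), (0, 1), (-1, 1), (-1, 0), (0, -1), (1, -1::int)}"
  have "across z k = eis (a + p - q) (b + 2 * q + p)"
    unfolding across_def *(1,3) sixth_power_step[OF *(3)] eis_add by simp
  moreover have "(a + p - q - (b + 2 * q + p)) mod 3 = 2"
    using *(2) by presburger
  ultimately show "across z k \<in> hex_face_centres" unfolding hex_face_centres_eis by blast
qed

lemma across_across: "across (across z k) (k + 3) = z"
  by (simp only: across_def add_Suc[symmetric] sixth_power_add3) simp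

lemma hex_face_edge_across: "hex_face_edge (across z k) (k + 3) = hex_face_edge z k"
  unfolding hex_face_edge_corner corner_def across_def add_Suc[symmetric] sixth_power_add3 by auto

lemma corner_across: "corner (across z k) (k + 4) = corner z k"
  "corner (across z k) (k + 5) = outer z k"
proof -
  have "k + 4 = Suc k + 3" "k + 5 = Suc (Suc k) + 3" by simp_all
  then show "corner (across z k) (k + 4) = corner z k" "corner (across z k) (k + 5) = outer z k"
    by (simp_all only: corner_def outer_def across_def sixth_power_add3 sixth_power_Suc_Suc) simp_all
qed

lemma leg_across: "leg z k = hex_face_edge (across z k) (k + 4)"
proof -
  have "Suc (k + 4) = k + 5" by simp
  then show ?thesis by (simp only: hex_face_edge_corner corner_across leg_def)
qed

lemma even_corner_iff:
  assumes "z \<in> hex_face_centres" "J \<subseteq> hex_edges" "\<And>v. even (degree_in J v)"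
  shows "(hex_face_edge z k \<in> J) \<noteq> (hex_face_edge z (k + 5) \<in> J) \<longleftrightarrow> leg z k \<in> J"
  using assms(3)[of "corner z k"] unfolding degree_in_corner[OF assms(1,2)]
  by (auto simp: of_bool_def split: if_splits)

text \<open>Made for rays: starting one face later drops index 0 and shifts all the others.\<close>

lemma odd_card_Suc:
  assumes "finite {m. Q (Suc m)}"
  shows "odd (card {m. Q m}) \<longleftrightarrow> Q 0 \<noteq> odd (card {m. Q (Suc m)})"
proof -
  have "{m. Q m} = (if Q 0 then {0} else {}) \<union> Suc ` {m. Q (Suc m)}"
  proof (intro set_eqI)
    show "m \<in> {m. Q m} \<longleftrightarrow> m \<in> (if Q 0 then {0} else {}) \<union> Suc ` {m. Q (Suc m)}" for m
      by (cases m) auto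
  qed
  then have "card {m. Q m} = of_bool (Q 0) + card {m. Q (Suc m)}"
    using assms by (subst \<open>{m. Q m} = _\<close>, subst card_Un_disjoint) (auto simp: card_image)
  then show ?thesis by simp
qed

text \<open>Modulo 2, every finite cycle of the planar lattice is a boundary. The ray from
  \<open>z\<close> leaves each face through its edge 0, so the rule for edge 0 is built into
  \<open>f\<close>. The rule for edge 2 holds far out on the ray, beyond the finite
  \<open>J\<close>, and is carried back along it; evenness at corner 2 then yields edge 1.\<close>

lemma face_potential:
  assumes "finite J" "J \<subseteq> hex_edges" "\<And>v. even (degree_in J v)"
  obtains f :: "complex \<Rightarrow> bool" where "\<And>z k. z \<in> hex_face_centres \<Longrightarrow> f z \<noteq> f (across z k) \<longleftrightarrow> hex_face_edge z k \<in> J"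
proof -
  define d where "d = 1 + sixth"
  define f where "f z = odd (card {m::nat. hex_face_edge (z + of_nat m * d) 0 \<in> J})" for z
  have d: "across z 0 = z + d" for z by (simp add: across_def d_def)
  have centre: "z + of_nat m * d \<in> hex_face_centres" if "z \<in> hex_face_centres" for z m
  proof (induction m)
    case (Suc m)
    have "z + of_nat (Suc m) * d = across (z + of_nat m * d) 0" by (simp add: d algebra_simps)
    then show ?case using across_centre[OF Suc] by simp
  qed (use that in simp)
  have fin: "finite {m::nat. hex_face_edge (z + of_nat m * d) k \<in> J}" for z k
  proof (rule finite_imageD)
    show "finite ((\<lambda>m::nat. hex_face_edge (z + of_nat m * d) k) ` {m. hex_face_edge (z + of_nat m * d) k \<in> J})"
      using assms(1) by (rule finite_subset[rotated]) auto
    show "inj_on (\<lambda>m::nat. hex_face_edge (z + of_nat m * d) k) {m. hex_face_edge (z + of_nat m * d) k \<in> J}"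
    proof (rule inj_onI)
      fix m n :: nat
      assume "hex_face_edge (z + of_nat m * d) k = hex_face_edge (z + of_nat n * d) k"
      then have "corner (z + of_nat m * d) k + corner (z + of_nat m * d) (Suc k) =
          corner (z + of_nat n * d) k + corner (z + of_nat n * d) (Suc k)"
        unfolding hex_face_edge_corner by (auto simp: doubleton_eq_iff add.commute)
      then have "2 * (of_nat m * d) = 2 * (of_nat n * d)" by (simp add: corner_def)
      moreover have "d \<noteq> 0" by (simp add: d_def sixth_def complex_eq_iff cos_60)
      ultimately show "m = n" by simp
    qed
  qed
  have cross0: "f z \<noteq> f (across z 0) \<longleftrightarrow> hex_face_edge z 0 \<in> J" for z
    using odd_card_Suc[of "\<lambda>m. hex_face_edge (z + of_nat m * d) 0 \<in> J"] fin[of "z + d" 0]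
    unfolding f_def d by (auto simp: algebra_simps)
  have n: "across z 2 + d = across (z + d) 2" for z by (simp add: across_def)
  have cross2: "f z \<noteq> f (across z 2) \<longleftrightarrow> hex_face_edge z 2 \<in> J" if z: "z \<in> hex_face_centres" for z
  proof -
    let ?P = "\<lambda>z. f z \<noteq> f (across z 2) \<longleftrightarrow> hex_face_edge z 2 \<in> J"
    \<comment> \<open>Corners 1 and 2 of the face at \<open>z\<close> are surrounded by the faces
      \<open>z\<close>, \<open>z + d\<close>, \<open>across z 2\<close> and
      \<open>across z 2 + d\<close>. Evenness at these two corners moves the claim one face
      back.\<close>
    have step: "?P z" if "z \<in> hex_face_centres" "?P (z + d)" for z
    proof -
      have "leg z 1 = hex_face_edge (z + d) 2"
        unfolding leg_def hex_face_edge_corner corner_def outer_def d_def using sixth_power2 sixth_power3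
        by (auto simp: numeral_2_eq_2 numeral_3_eq_3)
      moreover have "leg z 2 = hex_face_edge (across z 2) 0"
        using leg_across[of z 2] sixth_power_add6[of 0] sixth_power_add6[of 1]
        unfolding hex_face_edge_corner corner_def by simp
      moreover have "hex_face_edge z (1 + 5) = hex_face_edge z 0"
        using sixth_power_add6[of 0] sixth_power_add6[of 1] unfolding hex_face_edge_corner corner_def by simp
      moreover have "hex_face_edge z (2 + 5) = hex_face_edge z 1"
        using sixth_power_add6[of 1] sixth_power_add6[of 2] unfolding hex_face_edge_corner corner_def
        by (simp add: numeral_2_eq_2)
      ultimately show ?thesis
        using even_corner_iff[OF \<open>z \<in> _\<close> assms(2,3), of 1] even_corner_iff[OF \<open>z \<in> _\<close> assms(2,3), of 2]
          cross0[of z] cross0[of "across z 2"] \<open>?P (z + d)\<close> unfolding d n by metis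
    qed
    have far: "\<exists>M. \<forall>m\<ge>M. hex_face_edge (z + of_nat m * d) k \<notin> J" for z k
      using fin[of z k] by (metis (no_types, lifting) finite_nat_set_iff_bounded mem_Collect_eq not_le)
    obtain M0 M1 M2 where M: "\<forall>m\<ge>M0. hex_face_edge (z + of_nat m * d) 0 \<notin> J"
      "\<forall>m\<ge>M1. hex_face_edge (across z 2 + of_nat m * d) 0 \<notin> J"
      "\<forall>m\<ge>M2. hex_face_edge (z + of_nat m * d) 2 \<notin> J" using far by meson
    define M where "M = max M0 (max M1 M2)"
    have f0: "\<not> f (y + of_nat M * d)" if "\<forall>m\<ge>M. hex_face_edge (y + of_nat m * d) 0 \<notin> J" for y
    proof -
      have "hex_face_edge (y + of_nat M * d + of_nat m * d) 0 \<notin> J" for m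
        using that[rule_format, of "M + m"] by (simp add: algebra_simps)
      then show ?thesis unfolding f_def by simp
    qed
    have "across z 2 + of_nat M * d = across (z + of_nat M * d) 2" by (simp add: across_def)
    then have "?P (z + of_nat M * d)"
      using M f0[of z] f0[of "across z 2"] by (simp add: M_def)
    moreover have "?P z" if "?P (z + of_nat m * d)" for m
      using that
    proof (induction m)
      case (Suc m)
      then show ?case using step[OF centre[OF z], of m] by (simp add: algebra_simps)
    qed simp
    ultimately show "?P z" by blast
  qed
  have cross1: "f z \<noteq> f (across z 1) \<longleftrightarrow> hex_face_edge z 1 \<in> J" if z: "z \<in> hex_face_centres" for z
  proof -
    have "across z 1 = across (across z 2) 0"
      unfolding across_def using sixth_power2 sixth_power3 by (simp add: numeral_2_eq_2 numeral_3_eq_3)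
    moreover have "leg z 2 = hex_face_edge (across z 2) 0"
      using leg_across[of z 2] sixth_power_add6[of 0] sixth_power_add6[of 1]
      unfolding hex_face_edge_corner corner_def by simp
    moreover have "hex_face_edge z (2 + 5) = hex_face_edge z 1"
      using sixth_power_add6[of 1] sixth_power_add6[of 2] unfolding hex_face_edge_corner corner_def
      by (simp add: numeral_2_eq_2)
    ultimately show ?thesis
      using even_corner_iff[OF z assms(2,3), of 2] cross2[OF z] cross0[of "across z 2"] by metis
  qed
  have cross_low: "f z \<noteq> f (across z k) \<longleftrightarrow> hex_face_edge z k \<in> J" if "z \<in> hex_face_centres" "k < 3" for z k
  proof -
    from \<open>k < 3\<close> have "k = 0 \<or> k = 1 \<or> k = 2" by auto
    then show ?thesis using cross0[of z] cross1[OF that(1)] cross2[OF that(1)] by (elim disjE) simp_all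
  qed
  have cross: "f z \<noteq> f (across z k) \<longleftrightarrow> hex_face_edge z k \<in> J" if z: "z \<in> hex_face_centres" for z k
  proof -
    have mod: "across z k = across z (k mod 6)" "hex_face_edge z k = hex_face_edge z (k mod 6)"
      using sixth_power_mod[of k] unfolding across_def hex_face_edge_corner corner_def by simp_all
    have "f z \<noteq> f (across z l) \<longleftrightarrow> hex_face_edge z l \<in> J" if "l < 6" for l
    proof (cases "l < 3")
      case False
      \<comment> \<open>Edges 3 to 5 are edges 0 to 2 of the neighbouring faces.\<close>
      define j where "j = l - 3"
      have l: "l = j + 3" "j < 3" using False that by (simp_all add: j_def)
      have j6: "across (across z (j + 3)) j = z"
        "hex_face_edge (across z (j + 3)) j = hex_face_edge z (j + 3)"
        using across_across[of z "j + 3"] hex_face_edge_across[of z "j + 3"] sixth_power_add6[of j] sixth_power_add6[of "Suc j"]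
        unfolding across_def hex_face_edge_corner corner_def by (simp_all add: add.assoc)
      show ?thesis using cross_low[OF across_centre[OF z] l(2), of l] j6 l by metis
    qed (use cross_low z in blast)
    from this[of "k mod 6"] show ?thesis unfolding mod by simp
  qed
  show ?thesis by (rule that, rule cross)
qed

text \<open>Unit vectors leading from two centres to the same vertex have the same residue, so they
  differ by a rotation through a multiple of 120 degrees. This leaves three faces.\<close>

lemma vertex_class:
  assumes "z \<in> hex_face_centres" "z' \<in> hex_face_centres" "corner z k = corner z' l"
  shows "z' = z \<or> z' = across z k \<or> z' = across z (k + 5)"
proof -
  obtain a b p q where *: "z = eis a b" "(a - b) mod 3 = 2" "sixth ^ k = eis p q"
    "(p, q) \<in> {(1, 0), (0, 1), (-1, 1), (-1, 0), (0, -1), (1, -1)}"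
    using corner_eis[OF assms(1), of k] by metis
  obtain a' b' p' q' where r: "z' = eis a' b'" "(a' - b') mod 3 = 2" "sixth ^ l = eis p' q'"
    "(p', q') \<in> {(1, 0), (0, 1), (-1, 1), (-1, 0), (0, -1), (1, -1)}"
    using corner_eis[OF assms(2), of l] by metis
  have eq: "a' = a + p - p'" "b' = b + q - q'"
    using assms(3) unfolding corner_def *(1,3) r(1,3) eis_add by auto
  have "(p - q - (p' - q')) mod 3 = 0" using *(2) r(2) unfolding eq by presburger
  then have "(p', q') = (p, q) \<or> (p', q') = (- p - q, p) \<or> (p', q') = (q, - p - q)"
    using *(4) r(4) by (elim insertE emptyE) simp_all
  moreover have "across z k = eis (a + p - q) (b + 2 * q + p)"
    unfolding across_def *(1,3) sixth_power_step[OF *(3)] eis_add by simp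
  moreover have "across z (k + 5) = eis (a + 2 * p + q) (b + q - p)"
  proof -
    have "Suc (k + 5) = k + 6" by simp
    then have "sixth ^ Suc (k + 5) = eis p q" by (simp only: sixth_power_add6 *(3))
    then show ?thesis unfolding across_def *(1) sixth_power_step(2)[OF *(3)] by (simp add: eis_add)
  qed
  ultimately show ?thesis unfolding *(1) r(1) eq by auto
qed

text \<open>No edge at a vertex off \<open>J\<close> lies in \<open>J\<close>, so the three faces
  around it carry the same value, and \<open>SOME\<close> may select any of them. This transfers the
  potential to vertices, where it can be followed along strands.\<close>

lemma vertex_potential:
  assumes "finite J" "J \<subseteq> hex_edges" "\<And>v. even (degree_in J v)"
  obtains f g :: "complex \<Rightarrow> bool" where
    "\<And>z k. z \<in> hex_face_centres \<Longrightarrow> f z \<noteq> f (across z k) \<longleftrightarrow> hex_face_edge z k \<in> J"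
    "\<And>z k. z \<in> hex_face_centres \<Longrightarrow> corner z k \<notin> \<Union>J \<Longrightarrow> g (corner z k) = f z"
proof (rule face_potential[OF assms])
  fix f :: "complex \<Rightarrow> bool"
  assume f: "\<And>z k. z \<in> hex_face_centres \<Longrightarrow> f z \<noteq> f (across z k) \<longleftrightarrow> hex_face_edge z k \<in> J"
  define g where "g v = f (SOME z. z \<in> hex_face_centres \<and> (\<exists>k. v = corner z k))" for v
  have "g (corner z k) = f z" if z: "z \<in> hex_face_centres" "corner z k \<notin> \<Union>J" for z k
  proof -
    define z' where "z' = (SOME z'. z' \<in> hex_face_centres \<and> (\<exists>l. corner z k = corner z' l))"
    have "z' \<in> hex_face_centres \<and> (\<exists>l. corner z k = corner z' l)"
      unfolding z'_def by (rule someI[of _ z]) (use z in auto)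
    then obtain l where z': "z' \<in> hex_face_centres" "corner z k = corner z' l" by auto
    have "Suc (k + 5) = k + 6" by simp
    then have "corner z k \<in> hex_face_edge z k" "corner z k \<in> hex_face_edge z (k + 5)"
      unfolding hex_face_edge_corner by (simp_all only: corner_add6 insert_iff simp_thms)
    then have "hex_face_edge z k \<notin> J" "hex_face_edge z (k + 5) \<notin> J" using z(2) by auto
    then have "f (across z k) = f z" "f (across z (k + 5)) = f z"
      using f[OF z(1), of k] f[OF z(1), of "k + 5"] by auto
    then have "f z' = f z" using vertex_class[OF z(1) z'] by auto
    then show ?thesis by (simp add: g_def z'_def)
  qed
  from f this show thesis by (rule that)
qed

text \<open>Allows both ends of an edge to be compared with the value of \<open>f\<close> at one
  common face.\<close>

lemma hex_edge_face:
  assumes "{u, v} \<in> hex_edges"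
  obtains z k l where "z \<in> hex_face_centres" "u = corner z k" "v = corner z l"
proof -
  obtain c d where
    "{u, v} \<in> {{eis c d, eis (c + 1) d}, {eis c d, eis (c - 1) (d + 1)}, {eis c d, eis c (d - 1)}}"
    using assms unfolding hex_edges_eis mem_Collect_eq by (elim exE conjE) (rule that)
  then have "u \<in> {eis c d, eis (c + 1) d, eis (c - 1) (d + 1), eis c (d - 1)}" by auto
  then obtain a b where u: "u = eis a b" by blast
  then have "(a - b) mod 3 = 0 \<or> (a - b) mod 3 = 1" using assms by (auto simp: hex_edge_iff)
  then have "(a - 1 - b) mod 3 = 2 \<or> (a + 1 - b) mod 3 = 2" by presburger
  moreover have "u = corner (eis (a - 1) b) 0" "u = corner (eis (a + 1) b) 3"
    unfolding u corner_def sixth_power_eis eis_add by simp_all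
  ultimately obtain z k where z: "z \<in> hex_face_centres" "u = corner z k"
    unfolding hex_face_centres_eis by blast
  then have "v \<in> {corner z (Suc k), corner z (k + 5), corner (across z k) (k + 5)}"
    using hex_edge_at_corner_iff[of z k v] assms corner_across(2)[of z k] by simp
  moreover have "u = corner (across z k) (k + 4)" using z(2) corner_across(1)[of z k] by simp
  ultimately show ?thesis using that z across_centre[OF z(1), of k] by blast
qed

lemma vertex_potential_edge:
  assumes "\<And>z k. z \<in> hex_face_centres \<Longrightarrow> corner z k \<notin> X \<Longrightarrow> g (corner z k) = f z"
    and "{u, v} \<in> hex_edges" "u \<notin> X" "v \<notin> X"
  shows "g u = g v"
proof -
  obtain z k l where "z \<in> hex_face_centres" "u = corner z k" "v = corner z l"
    using hex_edge_face[OF assms(2)] by metis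
  then show ?thesis using assms(1)[of z k] assms(1)[of z l] assms(3,4) by simp
qed

section \<open>Non-crossing matchings of the six corners of a face\<close>

text \<open>
  The corners of a face are numbered from 0 to 5, and edge \<open>k\<close> joins corners \<open>k\<close> and \<open>k + 1\<close>.
  The state of a face consists of the list \<open>s\<close> telling which of its edges are occupied and of the
  list \<open>p\<close> with \<open>p ! i = j\<close> if corners \<open>i\<close> and \<open>j\<close> are joined outside the face, and \<open>p ! i = i\<close> if the
  third edge at corner \<open>i\<close> is vacant.
\<close>

definition relabel :: "nat \<times> nat \<Rightarrow> nat list \<Rightarrow> nat list" where
  "relabel e lab = map (\<lambda>x. if x = lab ! fst e then lab ! snd e else x) lab"

text \<open>A vacant leg contributes the trivial link \<open>(i, i)\<close>.\<close>

definition links :: "nat list \<Rightarrow> bool list \<Rightarrow> (nat \<times> nat) list" where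
  "links p s = zip [0..<6] p @ filter (\<lambda>e. s ! fst e) (map (\<lambda>i. (i, Suc i mod 6)) [0..<6])"

definition labels :: "nat list \<Rightarrow> bool list \<Rightarrow> nat list" where
  "labels p s = fold relabel (links p s) [0..<6]"

text \<open>In a configuration an occupied leg forces exactly one of the two face edges at its
  corner to be occupied, so the face edges decide whether the corner is visited.\<close>

definition active :: "bool list \<Rightarrow> nat \<Rightarrow> bool" where
  "active s i \<longleftrightarrow> s ! i \<or> s ! ((i + 5) mod 6)"

definition num_classes :: "nat list \<Rightarrow> bool list \<Rightarrow> nat" where
  "num_classes lab s = length (remdups (map (\<lambda>i. lab ! i) (filter (active s) [0..<6])))"

datatype edge_type = Unequal | Same_side | Opposite_side | Joined | Separate | Vacant

text \<open>At an occupied edge, legs of equal status mean that both turns go to the same side: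
  either both continue along the face or both leave it. At a vacant edge with active ends, both
  adjacent face edges and both legs are occupied.\<close>

definition edge_type :: "nat list \<Rightarrow> nat list \<Rightarrow> bool list \<Rightarrow> nat \<Rightarrow> edge_type" where
  "edge_type lab p s k =
     (let i = k; j = Suc k mod 6 in
      if active s i \<noteq> active s j then Unequal
      else if \<not> active s i then Vacant
      else if s ! k then (if (p ! i = i) = (p ! j = j) then Same_side else Opposite_side)
      else if lab ! i = lab ! j then Joined else Separate)"

text \<open>
  Contributions of the edges as polynomials in \<open>r\<^sup>2 = 1 / x\<^sup>2\<close>, given by their coefficients.  The
  constants are those of \<open>weight_ratios\<close> without the common factor \<open>\<kappa>\<close>, and \<open>[-2, 4, -1]\<close> is \<open>n\<close>.
  Named functions in place of abstractions prevent \<open>code_simp\<close> from evaluating open terms.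
\<close>

fun add_coeffs :: "int list \<Rightarrow> int list \<Rightarrow> int list" where
  "add_coeffs [] q = q"
| "add_coeffs p [] = p"
| "add_coeffs (a # p) (b # q) = (a + b) # add_coeffs p q"

fun mult_coeffs :: "int list \<Rightarrow> int list \<Rightarrow> int list" where
  "mult_coeffs [] q = []"
| "mult_coeffs (a # p) q = add_coeffs (map ((*) a) q) (0 # mult_coeffs p q)"

fun loop_coeffs :: "nat \<Rightarrow> int list" where
  "loop_coeffs 0 = [1]"
| "loop_coeffs (Suc k) = mult_coeffs [-2, 4, -1] (loop_coeffs k)"

fun edge_coeffs :: "nat \<Rightarrow> edge_type \<Rightarrow> int list" where
  "edge_coeffs N Unequal = mult_coeffs [-2, 2, -1] (loop_coeffs (N - 1))"
| "edge_coeffs N Same_side = mult_coeffs [-2, 0, 1] (loop_coeffs (N - 1))"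
| "edge_coeffs N Opposite_side = mult_coeffs [-2, 2] (loop_coeffs (N - 1))"
| "edge_coeffs N Joined =
     add_coeffs (mult_coeffs [-2, 2, -2] (loop_coeffs (N - 1))) (mult_coeffs [0, 2] (loop_coeffs N))"
| "edge_coeffs N Separate =
     add_coeffs (mult_coeffs [-2, 2, -2] (loop_coeffs (N - 1))) (mult_coeffs [0, 2] (loop_coeffs (N - 2)))"
| "edge_coeffs N Vacant = []"

definition edge_poly_at ::
    "nat list \<Rightarrow> nat \<Rightarrow> int list \<Rightarrow> nat list \<Rightarrow> bool list \<Rightarrow> nat \<Rightarrow> int list" where
  "edge_poly_at lab N z p s k = z @ edge_coeffs N (edge_type lab p s k)"

text \<open>With \<open>m\<close> occupied edges, \<open>x ^ m = x ^ 6 * r ^ (6 - m)\<close>. The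
  prepended zeros multiply by the even part of \<open>r ^ (6 - m)\<close>, as a power of
  \<open>r\<^sup>2\<close>; a remaining single factor \<open>r\<close> is common to a state and its
  complement.\<close>

definition label_polys :: "nat list \<Rightarrow> nat list \<Rightarrow> bool list \<Rightarrow> int list list" where
  "label_polys lab p s = map (edge_poly_at lab (num_classes lab s)
     (replicate ((6 - length (filter id s)) div 2) 0) p s) [0..<6]"

definition face_polys :: "nat list \<Rightarrow> bool list \<Rightarrow> int list list" where
  "face_polys p s = label_polys (labels p s) p s"

text \<open>For \<open>i = 0\<close> and \<open>i = 1\<close> its vanishing gives the two equations
  of the theorem for a face listed from edge 0, with all indices below 6.\<close>

definition imbalance :: "(nat \<Rightarrow> real) \<Rightarrow> nat \<Rightarrow> real" where
  "imbalance T i = T (i + 3) + T (i + 4) - T i - T (i + 1)"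

definition imbalance_coeffs :: "int list list \<Rightarrow> nat \<Rightarrow> int list" where
  "imbalance_coeffs P i = add_coeffs (add_coeffs (P ! (i + 3)) (P ! (i + 4)))
     (map uminus (add_coeffs (P ! i) (P ! (i + 1))))"

definition cancelling_at :: "int list list \<Rightarrow> int list list \<Rightarrow> nat \<Rightarrow> bool" where
  "cancelling_at P Q i \<longleftrightarrow> list_all ((=) 0) (add_coeffs (imbalance_coeffs P i) (imbalance_coeffs Q i))"

definition cancelling :: "bool list \<Rightarrow> nat list \<Rightarrow> bool" where
  "cancelling s p \<longleftrightarrow> list_all (cancelling_at (face_polys p s) (face_polys p (map Not s))) [0, 1]"

text \<open>The parity condition at the corners, as the leg at \<open>k\<close> is occupied exactly
  if \<open>p ! k \<noteq> k\<close>.\<close>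

definition compatible :: "nat list \<Rightarrow> bool list \<Rightarrow> bool" where
  "compatible p s \<longleftrightarrow> length s = 6 \<and> (\<forall>k<6. (s ! k = s ! ((k + 5) mod 6)) = (p ! k = k))"

text \<open>Going round the face, the legs determine each edge from the preceding one. Of the two
  complementary solutions this is the one with edge 0 vacant.\<close>

definition face_edges :: "nat list \<Rightarrow> bool list" where
  "face_edges p = (let s1 = (p ! 1 \<noteq> 1); s2 = (s1 \<noteq> (p ! 2 \<noteq> 2)); s3 = (s2 \<noteq> (p ! 3 \<noteq> 3));
     s4 = (s3 \<noteq> (p ! 4 \<noteq> 4)); s5 = (s4 \<noteq> (p ! 5 \<noteq> 5)) in [False, s1, s2, s3, s4, s5])"

lemma all_less_6: "(\<forall>k<6. P k) \<longleftrightarrow> P 0 \<and> P 1 \<and> P 2 \<and> P 3 \<and> P 4 \<and> P (5::nat)"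
proof
  assume *: "P 0 \<and> P 1 \<and> P 2 \<and> P 3 \<and> P 4 \<and> P 5"
  show "\<forall>k<6. P k"
  proof (intro allI impI)
    fix k :: nat assume "k < 6"
    then have "k = 0 \<or> k = 1 \<or> k = 2 \<or> k = 3 \<or> k = 4 \<or> k = 5" by auto
    with * show "P k" by auto
  qed
qed simp

lemma compatible_face_edges:
  assumes "compatible p s"
  shows "s = face_edges p \<or> s = map Not (face_edges p)"
proof -
  have "length s = Suc (Suc (Suc (Suc (Suc (Suc 0)))))" using assms by (simp add: compatible_def)
  then obtain s0 s1 s2 s3 s4 s5 where s: "s = [s0, s1, s2, s3, s4, s5]"
    unfolding length_Suc_conv length_0_conv by blast
  have "(s0 = s5) = (p ! 0 = 0)" "(s1 = s0) = (p ! 1 = 1)" "(s2 = s1) = (p ! 2 = 2)"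
    "(s3 = s2) = (p ! 3 = 3)" "(s4 = s3) = (p ! 4 = 4)" "(s5 = s4) = (p ! 5 = 5)"
    using assms unfolding compatible_def s all_less_6 by simp_all
  note this(2-6)[symmetric]
  then show ?thesis unfolding s face_edges_def Let_def by (cases s0; cases s1; cases s2; cases s3; cases s4; cases s5; simp)
qed

text \<open>Involutions with non-crossing arcs, vacant legs being fixed points. The conditions on
  position \<open>j\<close> involve earlier positions only, which lets \<open>extends\<close> prune
  lists while they are being built.\<close>

definition noncrossing :: "nat list \<Rightarrow> bool" where
  "noncrossing p \<longleftrightarrow> length p = 6 \<and> (\<forall>j<6. p ! j < 6 \<and>
     (\<forall>i<j. (p ! i = j \<longleftrightarrow> p ! j = i) \<and> (j < p ! i \<longrightarrow> i \<le> p ! j \<and> p ! j \<le> p ! i)))"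

definition extends :: "nat list \<Rightarrow> nat \<Rightarrow> bool" where
  "extends p q \<longleftrightarrow> list_all (\<lambda>i. (p ! i = length p \<longleftrightarrow> q = i) \<and>
      (length p < p ! i \<longrightarrow> i \<le> q \<and> q \<le> p ! i)) [0..<length p]"

fun extensions :: "nat \<Rightarrow> nat list \<Rightarrow> nat list list" where
  "extensions 0 p = [p]"
| "extensions (Suc k) p =
     concat (map (\<lambda>q. if extends p q then extensions k (p @ [q]) else []) [0..<6])"

text \<open>Induction on the number of entries still to be chosen: each prefix of \<open>p\<close>
  passes the test for its next entry.\<close>

lemma noncrossing_extensions:
  assumes "noncrossing p"
  shows "p \<in> set (extensions 6 [])"
proof -
  have "p \<in> set (extensions k (take (6 - k) p))" if "k \<le> 6" for k
    using that
  proof (induction k)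
    case 0
    then show ?case using assms by (simp add: noncrossing_def)
  next
    case (Suc k)
    define m where "m = 6 - Suc k"
    have m: "6 - k = Suc m" "m < 6" using Suc.prems by (auto simp: m_def)
    have len: "length p = 6" using assms by (simp add: noncrossing_def)
    have "\<forall>i<m. (p ! i = m \<longleftrightarrow> p ! m = i) \<and> (m < p ! i \<longrightarrow> i \<le> p ! m \<and> p ! m \<le> p ! i)"
      using assms m(2) unfolding noncrossing_def by blast
    then have "extends (take m p) (p ! m)"
      using m(2) len by (simp add: extends_def list_all_iff)
    moreover have "take (Suc m) p = take m p @ [p ! m]" using m len by (simp add: take_Suc_conv_app_nth)
    moreover have "p ! m < 6" using assms m by (simp add: noncrossing_def)
    ultimately show ?case using Suc m unfolding m_def[symmetric] by (auto intro!: bexI[of _ "p ! m"])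
  qed
  from this[of 6] show ?thesis by simp
qed

text \<open>One of the two compatible states is enough, since the sum over a state and its
  complement is symmetric.\<close>

definition balanced :: "nat list \<Rightarrow> bool" where
  "balanced p \<longleftrightarrow> cancelling (face_edges p) p"

text \<open>A computation with the 51 non-crossing matchings.\<close>

lemma extensions_balanced: "list_all balanced (extensions 6 [])"
  by code_simp

lemma add_coeffs_commute: "add_coeffs p q = add_coeffs q p"
proof (induction p q rule: add_coeffs.induct)
  case (1 q)
  then show ?case by (cases q) simp_all
qed simp_all

lemma face_polys_cancel:
  assumes "noncrossing p" "compatible p s" "i < 2"
  shows "list_all ((=) 0) (add_coeffs (imbalance_coeffs (face_polys p s) i)
    (imbalance_coeffs (face_polys p (map Not s)) i))"
proof -
  have "list_all ((=) 0) (add_coeffs (imbalance_coeffs (face_polys p (face_edges p)) i)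
      (imbalance_coeffs (face_polys p (map Not (face_edges p))) i))"
    using extensions_balanced noncrossing_extensions[OF assms(1)] assms(3)
    by (auto simp: list_all_iff balanced_def cancelling_def cancelling_at_def less_2_cases_iff)
  moreover have "map Not (map Not s) = s" for s by (induction s) auto
  ultimately show ?thesis
    using compatible_face_edges[OF assms(2)] by (metis add_coeffs_commute)
qed

section \<open>From coefficient lists to real numbers\<close>

definition eval_coeffs :: "int list \<Rightarrow> real \<Rightarrow> real" where
  "eval_coeffs p y = foldr (\<lambda>a b. of_int a + y * b) p 0"

lemma eval_coeffs_simps [simp]:
  "eval_coeffs [] y = 0" "eval_coeffs (a # p) y = of_int a + y * eval_coeffs p y"
  by (simp_all add: eval_coeffs_def)

lemma eval_coeffs_add [simp]: "eval_coeffs (add_coeffs p q) y = eval_coeffs p y + eval_coeffs q y"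
  by (induction p q rule: add_coeffs.induct) (simp_all add: algebra_simps)

lemma eval_coeffs_scale [simp]: "eval_coeffs (map ((*) a) p) y = of_int a * eval_coeffs p y"
  by (induction p) (simp_all add: algebra_simps)

lemma eval_coeffs_uminus [simp]: "eval_coeffs (map uminus p) y = - eval_coeffs p y"
  by (induction p) (simp_all add: algebra_simps)

lemma eval_coeffs_mult [simp]: "eval_coeffs (mult_coeffs p q) y = eval_coeffs p y * eval_coeffs q y"
  by (induction p) (simp_all add: algebra_simps)

lemma eval_coeffs_shift [simp]: "eval_coeffs (replicate m 0 @ p) y = y ^ m * eval_coeffs p y"
  by (induction m) (simp_all add: algebra_simps)

lemma eval_coeffs_zero: "list_all ((=) 0) p \<Longrightarrow> eval_coeffs p y = 0"
  by (induction p) simp_all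

text \<open>If \<open>N\<close> components meet the face, the number of loops is
  \<open>N - 1\<close> up to a summand that the flip preserves. The weight \<open>W2\<close> comes
  with a further factor \<open>n\<close> for \<open>Joined\<close> and \<open>1 / n\<close> for
  \<open>Separate\<close>, whence the exponents \<open>N\<close> and \<open>N - 2\<close>.\<close>

fun edge_value :: "real \<Rightarrow> real \<Rightarrow> real \<Rightarrow> real \<Rightarrow> real \<Rightarrow> real \<Rightarrow> nat \<Rightarrow> edge_type \<Rightarrow> real" where
  "edge_value n U1 U2 V W1 W2 N Unequal = n ^ (N - 1) * U1"
| "edge_value n U1 U2 V W1 W2 N Same_side = n ^ (N - 1) * U2"
| "edge_value n U1 U2 V W1 W2 N Opposite_side = n ^ (N - 1) * V"
| "edge_value n U1 U2 V W1 W2 N Joined = n ^ (N - 1) * W1 + n ^ N * W2"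
| "edge_value n U1 U2 V W1 W2 N Separate = n ^ (N - 1) * W1 + n ^ (N - 2) * W2"
| "edge_value n U1 U2 V W1 W2 N Vacant = 0"

lemma face_cancel:
  fixes n x r \<kappa> U1 U2 V W1 W2 :: real
  assumes "noncrossing p" "compatible p s" "i < 2"
    and "r \<noteq> 0" "x = 1 / r" "n = - (r ^ 4) + 4 * r ^ 2 - 2"
    and "U1 = \<kappa> * (2 * r ^ 2 - r ^ 4 - 2)" "U2 = \<kappa> * (r ^ 4 - 2)" "V = \<kappa> * (2 * r ^ 2 - 2)"
    and "W1 = \<kappa> * (2 * r ^ 2 - 2 * r ^ 4 - 2)" "W2 = \<kappa> * (2 * r ^ 2)"
    and T: "\<And>s k. T s k = x ^ length (filter id s) *
      edge_value n U1 U2 V W1 W2 (num_classes (labels p s) s) (edge_type (labels p s) p s k)"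
  shows "imbalance (T s) i + imbalance (T (map Not s)) i = 0"
proof -
  define y where "y = r ^ 2"
  have r4: "r ^ 4 = y ^ 2" by (simp add: y_def)
  have "eval_coeffs [-2, 4, -1] y = n" by (simp add: assms(6) y_def algebra_simps power_numeral_reduce)
  then have n: "eval_coeffs (loop_coeffs k) y = n ^ k" for k
    by (induction k) (simp, simp only: loop_coeffs.simps eval_coeffs_mult power_Suc)
  have edge: "edge_value n U1 U2 V W1 W2 N t = \<kappa> * eval_coeffs (edge_coeffs N t) y" for N t
    by (cases t; simp add: n assms(7-11) r4 y_def[symmetric]; simp add: algebra_simps power2_eq_square)
  \<comment> \<open>The numbers of occupied edges of \<open>s\<close> and of its complement add up
    to 6, so they share this parity.\<close>
  define \<epsilon> where "\<epsilon> = length (filter id s) mod 2"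
  have T': "T s k = x ^ 6 * (\<kappa> * (r ^ \<epsilon> * eval_coeffs (face_polys p s ! k) y))"
    if "length s = 6" "length (filter id s) mod 2 = \<epsilon>" "k < 6" for s k
  proof -
    define m where "m = length (filter id s)"
    have m: "m \<le> 6" "m mod 2 = \<epsilon>" using that length_filter_le[of id s] by (simp_all add: m_def)
    have "x ^ 6 = x ^ m * x ^ (6 - m)" using m(1) by (simp flip: power_add)
    moreover have "x ^ (6 - m) * r ^ (6 - m) = 1" using assms(4,5) by (simp flip: power_mult_distrib)
    ultimately have "x ^ m = x ^ 6 * r ^ (6 - m)" by (simp add: mult.assoc)
    moreover have "6 - m = \<epsilon> + 2 * ((6 - m) div 2)" using m by presburger
    then have "r ^ (6 - m) = r ^ \<epsilon> * y ^ ((6 - m) div 2)"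
      unfolding y_def by (metis power_add power_mult)
    moreover have "face_polys p s ! k = replicate ((6 - m) div 2) 0 @
        edge_coeffs (num_classes (labels p s) s) (edge_type (labels p s) p s k)"
      using that(3) by (simp add: face_polys_def label_polys_def edge_poly_at_def m_def del: upt_Suc)
    ultimately show ?thesis unfolding T edge m_def[symmetric] by simp
  qed
  have imb: "imbalance (T s) i = x ^ 6 * (\<kappa> * (r ^ \<epsilon> * eval_coeffs (imbalance_coeffs (face_polys p s) i) y))"
    if "length s = 6" "length (filter id s) mod 2 = \<epsilon>" for s
    using T'[OF that, of i] T'[OF that, of "i + 1"] T'[OF that, of "i + 3"] T'[OF that, of "i + 4"] assms(3)
    unfolding imbalance_def imbalance_coeffs_def by (simp add: algebra_simps)
  have len: "length s = 6" using assms(2) by (simp add: compatible_def)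
  have "length (filter id s) + length (filter id (map Not s)) = length s" for s by (induction s) auto
  from this[of s] have "length (filter id (map Not s)) mod 2 = \<epsilon>"
    unfolding len \<epsilon>_def by presburger
  then have "imbalance (T s) i + imbalance (T (map Not s)) i = x ^ 6 * (\<kappa> * (r ^ \<epsilon> * eval_coeffs
      (add_coeffs (imbalance_coeffs (face_polys p s) i) (imbalance_coeffs (face_polys p (map Not s)) i)) y))"
    using imb[of s] imb[of "map Not s"] len by (simp add: \<epsilon>_def algebra_simps)
  then show ?thesis unfolding eval_coeffs_zero[OF face_polys_cancel[OF assms(1-3)]] by simp
qed

section \<open>Correctness of the relabelling\<close>

definition linked :: "(nat \<times> nat) list \<Rightarrow> nat \<Rightarrow> nat \<Rightarrow> bool" where
  "linked es i j \<longleftrightarrow> (i, j) \<in> (set es \<union> (set es)\<inverse>)\<^sup>*"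

text \<open>Induction from the end of the list, because \<open>fold\<close> applies the last link
  last. That link merges exactly the classes of its two ends.\<close>

lemma linked_fold_relabel:
  assumes "\<And>e. e \<in> set es \<Longrightarrow> fst e < n \<and> snd e < n" "i < n" "j < n"
  shows "fold relabel es [0..<n] ! i = fold relabel es [0..<n] ! j \<longleftrightarrow> linked es i j"
  using assms
proof (induction es arbitrary: i j rule: rev_induct)
  case Nil
  then show ?case by (simp add: linked_def)
next
  case (snoc e es)
  define lab where "lab = fold relabel es [0..<n]"
  have len: "length (fold relabel es xs) = length xs" for es xs
    by (induction es arbitrary: xs) (auto simp: relabel_def)
  obtain a b where e: "e = (a, b)" "a < n" "b < n" using snoc.prems(1)[of e] by (cases e) auto
  have IH: "lab ! i = lab ! j \<longleftrightarrow> linked es i j" if "i < n" "j < n" for i j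
    using snoc.IH that snoc.prems(1) unfolding lab_def by simp
  have new: "fold relabel (es @ [e]) [0..<n] ! i = (if lab ! i = lab ! a then lab ! b else lab ! i)" if "i < n" for i
    using that e len[of es "[0..<n]"] by (simp add: relabel_def lab_def)
  let ?R = "set (es @ [e]) \<union> (set (es @ [e]))\<inverse>"
  have mono: "linked (es @ [e]) i j" if "linked es i j" for i j
    using that unfolding linked_def by (rule rtrancl_mono[THEN subsetD, rotated]) auto
  have tr: "linked (es @ [e]) i k" if "linked (es @ [e]) i j" "linked (es @ [e]) j k" for i j k
    using that unfolding linked_def by (rule rtrancl_trans)
  have ab: "linked (es @ [e]) a b" "linked (es @ [e]) b a" unfolding linked_def e(1) by auto
  show ?case
  proof
    assume "fold relabel (es @ [e]) [0..<n] ! i = fold relabel (es @ [e]) [0..<n] ! j"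
    then have "lab ! i = lab ! j \<or> lab ! i = lab ! a \<and> lab ! b = lab ! j \<or> lab ! i = lab ! b \<and> lab ! a = lab ! j"
      unfolding new[OF snoc.prems(2)] new[OF snoc.prems(3)] by (auto split: if_splits)
    then show "linked (es @ [e]) i j"
      using IH snoc.prems e mono ab tr by meson
  next
    assume "linked (es @ [e]) i j"
    then have "(i, j) \<in> ?R\<^sup>*" by (simp add: linked_def)
    then have "j < n \<and> fold relabel (es @ [e]) [0..<n] ! i = fold relabel (es @ [e]) [0..<n] ! j"
    proof (induction rule: rtrancl_induct)
      case (step y z)
      have z: "z < n" using step(2) snoc.prems(1) by force
      have "(y, z) \<in> {(a, b), (b, a)} \<or> linked es y z"
        using step(2) unfolding linked_def e(1) by auto
      then have "fold relabel (es @ [e]) [0..<n] ! y = fold relabel (es @ [e]) [0..<n] ! z"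
        using step(3) z IH[of y z] unfolding new[OF z] new[OF step(3)[THEN conjunct1]] by auto
      with step(3) z show ?case by simp
    qed (use snoc.prems in simp)
    then show "fold relabel (es @ [e]) [0..<n] ! i = fold relabel (es @ [e]) [0..<n] ! j" ..
  qed
qed

lemma labels_eq_iff:
  assumes "\<And>k. k < 6 \<Longrightarrow> p ! k < 6" "length p = 6" "i < 6" "j < 6"
  shows "labels p s ! i = labels p s ! j \<longleftrightarrow> linked (links p s) i j"
  unfolding labels_def
proof (rule linked_fold_relabel[OF _ assms(3,4)])
  fix e assume "e \<in> set (links p s)"
  then show "fst e < 6 \<and> snd e < 6"
    unfolding links_def using assms(1,2) by (auto simp: set_zip)
qed

section \<open>The weights at \<open>\<theta> = \<pi> / 3\<close>\<close>

text \<open>\<open>\<kappa>\<close> is half the logarithmic derivative of \<open>wt_t\<close> at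
  \<open>pi / 3\<close>, which accounts for the summand \<open>- 2\<close> in the first four ratios.
  \<open>wt_w2\<close> vanishes at \<open>pi / 3\<close>, so its derivative comes only from the
  vanishing sine, and no such summand appears.\<close>

lemma weight_ratios:
  fixes \<sigma> :: real
  defines "\<alpha> \<equiv> pi / 3 * (\<sigma> - 1)"
  defines "r \<equiv> 2 * cos \<alpha>"
  defines "\<kappa> \<equiv> (\<sigma> - 1) / (16 * sin \<alpha> * cos \<alpha> ^ 3)"
  assumes "sin \<alpha> \<noteq> 0" "cos \<alpha> \<noteq> 0"
  shows "deriv_at_third wt_u1 \<sigma> / at_third wt_u1 \<sigma> = \<kappa> * (2 * r ^ 2 - r ^ 4 - 2)"
    "deriv_at_third wt_u2 \<sigma> / at_third wt_u2 \<sigma> = \<kappa> * (r ^ 4 - 2)"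
    "deriv_at_third wt_v \<sigma> / at_third wt_v \<sigma> = \<kappa> * (2 * r ^ 2 - 2)"
    "deriv_at_third wt_w1 \<sigma> / at_third wt_w1 \<sigma> = \<kappa> * (2 * r ^ 2 - 2 * r ^ 4 - 2)"
    "deriv_at_third wt_w2 \<sigma> / at_third wt_w1 \<sigma> = \<kappa> * (2 * r ^ 2)"
proof -
  define s c where "s = sin \<alpha>" and "c = cos \<alpha>"
  have sc: "s \<noteq> 0" "c \<noteq> 0" using assms(4,5) by (simp_all add: s_def c_def)
  have pyth: "s ^ 2 = 1 - c ^ 2" by (simp add: s_def c_def sin_squared_eq)
  have angles: "2 * pi / 3 * (\<sigma> - 1) = 2 * \<alpha>" "pi / 3 * (\<sigma> - 1) = \<alpha>" "(pi / 3 - pi / 3) * (\<sigma> - 1) = 0"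
    "(2 * pi / 3 - pi / 3) * (\<sigma> - 1) = \<alpha>" "(pi - pi / 3) * (\<sigma> - 1) = 2 * \<alpha>"
    by (simp_all add: \<alpha>_def field_simps)
  have "2 * pi * (\<sigma> - 1) / 3 = 2 * \<alpha>" by (simp add: \<alpha>_def field_simps)
  have double: "sin (2 * \<alpha>) = 2 * s * c" "cos (2 * \<alpha>) = 2 * c ^ 2 - 1"
    by (simp_all add: s_def c_def sin_double cos_double_cos)
  let ?t = "8 * s ^ 2 * c ^ 3"
  let ?T = "wt_t \<sigma> (pi / 3)"
  let ?t' = "(\<sigma> - 1) * s"
  have t: "wt_t \<sigma> (pi / 3) = ?t"
    unfolding wt_t_def angles double s_def[symmetric] using sc by (simp add: power_mult_distrib field_simps power_numeral_reduce)
  have t_nz: "wt_t \<sigma> (pi / 3) \<noteq> 0" unfolding t using sc by simp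
  \<comment> \<open>All the sines have arguments affine in \<open>\<theta>\<close>, so the four
    derivatives in \<open>S\<close> are instances of one rule.\<close>
  have sinD: "((\<lambda>\<theta>. sin ((a + b * \<theta>) * (\<sigma> - 1))) has_real_derivative b * (\<sigma> - 1) * cos ((a + b * (pi / 3)) * (\<sigma> - 1))) (at (pi / 3))"
    for a b by (auto intro!: derivative_eq_intros)
  have S: "((\<lambda>\<theta>. sin (\<theta> * (\<sigma> - 1))) has_real_derivative (\<sigma> - 1) * c) (at (pi / 3))"
    "((\<lambda>\<theta>. sin ((pi - \<theta>) * (\<sigma> - 1))) has_real_derivative - (\<sigma> - 1) * (2 * c ^ 2 - 1)) (at (pi / 3))"
    "((\<lambda>\<theta>. sin ((2 * pi / 3 - \<theta>) * (\<sigma> - 1))) has_real_derivative - (\<sigma> - 1) * c) (at (pi / 3))"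
    "((\<lambda>\<theta>. sin ((\<theta> - pi / 3) * (\<sigma> - 1))) has_real_derivative (\<sigma> - 1)) (at (pi / 3))"
    using sinD[of 0 1] sinD[of pi "-1"] sinD[of "2 * pi / 3" "-1"] sinD[of "- pi / 3" 1] double angles
      \<open>2 * pi * (\<sigma> - 1) / 3 = 2 * \<alpha>\<close>
    by (simp_all add: c_def)
  have tD: "(wt_t \<sigma> has_real_derivative ?t') (at (pi / 3))"
    unfolding wt_t_def
    by (rule derivative_eq_intros S refl)+ (simp add: angles s_def \<alpha>_def)
  have quotient: "deriv (\<lambda>\<theta>. 1 / wt_t \<sigma> \<theta> * A \<theta> * B \<theta>) (pi / 3) =
      (A' * B (pi / 3) + A (pi / 3) * B') / ?T - A (pi / 3) * B (pi / 3) * ?t' / ?T ^ 2"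
    if "(A has_real_derivative A') (at (pi / 3))" "(B has_real_derivative B') (at (pi / 3))" for A B A' B'
  proof -
    have "((\<lambda>\<theta>. 1 / wt_t \<sigma> \<theta>) has_real_derivative - ?t' / ?T ^ 2) (at (pi / 3))"
      by (rule derivative_eq_intros tD refl t_nz)+ (simp add: power2_eq_square)
    then have "((\<lambda>\<theta>. 1 / wt_t \<sigma> \<theta> * A \<theta> * B \<theta>) has_real_derivative
        (- ?t' / ?T ^ 2 * A (pi / 3) + A' * (1 / ?T)) * B (pi / 3) + B' * (1 / ?T * A (pi / 3))) (at (pi / 3))"
      using that by (intro DERIV_mult)
    then show ?thesis by (intro DERIV_imp_deriv, elim DERIV_cong) (simp add: algebra_simps add_divide_distrib diff_divide_distrib)
  qed
  have const: "((\<lambda>\<theta>. sin (2 * pi / 3 * (\<sigma> - 1))) has_real_derivative 0) (at (pi / 3))" by simp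
  note defs = at_third_def deriv_at_third_def wt_u1_def wt_u2_def wt_v_def wt_w1_def wt_w2_def
  have \<kappa>: "\<kappa> = (\<sigma> - 1) / (16 * s * c ^ 3)" by (simp add: \<kappa>_def s_def c_def)
  have r: "r = 2 * c" by (simp add: r_def c_def)
  note calc = t angles double s_def[symmetric] c_def[symmetric] \<kappa> r
  show "deriv_at_third wt_u1 \<sigma> / at_third wt_u1 \<sigma> = \<kappa> * (2 * r ^ 2 - r ^ 4 - 2)"
    unfolding defs unfolding quotient[OF S(2) const] unfolding calc using sc by (simp add: field_simps power_numeral_reduce)
  show "deriv_at_third wt_u2 \<sigma> / at_third wt_u2 \<sigma> = \<kappa> * (r ^ 4 - 2)"
    unfolding defs unfolding quotient[OF S(1) const] unfolding calc using sc by (simp add: field_simps power_numeral_reduce)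
  show "deriv_at_third wt_v \<sigma> / at_third wt_v \<sigma> = \<kappa> * (2 * r ^ 2 - 2)"
    unfolding defs unfolding quotient[OF S(1,2)] unfolding calc using sc by (simp add: field_simps power_numeral_reduce)
  show "deriv_at_third wt_w1 \<sigma> / at_third wt_w1 \<sigma> = \<kappa> * (2 * r ^ 2 - 2 * r ^ 4 - 2)"
    unfolding defs unfolding quotient[OF S(3,2)] unfolding calc using sc by (simp add: field_simps power_numeral_reduce)
  show "deriv_at_third wt_w2 \<sigma> / at_third wt_w1 \<sigma> = \<kappa> * (2 * r ^ 2)"
    unfolding defs unfolding quotient[OF S(4,1)] unfolding calc using sc by (simp add: field_simps power_numeral_reduce)
qed

text \<open>In both regimes \<open>cos (4 * \<alpha>) = - n / 2\<close>, and two half-angle steps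
  lead to \<open>r\<close>. The regimes differ in the sign of the square root for
  \<open>cos (2 * \<alpha>)\<close>, recorded as \<open>\<epsilon>\<close>; the bounds on
  \<open>n\<close> keep \<open>- \<alpha>\<close> strictly between 0 and
  \<open>pi / 2\<close>.\<close>

lemma critical_angle:
  fixes n x \<sigma> :: real
  defines "\<alpha> \<equiv> pi / 3 * (\<sigma> - 1)"
  defines "r \<equiv> 2 * cos \<alpha>"
  assumes "0 \<le> n" "n \<le> 2"
    and "x = 1 / sqrt (2 + sqrt (2 - n)) \<and> \<sigma> = 1 - 3 / (4 * pi) * arccos (- n / 2) \<or>
         x = 1 / sqrt (2 - sqrt (2 - n)) \<and> \<sigma> = 1 - 3 / (4 * pi) * (2 * pi - arccos (- n / 2))"
  shows "sin \<alpha> \<noteq> 0" "cos \<alpha> \<noteq> 0" "x = 1 / r" "n = - (r ^ 4) + 4 * r ^ 2 - 2"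
proof -
  define \<phi> where "\<phi> = arccos (- n / 2)"
  have \<phi>: "cos \<phi> = - n / 2" "0 \<le> \<phi>" "\<phi> \<le> pi"
    using assms(3,4) by (auto simp: \<phi>_def cos_arccos arccos_lbound arccos_ubound)
  have "\<phi> \<ge> pi / 2" 
    using arccos_le_arccos[of "- n / 2" 0] assms(3,4) by (simp add: \<phi>_def)
  \<comment> \<open>At \<open>n = 2\<close> the two regimes coincide, and \<open>\<epsilon>\<close>
    is 1.\<close>
  define \<epsilon> :: real where "\<epsilon> = (if x = 1 / sqrt (2 + sqrt (2 - n)) \<and> \<sigma> = 1 - 3 / (4 * pi) * \<phi> then 1 else -1)"
  have cases: "\<epsilon> = 1 \<and> x = 1 / sqrt (2 + sqrt (2 - n)) \<and> \<alpha> = - \<phi> / 4 \<or>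
      \<epsilon> = -1 \<and> x = 1 / sqrt (2 - sqrt (2 - n)) \<and> \<alpha> = - (2 * pi - \<phi>) / 4"
  proof -
    have "\<alpha> = - q / 4" if "\<sigma> = 1 - 3 / (4 * pi) * q" for q using that by (simp add: \<alpha>_def)
    from this[of "arccos (- n / 2)"] this[of "2 * pi - arccos (- n / 2)"]
    show ?thesis using assms(5) unfolding \<epsilon>_def \<phi>_def by argo
  qed
  from cases have range: "0 < - \<alpha> \<and> - \<alpha> < pi / 2"
  proof (elim disjE conjE)
    assume "\<alpha> = - \<phi> / 4"
    then show ?thesis using \<phi>(3) \<open>\<phi> \<ge> pi / 2\<close> pi_gt_zero by (intro conjI; linarith)
  next
    assume "\<alpha> = - (2 * pi - \<phi>) / 4"
    then have "4 * \<alpha> = \<phi> - 2 * pi" by simp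
    then show ?thesis using \<phi>(3) \<open>\<phi> \<ge> pi / 2\<close> pi_gt_zero by (intro conjI; linarith)
  qed
  have "sin (- \<alpha>) > 0" by (rule sin_gt_zero) (use range pi_gt_zero in linarith)+
  moreover have "cos (- \<alpha>) > 0" by (rule cos_gt_zero) (use range in linarith)+
  ultimately have "sin \<alpha> \<noteq> 0" and cpos: "cos \<alpha> > 0" by auto
  then show "sin \<alpha> \<noteq> 0" "cos \<alpha> \<noteq> 0" by auto
  have "4 * \<alpha> = - \<phi> \<or> 4 * \<alpha> = - (2 * pi - \<phi>)" using cases by auto
  then have "cos (4 * \<alpha>) = - n / 2"
    by (elim disjE) (simp_all only: cos_minus cos_2pi_minus \<phi>(1))
  then have sq: "(2 * cos (2 * \<alpha>)) ^ 2 = 2 - n"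
    using cos_double_cos[of "2 * \<alpha>"] by (simp add: power_mult_distrib)
  have "2 * cos (2 * \<alpha>) = \<epsilon> * sqrt (2 - n)"
    using cases
  proof (elim disjE conjE)
    assume "\<epsilon> = 1" "\<alpha> = - \<phi> / 4"
    then have "2 * \<alpha> = - (\<phi> / 2)" by simp
    then have "cos (2 * \<alpha>) \<ge> 0" using \<phi> by (simp add: cos_ge_zero)
    then have "sqrt (2 - n) = 2 * cos (2 * \<alpha>)" using sq by (intro real_sqrt_unique) auto
    then show ?thesis using \<open>\<epsilon> = 1\<close> by simp
  next
    assume "\<epsilon> = -1" "\<alpha> = - (2 * pi - \<phi>) / 4"
    then have "2 * \<alpha> = - (pi - \<phi> / 2)" by (simp add: field_simps)
    then have "cos (2 * \<alpha>) = - cos (\<phi> / 2)" by (simp add: cos_diff)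
    moreover have "cos (\<phi> / 2) \<ge> 0" using \<phi> by (intro cos_ge_zero) auto
    ultimately have "sqrt (2 - n) = - (2 * cos (2 * \<alpha>))" using sq by (intro real_sqrt_unique) auto
    then show ?thesis using \<open>\<epsilon> = -1\<close> by simp
  qed
  then have r2: "r ^ 2 = 2 + \<epsilon> * sqrt (2 - n)"
    unfolding r_def using cos_double_cos[of \<alpha>] by (simp add: power_mult_distrib)
  have "r > 0" using cpos by (simp add: r_def)
  then have "r = sqrt (2 + \<epsilon> * sqrt (2 - n))" using r2 by (metis less_imp_le real_sqrt_unique)
  then show "x = 1 / r" using cases by auto
  have "(r ^ 2 - 2) ^ 2 = \<epsilon> ^ 2 * (2 - n)" unfolding r2 using assms(4) by (simp add: power_mult_distrib)
  moreover have "\<epsilon> ^ 2 = 1" by (simp add: \<epsilon>_def)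
  ultimately have "(r ^ 2 - 2) ^ 2 = 2 - n" by simp
  then show "n = - (r ^ 4) + 4 * r ^ 2 - 2" by (simp add: power2_eq_square algebra_simps power_numeral_reduce)
qed

section \<open>A face of a domain\<close>

lemma eis_bounded_finite: "finite {(a, b). cmod (eis a b) \<le> K}"
proof -
  have "{(a, b). cmod (eis a b) \<le> K} \<subseteq> {- \<lceil>3 * K\<rceil>..\<lceil>3 * K\<rceil>} \<times> {- \<lceil>3 * K\<rceil>..\<lceil>3 * K\<rceil>}"
  proof (rule subsetI, elim CollectE case_prodE)
    fix x a b assume x: "x = (a, b)" and "cmod (eis a b) \<le> K"
    then have "\<bar>Re (eis a b)\<bar> \<le> K" "\<bar>Im (eis a b)\<bar> \<le> K"
      using abs_Re_le_cmod abs_Im_le_cmod order_trans by blast+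
    then have *: "\<bar>real_of_int a + real_of_int b / 2\<bar> \<le> K" "\<bar>real_of_int b * sqrt 3 / 2\<bar> \<le> K"
      by (simp_all add: eis_def sixth_def cos_60 sin_60)
    have "\<bar>real_of_int b\<bar> * 1 \<le> \<bar>real_of_int b\<bar> * sqrt 3" by (intro mult_left_mono) auto
    then have b: "\<bar>real_of_int b\<bar> \<le> 2 * K" using *(2) by (simp add: abs_mult)
    then have "\<bar>real_of_int a\<bar> \<le> 3 * K" using *(1) by linarith
    moreover have "\<bar>real_of_int b\<bar> \<le> 3 * K" using b by linarith
    ultimately show "x \<in> {- \<lceil>3 * K\<rceil>..\<lceil>3 * K\<rceil>} \<times> {- \<lceil>3 * K\<rceil>..\<lceil>3 * K\<rceil>}"
      unfolding x by (auto; linarith)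
  qed
  then show ?thesis by (rule finite_subset) auto
qed

lemma hex_edge_eis:
  assumes "e \<in> hex_edges" "v \<in> e"
  obtains a b where "v = eis a b"
proof -
  obtain c d where "e \<in> {{eis c d, eis (c + 1) d}, {eis c d, eis (c - 1) (d + 1)}, {eis c d, eis c (d - 1)}}"
    using assms(1) unfolding hex_edges_eis mem_Collect_eq by (elim exE conjE) (rule that)
  with assms(2) have "v \<in> {eis c d, eis (c + 1) d, eis (c - 1) (d + 1), eis c (d - 1)}" by auto
  then show ?thesis using that by blast
qed

lemma finite_hex_edges_bounded:
  assumes "bounded S"
  shows "finite {e \<in> hex_edges. e \<subseteq> S}"
proof -
  obtain K where K: "\<And>x. x \<in> S \<Longrightarrow> cmod x \<le> K" using assms by (auto simp: bounded_iff)
  have "{e \<in> hex_edges. e \<subseteq> S} \<subseteq> Pow ((\<lambda>(a, b). eis a b) ` {(a, b). cmod (eis a b) \<le> K})"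
  proof (intro subsetI PowI)
    fix e v assume e: "e \<in> {e \<in> hex_edges. e \<subseteq> S}" "v \<in> e"
    then obtain a b where v: "v = eis a b" using hex_edge_eis[of e v] by auto
    then have "cmod (eis a b) \<le> K" using e K by auto
    then show "v \<in> (\<lambda>(a, b). eis a b) ` {(a, b). cmod (eis a b) \<le> K}" using v by (intro image_eqI[of _ _ "(a, b)"]) auto
  qed
  then show ?thesis by (rule finite_subset) (simp add: eis_bounded_finite)
qed

text \<open>The inside of a bounded set is bounded, and a bounded region contains finitely many
  lattice points. Hence configurations are finite graphs.\<close>

lemma domain_edges_finite:
  assumes "hex_cycle C" shows "finite (domain_edges C)"
proof -
  have "bounded (convex hull e)" if "e \<in> C" for e
  proof -
    have "e \<in> hex_edges" using that assms by (auto simp: hex_cycle_iff)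
    then obtain u v where "e = {u, v}" using hex_edges_simple by blast
    then have "finite e" by simp
    then show ?thesis by (intro bounded_convex_hull finite_imp_bounded)
  qed
  then have "bounded (cycle_curve C)"
    unfolding cycle_curve_def using hex_cycle_finite[OF assms] by (intro bounded_UN) auto
  then have "bounded (cycle_region C)"
    unfolding cycle_region_def by (intro bounded_Un[THEN iffD2] conjI bounded_inside)
  moreover have "domain_edges C \<subseteq> {e \<in> hex_edges. e \<subseteq> cycle_region C}"
  proof
    fix e assume "e \<in> domain_edges C"
    then show "e \<in> {e \<in> hex_edges. e \<subseteq> cycle_region C}"
      using order_trans[OF hull_subset[of e convex]] by (simp add: domain_edges_def)
  qed
  ultimately show ?thesis using finite_subset[OF _ finite_hex_edges_bounded] by simp
qed

lemma hex_vertex_corner: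
  assumes "e \<in> hex_edges" "v \<in> e"
  obtains z k where "z \<in> hex_face_centres" "v = corner z k"
proof -
  obtain a b where "e = {a, b}" using hex_edges_simple[OF assms(1)] by blast
  with assms obtain w where "{v, w} \<in> hex_edges" by (cases "v = a") (auto simp: insert_commute)
  then show ?thesis using hex_edge_face that by metis
qed

lemma hex_degree_le_3:
  assumes "{v, a} \<in> hex_edges"
  shows "finite {e \<in> hex_edges. v \<in> e}" "card {e \<in> hex_edges. v \<in> e} \<le> 3"
proof -
  obtain z k where z: "z \<in> hex_face_centres" "v = corner z k"
    by (rule hex_vertex_corner[OF assms, of v]) auto
  show "finite {e \<in> hex_edges. v \<in> e}" "card {e \<in> hex_edges. v \<in> e} \<le> 3"
    unfolding z(2) hex_edges_at_corner[OF z(1)] by (simp_all add: card_insert_if)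
qed

lemma centre_not_vertex:
  assumes "z \<in> hex_face_centres" "e \<in> hex_edges"
  shows "z \<notin> e"
proof
  assume "z \<in> e"
  then obtain z' k where z': "z' \<in> hex_face_centres" "z = corner z' k"
    using hex_vertex_corner[OF assms(2)] by metis
  obtain a b p q where *: "(a - b) mod 3 = 2"
    "(p, q) \<in> {(1, 0), (0, 1), (-1, 1), (-1, 0), (0, -1), (1, -1)}" "corner z' k = eis (a + p) (b + q)"
    using corner_eis[OF z'(1), of k] by metis
  have "(a + p - (b + q)) mod 3 = 2"
    using assms(1) unfolding z'(2) *(3) hex_face_centres_eis by auto
  moreover have "(p - q) mod 3 \<noteq> 0" using *(2) by (elim insertE emptyE) simp_all
  ultimately show False using *(1) by presburger
qed

lemma degree_in_Un:
  assumes "finite X" "finite Y" "X \<inter> Y = {}"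
  shows "degree_in (X \<union> Y) v = degree_in X v + degree_in Y v"
proof -
  have "{e \<in> X \<union> Y. v \<in> e} = {e \<in> X. v \<in> e} \<union> {e \<in> Y. v \<in> e}" by blast
  then show ?thesis unfolding degree_in_def using assms by (simp add: card_Un_disjoint disjoint_iff)
qed

lemma degree_in_eq_0: "v \<notin> \<Union>\<omega> \<Longrightarrow> degree_in \<omega> v = 0"
proof -
  assume "v \<notin> \<Union>\<omega>"
  then have "{e \<in> \<omega>. v \<in> e} = {}" by blast
  then show ?thesis unfolding degree_in_def by (simp only: card.empty)
qed

locale face_in_domain =
  fixes C :: "complex set set" and B :: "complex set" and z :: complex
  assumes cycle: "hex_cycle C" and bc: "boundary_condition C B"
    and centre: "z \<in> hex_face_centres"
    and face: "\<And>k. hex_face_edge z k \<in> domain_edges C - C"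
begin

definition face_boundary :: "complex set set" where
  "face_boundary = range (hex_face_edge z)"

lemma face_boundary_eq: "face_boundary = hex_face_edge z ` {..<6}"
proof
  show "face_boundary \<subseteq> hex_face_edge z ` {..<6}"
  proof
    fix e assume "e \<in> face_boundary"
    then obtain k where "e = hex_face_edge z k" by (auto simp: face_boundary_def)
    also have "\<dots> = hex_face_edge z (k mod 6)"
      using sixth_power_mod[of k] unfolding hex_face_edge_corner corner_def by simp
    finally show "e \<in> hex_face_edge z ` {..<6}" by simp
  qed
qed (auto simp: face_boundary_def)

lemma C_hex: "C \<subseteq> hex_edges" and finite_C: "finite C"
  using cycle hex_cycle_finite by (auto simp: hex_cycle_iff)

lemma domain_hex: "domain_edges C \<subseteq> hex_edges"
  by (auto simp: domain_edges_def)

lemma face_boundary_domain: "face_boundary \<subseteq> domain_edges C - C"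
  using face by (auto simp: face_boundary_def)

lemma leg_not_face_boundary: "leg z k \<notin> face_boundary"
  using outer_not_corner[of z k]
  by (auto simp: face_boundary_def hex_face_edge_corner leg_def doubleton_eq_iff)

text \<open>The face edges are not in \<open>C\<close>, so of the edges at a corner only the leg
  could be, whereas a cycle has two edges at each of its vertices.\<close>

lemma corner_not_in_cycle: "corner z k \<notin> \<Union>C"
proof
  assume "corner z k \<in> \<Union>C"
  then obtain a b where ab: "{corner z k, a} \<in> C" "{corner z k, b} \<in> C" "a \<noteq> b"
    using hex_cycle_two_edges[OF cycle] by metis
  have "e = leg z k" if "e \<in> C" "corner z k \<in> e" for e
  proof -
    have "e \<in> {e \<in> hex_edges. corner z k \<in> e}" using that C_hex by auto
    then have "e \<in> {hex_face_edge z k, hex_face_edge z (k + 5), leg z k}"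
      unfolding hex_edges_at_corner[OF centre] .
    then show ?thesis using \<open>e \<in> C\<close> face[of k] face[of "k + 5"] by auto
  qed
  then have "{corner z k, a} = leg z k" "{corner z k, b} = leg z k" using ab by auto
  with ab(3) show False by (auto simp: leg_def doubleton_eq_iff)
qed

lemma domain_vertex: "v \<in> e \<Longrightarrow> e \<in> domain_edges C \<Longrightarrow> v \<in> domain_vertices C"
  unfolding domain_edges_def domain_vertices_def hex_vertices_def using hull_inc[of v e convex] by auto

lemma cycle_vertex: "v \<in> \<Union>C \<Longrightarrow> v \<in> domain_vertices C"
proof -
  assume "v \<in> \<Union>C"
  then obtain e where "e \<in> C" "v \<in> e" by blast
  moreover have "e \<in> domain_edges C"
    using \<open>e \<in> C\<close> C_hex unfolding domain_edges_def cycle_region_def cycle_curve_def by auto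
  ultimately show ?thesis using domain_vertex by blast
qed

lemma B_cases: "B = {} \<or> (\<exists>b b'. B = {b, b'} \<and> b \<noteq> b')"
  and B_cycle: "B \<subseteq> \<Union>C"
  using bc by (auto simp: boundary_condition_def)

lemma finite_B: "finite B" using B_cases by auto

lemma corner_not_in_B: "corner z k \<notin> B"
  using B_cycle corner_not_in_cycle by blast

lemma centre_not_in_B: "z \<notin> B"
  using B_cycle C_hex centre_not_vertex[OF centre] by blast

lemma confD:
  assumes "\<omega> \<in> conf C B"
  shows "simple_graph \<omega>" "\<omega> \<subseteq> hex_edges" "\<omega> \<subseteq> domain_edges C - C"
    "v \<in> B \<Longrightarrow> degree_in \<omega> v = 1" "v \<notin> B \<Longrightarrow> degree_in \<omega> v \<in> {0, 2}"
    "degree_in \<omega> v \<le> 2"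
proof -
  show sub: "\<omega> \<subseteq> domain_edges C - C" using assms by (simp add: conf_def)
  then show hex: "\<omega> \<subseteq> hex_edges" using domain_hex by blast
  have "finite \<omega>" using sub domain_edges_finite[OF cycle] finite_subset by blast
  then show "simple_graph \<omega>" using hex hex_edges_simple unfolding simple_graph_def by blast
  show B: "degree_in \<omega> v = 1" if "v \<in> B" for v
  proof -
    have "v \<in> domain_vertices C" using that B_cycle cycle_vertex by blast
    then show ?thesis using assms that by (auto simp: conf_def)
  qed
  show nB: "degree_in \<omega> v \<in> {0, 2}" if "v \<notin> B" for v
  proof (cases "v \<in> domain_vertices C")
    case True
    then show ?thesis using assms that by (auto simp: conf_def)
  next
    case False
    then have "v \<notin> \<Union>\<omega>" using sub domain_vertex by blast
    then show ?thesis by (simp add: degree_in_eq_0)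
  qed
  show "degree_in \<omega> v \<le> 2" using B[of v] nB[of v] by (cases "v \<in> B") auto
qed

text \<open>Two of the at most three lattice edges at \<open>v\<close> belong to \<open>C\<close>,
  and \<open>\<omega>\<close> is disjoint from \<open>C\<close>, which rules out degree two.\<close>

lemma conf_avoids_cycle:
  assumes "\<omega> \<in> conf C B" "v \<in> \<Union>C" "v \<notin> B"
  shows "v \<notin> \<Union>\<omega>"
proof
  assume "v \<in> \<Union>\<omega>"
  note \<omega> = confD[OF assms(1)]
  have fin: "finite \<omega>" using \<omega>(1) by (simp add: simple_graph_def)
  have "degree_in \<omega> v > 0" using \<open>v \<in> \<Union>\<omega>\<close> degree_in_pos[OF fin] by simp
  then have 2: "card {e \<in> \<omega>. v \<in> e} = 2" using \<omega>(5)[OF assms(3)] by (simp add: degree_in_def)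
  obtain a b where ab: "{v, a} \<in> C" "{v, b} \<in> C" "a \<noteq> b"
    using hex_cycle_two_edges[OF cycle assms(2)] by metis
  have h: "{v, a} \<in> hex_edges" using ab C_hex by blast
  have "card ({{v, a}, {v, b}} \<union> {e \<in> \<omega>. v \<in> e}) = card {{v, a}, {v, b}} + card {e \<in> \<omega>. v \<in> e}"
    using \<omega>(3) ab fin by (intro card_Un_disjoint) auto
  also have "card {{v, a}, {v, b}} = 2" using ab(3) by (simp add: doubleton_eq_iff)
  finally have "card ({{v, a}, {v, b}} \<union> {e \<in> \<omega>. v \<in> e}) = 4" using 2 by simp
  moreover have "card ({{v, a}, {v, b}} \<union> {e \<in> \<omega>. v \<in> e}) \<le> card {e \<in> hex_edges. v \<in> e}"
    using hex_degree_le_3(1)[OF h] ab C_hex \<omega>(2) by (intro card_mono) auto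
  ultimately show False using hex_degree_le_3(2)[OF h] by simp
qed

text \<open>The added edges raise the degrees of \<open>b\<close> and \<open>b'\<close> to two. Once
  the face edges are removed, corners with occupied legs are the only vertices of degree
  one.\<close>

definition closed_up :: "complex set set \<Rightarrow> complex set set" where
  "closed_up \<omega> = \<omega> \<union> (\<lambda>b. {b, z}) ` B"

definition rest :: "complex set set \<Rightarrow> complex set set" where
  "rest \<omega> = \<omega> - face_boundary"

lemma closed_up_degree:
  assumes "\<omega> \<subseteq> hex_edges" "finite \<omega>"
  shows "degree_in (closed_up \<omega>) v = degree_in \<omega> v + (if v \<in> B then 1 else if v = z then card B else 0)"
proof -
  have disj: "\<omega> \<inter> (\<lambda>b. {b, z}) ` B = {}" using assms centre_not_vertex[OF centre] by blast
  have inj: "inj_on (\<lambda>b. {b, z}) X" for X by (auto simp: inj_on_def doubleton_eq_iff)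
  have "{e \<in> (\<lambda>b. {b, z}) ` B. v \<in> e} = (\<lambda>b. {b, z}) ` (if v \<in> B then {v} else if v = z then B else {})"
    using centre_not_in_B by auto
  then have "degree_in ((\<lambda>b. {b, z}) ` B) v = card (if v \<in> B then {v} else if v = z then B else {})"
    unfolding degree_in_def using card_image[OF inj] by metis
  then show ?thesis unfolding closed_up_def using degree_in_Un[OF assms(2) _ disj] finite_B by auto
qed

lemma closed_up_simple:
  assumes "simple_graph \<omega>" shows "simple_graph (closed_up \<omega>)"
  using assms finite_B centre_not_in_B unfolding simple_graph_def closed_up_def by blast

lemma conf_rest_degree:
  assumes "\<omega> \<in> conf C B"
  shows "degree_in (closed_up (rest \<omega>)) (corner z k) = of_bool (leg z k \<in> \<omega>)"
    "(\<And>k. v \<noteq> corner z k) \<Longrightarrow> degree_in (closed_up (rest \<omega>)) v \<in> {0, 2}"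
    "degree_in (closed_up (rest \<omega>)) v \<le> 2"
proof -
  note \<omega> = confD[OF assms]
  have fin: "finite \<omega>" using \<omega>(1) by (simp add: simple_graph_def)
  have R: "rest \<omega> \<subseteq> hex_edges" "finite (rest \<omega>)" using fin \<omega>(2) by (auto simp: rest_def)
  have "corner z k \<noteq> z" for k
  proof -
    have "sixth \<noteq> 0" by (simp add: sixth_def complex_eq_iff cos_60)
    then have "sixth ^ k \<noteq> 0" by simp
    then show ?thesis by (simp add: corner_def)
  qed
  then show corner: "degree_in (closed_up (rest \<omega>)) (corner z k) = of_bool (leg z k \<in> \<omega>)" for k
    unfolding closed_up_degree[OF R] degree_in_corner[OF centre R(1)]
    using corner_not_in_B leg_not_face_boundary by (auto simp: rest_def face_boundary_def)
  have other: "degree_in (closed_up (rest \<omega>)) v \<in> {0, 2}" if "\<And>k. v \<noteq> corner z k" for v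
  proof -
    have "v \<notin> e" if "e \<in> face_boundary" for e
      using that \<open>\<And>k. v \<noteq> corner z k\<close> by (auto simp: face_boundary_def hex_face_edge_corner)
    then have "{e \<in> rest \<omega>. v \<in> e} = {e \<in> \<omega>. v \<in> e}" by (auto simp: rest_def)
    then have deg: "degree_in (rest \<omega>) v = degree_in \<omega> v" by (simp add: degree_in_def)
    have "v = z \<Longrightarrow> degree_in \<omega> v = 0"
      using centre_not_vertex[OF centre] \<omega>(2) by (intro degree_in_eq_0) blast
    moreover have "card B \<in> {0, 2}" using B_cases by auto
    ultimately show ?thesis unfolding closed_up_degree[OF R] deg using \<omega>(4,5)[of v] centre_not_in_B by auto
  qed
  then show "(\<And>k. v \<noteq> corner z k) \<Longrightarrow> degree_in (closed_up (rest \<omega>)) v \<in> {0, 2}" .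
  show "degree_in (closed_up (rest \<omega>)) v \<le> 2"
  proof (cases "\<exists>k. v = corner z k")
    case True
    then obtain k where "v = corner z k" by blast
    then show ?thesis using corner[of k] by simp
  next
    case False
    then have "degree_in (closed_up (rest \<omega>)) v \<in> {0, 2}" by (intro other) auto
    then show ?thesis by auto
  qed
qed

end

section \<open>The strands outside the face\<close>

lemma hex_face_edge_inj:
  assumes "k < 6" "l < 6" "hex_face_edge z k = hex_face_edge z l"
  shows "k = l"
proof -
  have *: "corner z (Suc m) = corner z (Suc m mod 6)" for m using corner_mod6[of z "Suc m"] .
  have "Suc k mod 6 < 6" "Suc l mod 6 < 6" by simp_all
  then have "k = l \<or> k = Suc l mod 6 \<and> Suc k mod 6 = l"
    using assms unfolding hex_face_edge_corner * by (auto simp: doubleton_eq_iff corner_eq_iff)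
  then show ?thesis using assms(1,2) by (auto simp: mod_Suc split: if_splits)
qed

lemma hex_face_edge_mod6: "hex_face_edge z k = hex_face_edge z (k mod 6)"
  using sixth_power_mod[of k] unfolding hex_face_edge_corner corner_def by simp

context face_in_domain begin

text \<open>The value \<open>k\<close> at a vacant leg is the convention of
  \<open>compatible\<close>; \<open>partner_ex1\<close> justifies the description operator.\<close>

definition partner :: "complex set set \<Rightarrow> nat \<Rightarrow> nat" where
  "partner \<omega> k = (if leg z k \<in> \<omega>
     then THE j. j < 6 \<and> j \<noteq> k \<and> connected_in (closed_up (rest \<omega>)) (corner z k) (corner z j) else k)"

lemma simple_closed_rest: "\<omega> \<in> conf C B \<Longrightarrow> simple_graph (closed_up (rest \<omega>))"
  by (intro closed_up_simple simple_graph_subset[OF confD(1)]) (auto simp: rest_def)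

lemma connected_corners_leg:
  assumes "\<omega> \<in> conf C B" "corner z i \<noteq> corner z k"
    "connected_in (closed_up (rest \<omega>)) (corner z i) (corner z k)"
  shows "leg z k \<in> \<omega>"
proof (rule ccontr)
  assume "leg z k \<notin> \<omega>"
  then have "degree_in (closed_up (rest \<omega>)) (corner z k) = 0"
    using conf_rest_degree(1)[OF assms(1)] by simp
  moreover have "finite (closed_up (rest \<omega>))"
    using simple_closed_rest[OF assms(1)] by (simp add: simple_graph_def)
  ultimately show False
    using connected_in_Union[OF assms(3,2)] degree_in_pos[of "closed_up (rest \<omega>)" "corner z k"] by simp
qed

text \<open>By \<open>degree_one_partner\<close> the strand has exactly one other end of degree one,
  and such an end is a corner.\<close>

lemma partner_ex1:
  assumes "\<omega> \<in> conf C B" "k < 6" "leg z k \<in> \<omega>"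
  shows "\<exists>!j. j < 6 \<and> j \<noteq> k \<and> connected_in (closed_up (rest \<omega>)) (corner z k) (corner z j)"
proof -
  let ?G = "closed_up (rest \<omega>)"
  have "\<exists>!v. v \<noteq> corner z k \<and> degree_in ?G v = 1 \<and> connected_in ?G (corner z k) v"
    using degree_one_partner[OF simple_closed_rest[OF assms(1)] conf_rest_degree(3)[OF assms(1)]]
      conf_rest_degree(1)[OF assms(1), of k] assms(3) by simp
  then obtain v where v: "v \<noteq> corner z k" "degree_in ?G v = 1" "connected_in ?G (corner z k) v"
    and uniq: "\<And>w. w \<noteq> corner z k \<Longrightarrow> degree_in ?G w = 1 \<Longrightarrow> connected_in ?G (corner z k) w \<Longrightarrow> w = v"
    by metis
  obtain j where j: "v = corner z j" using v(2) conf_rest_degree(2)[OF assms(1), of v] by fastforce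
  then have j': "v = corner z (j mod 6)" using corner_mod6 by metis
  show ?thesis
  proof (rule ex1I[of _ "j mod 6"])
    show "j mod 6 < 6 \<and> j mod 6 \<noteq> k \<and> connected_in ?G (corner z k) (corner z (j mod 6))"
      using v j' by auto
  next
    fix m assume m: "m < 6 \<and> m \<noteq> k \<and> connected_in ?G (corner z k) (corner z m)"
    then have "corner z k \<noteq> corner z m" using corner_eq_iff[OF assms(2), of m z] by auto
    then have "leg z m \<in> \<omega>" using connected_corners_leg[OF assms(1)] m by blast
    then have "corner z m = v"
      using uniq m \<open>corner z k \<noteq> corner z m\<close> conf_rest_degree(1)[OF assms(1), of m] by simp
    then show "m = j mod 6" using j' m corner_eq_iff[of m "j mod 6" z] by simp
  qed
qed

lemma partner_leg:
  assumes "\<omega> \<in> conf C B" "k < 6" "leg z k \<in> \<omega>"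
  shows "partner \<omega> k < 6" "partner \<omega> k \<noteq> k"
    "connected_in (closed_up (rest \<omega>)) (corner z k) (corner z (partner \<omega> k))"
  using theI'[OF partner_ex1[OF assms]] assms(3) by (simp_all add: partner_def)

lemma partner_less: "\<omega> \<in> conf C B \<Longrightarrow> k < 6 \<Longrightarrow> partner \<omega> k < 6"
  using partner_leg(1) by (cases "leg z k \<in> \<omega>") (auto simp: partner_def)

lemma partner_eq_iff: "\<omega> \<in> conf C B \<Longrightarrow> k < 6 \<Longrightarrow> partner \<omega> k = k \<longleftrightarrow> leg z k \<notin> \<omega>"
  using partner_leg(2) by (cases "leg z k \<in> \<omega>") (auto simp: partner_def)

lemma partner_connected:
  "\<omega> \<in> conf C B \<Longrightarrow> k < 6 \<Longrightarrow> connected_in (closed_up (rest \<omega>)) (corner z k) (corner z (partner \<omega> k))"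
  using partner_leg(3) by (cases "leg z k \<in> \<omega>") (auto simp: partner_def)

lemma partner_unique:
  assumes "\<omega> \<in> conf C B" "i < 6" "k < 6"
    and "connected_in (closed_up (rest \<omega>)) (corner z i) (corner z k)"
  shows "k = i \<or> k = partner \<omega> i"
proof (rule disjCI)
  assume "k \<noteq> partner \<omega> i"
  show "k = i"
  proof (rule ccontr)
    assume "k \<noteq> i"
    then have ne: "corner z k \<noteq> corner z i" using corner_eq_iff[OF assms(3,2)] by simp
    have "leg z i \<in> \<omega>"
      using connected_corners_leg[OF assms(1) ne] connected_in_sym[OF assms(4)] by blast
    from partner_ex1[OF assms(1,2) this] partner_leg[OF assms(1,2) this] \<open>k \<noteq> i\<close> \<open>k \<noteq> partner \<omega> i\<close> assms(3,4)
    show False by blast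
  qed
qed

lemma partner_partner:
  assumes "\<omega> \<in> conf C B" "k < 6"
  shows "partner \<omega> (partner \<omega> k) = k"
proof (cases "leg z k \<in> \<omega>")
  case True
  note p = partner_leg[OF assms True]
  show ?thesis
    using partner_unique[OF assms(1) p(1) assms(2) connected_in_sym[OF p(3)]] p(2) by metis
qed (simp add: partner_def)

lemma closed_rest_corner_edge:
  assumes "\<omega> \<in> conf C B" "{corner z k, w} \<in> closed_up (rest \<omega>)"
  shows "w = outer z k"
proof -
  have "corner z k \<noteq> z" using centre_not_vertex[OF centre, of "hex_face_edge z k"] face[of k] domain_hex
    by (auto simp: hex_face_edge_corner)
  then have "{corner z k, w} \<in> rest \<omega>"
    using assms(2) corner_not_in_B by (auto simp: closed_up_def doubleton_eq_iff)
  then have "{corner z k, w} \<in> {e \<in> hex_edges. corner z k \<in> e}" "{corner z k, w} \<notin> face_boundary"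
    using confD(2)[OF assms(1)] by (auto simp: rest_def)
  then have "{corner z k, w} = leg z k"
    unfolding hex_edges_at_corner[OF centre] by (auto simp: face_boundary_def)
  then show ?thesis by (auto simp: leg_def doubleton_eq_iff)
qed

lemma closed_rest_hex:
  assumes "\<omega> \<in> conf C B" "{u, v} \<in> closed_up (rest \<omega>)" "u \<noteq> z" "v \<noteq> z"
  shows "{u, v} \<in> hex_edges"
  using assms confD(2)[OF assms(1)] by (auto simp: closed_up_def rest_def doubleton_eq_iff)

lemma closed_rest_centre:
  assumes "\<omega> \<in> conf C B" "{u, z} \<in> closed_up (rest \<omega>)"
  shows "u \<in> B"
proof -
  have "{u, z} \<notin> hex_edges" using centre_not_vertex[OF centre] by blast
  then have "{u, z} \<in> (\<lambda>b. {b, z}) ` B"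
    using assms confD(2)[OF assms(1)] by (auto simp: closed_up_def rest_def)
  then show ?thesis by (auto simp: doubleton_eq_iff)
qed

text \<open>If the strand joining corners \<open>i\<close> and \<open>k\<close> avoids \<open>z\<close>, it is closed up along the face to a set
  of edges with even degrees.  Its potential takes different values at the outer ends of the legs
  \<open>j\<close> and \<open>l\<close> but is constant along the strand joining them.\<close>

lemma strands_do_not_cross:
  assumes \<omega>: "\<omega> \<in> conf C B" and ijk: "i < j" "j < k" "k < 6" and l: "l < 6"
    and partners: "partner \<omega> i = k" "partner \<omega> j = l" "l \<noteq> j"
    and avoid: "\<not> connected_in (closed_up (rest \<omega>)) (corner z i) z"
  shows "i \<le> l \<and> l \<le> k"
proof (rule ccontr)
  assume nl: "\<not> (i \<le> l \<and> l \<le> k)"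
  define G where "G = closed_up (rest \<omega>)"
  define X where "X = component G (corner z i)"
  define \<gamma> where "\<gamma> = {e \<in> G. e \<subseteq> X}"
  define arc where "arc = hex_face_edge z ` {i..<k}"
  define J where "J = \<gamma> \<union> arc"
  note simple = simple_closed_rest[OF \<omega>, folded G_def]
  have finG: "finite G" using simple by (simp add: simple_graph_def)
  have legs: "leg z i \<in> \<omega>" "leg z j \<in> \<omega>"
    using partner_eq_iff[OF \<omega>, of i] partner_eq_iff[OF \<omega>, of j] partners ijk by auto
  have z_X: "z \<notin> X" using avoid by (simp add: X_def component_def G_def)
  have X_closed: "q \<in> X" if "p \<in> X" "{p, q} \<in> G" for p q
    using that connected_in_edge connected_in_trans unfolding X_def component_def by blast
  \<comment> \<open>As the strand avoids \<open>z\<close>, all its edges are lattice edges.\<close>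
  have \<gamma>_rest: "\<gamma> \<subseteq> rest \<omega>" using z_X by (auto simp: \<gamma>_def G_def closed_up_def)
  have rest_hex: "rest \<omega> \<subseteq> hex_edges" using confD(2)[OF \<omega>] by (auto simp: rest_def)
  have arc_hex: "arc \<subseteq> hex_edges" using face domain_hex by (auto simp: arc_def)
  have disj: "\<gamma> \<inter> arc = {}" using \<gamma>_rest by (auto simp: rest_def arc_def face_boundary_def)
  have fin: "finite \<gamma>" "finite arc" using finG by (auto simp: \<gamma>_def arc_def)
  have J_hex: "J \<subseteq> hex_edges" using \<gamma>_rest rest_hex arc_hex by (auto simp: J_def)
  have in_arc: "hex_face_edge z m \<in> arc \<longleftrightarrow> i \<le> m \<and> m < k" if "m < 6" for m
  proof
    assume "hex_face_edge z m \<in> arc"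
    then obtain x where x: "x \<in> {i..<k}" "hex_face_edge z m = hex_face_edge z x" by (auto simp: arc_def)
    then have "m = x" using hex_face_edge_inj[OF that _ x(2)] ijk(3) by simp
    then show "i \<le> m \<and> m < k" using x(1) by simp
  qed (auto simp: arc_def)
  have in_J: "hex_face_edge z m \<in> J \<longleftrightarrow> i \<le> m \<and> m < k" if "m < 6" for m
    using in_arc[OF that] \<gamma>_rest by (auto simp: J_def rest_def face_boundary_def)
  have leg_arc: "leg z m \<notin> arc" for m
    using leg_not_face_boundary[of m] by (auto simp: arc_def face_boundary_def)
  have corner_X: "corner z m \<in> X \<longleftrightarrow> m = i \<or> m = k" if "m < 6" for m
    using partner_unique[OF \<omega> _ that, of i] partner_connected[OF \<omega>, of i] partners(1) ijk
    by (auto simp: X_def component_def G_def)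
  have deg_\<gamma>: "degree_in \<gamma> v = (if v \<in> X then degree_in G v else 0)" for v
  proof (cases "v \<in> X")
    case True
    have "{e \<in> \<gamma>. v \<in> e} = {e \<in> G. v \<in> e}"
    proof
      show "{e \<in> G. v \<in> e} \<subseteq> {e \<in> \<gamma>. v \<in> e}"
      proof
        fix e assume e: "e \<in> {e \<in> G. v \<in> e}"
        then obtain a b where ab: "e = {a, b}" using simple unfolding simple_graph_def by blast
        have "e \<subseteq> X" using e True X_closed[of v] unfolding ab by (auto simp: insert_commute)
        with e show "e \<in> {e \<in> \<gamma>. v \<in> e}" by (auto simp: \<gamma>_def)
      qed
    qed (auto simp: \<gamma>_def)
    then show ?thesis using True by (simp add: degree_in_def)
  next
    case False
    then have "degree_in \<gamma> v = 0" by (intro degree_in_eq_0) (auto simp: \<gamma>_def)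
    with False show ?thesis by simp
  qed
  have even: "even (degree_in J v)" for v
  proof (cases "\<exists>m. v = corner z m")
    case True
    then obtain m where m: "v = corner z m" "m < 6"
      using corner_mod6 by (metis mod_less_divisor zero_less_numeral)
    \<comment> \<open>The face edge preceding corner \<open>m\<close>. For \<open>m = 0\<close> this
      is edge 5, which is never in the arc because \<open>k < 6\<close>.\<close>
    have "(m + 5) mod 6 = (if m = 0 then 5 else m - 1)" using m(2) by (auto simp: mod_if)
    then have m5: "hex_face_edge z (m + 5) \<in> arc \<longleftrightarrow> m \<noteq> 0 \<and> i \<le> m - 1 \<and> m - 1 < k"
      using in_arc[of "(m + 5) mod 6"] hex_face_edge_mod6[of z "m + 5"] ijk m(2) by auto
    have "degree_in G (corner z i) = 1"
      using conf_rest_degree(1)[OF \<omega>, of i] legs(1) by (simp add: G_def)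
    moreover have "leg z k \<in> \<omega>"
      using partner_eq_iff[OF \<omega>, of k] partner_partner[OF \<omega>, of i] partners(1) ijk by auto
    then have "degree_in G (corner z k) = 1"
      using conf_rest_degree(1)[OF \<omega>, of k] by (simp add: G_def)
    ultimately have "degree_in \<gamma> v = of_bool (m = i \<or> m = k)"
      unfolding deg_\<gamma> m(1) using corner_X[OF m(2)] by auto
    moreover have "degree_in arc v = of_bool (i \<le> m \<and> m < k) + of_bool (m \<noteq> 0 \<and> i \<le> m - 1 \<and> m - 1 < k)"
      unfolding m(1) degree_in_corner[OF centre arc_hex] using in_arc[OF m(2)] m5 leg_arc by simp
    ultimately show ?thesis
      unfolding J_def degree_in_Un[OF fin disj] using ijk by (auto simp: of_bool_def)
  next
    case False
    then have "degree_in arc v = 0"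
      by (intro degree_in_eq_0) (auto simp: arc_def hex_face_edge_corner)
    moreover have "degree_in G v \<in> {0, 2}"
      unfolding G_def using False by (intro conf_rest_degree(2)[OF \<omega>]) auto
    ultimately show ?thesis unfolding J_def degree_in_Un[OF fin disj] deg_\<gamma> by auto
  qed
  have not_J: "v \<notin> \<Union>J" if "v \<notin> X" "\<And>m. v \<noteq> corner z m" for v
    using that by (auto simp: J_def \<gamma>_def arc_def hex_face_edge_corner)
  show False
  proof (rule vertex_potential[OF _ J_hex even])
    show "finite J" using fin by (simp add: J_def)
    fix f g :: "complex \<Rightarrow> bool"
    assume f: "\<And>z k. z \<in> hex_face_centres \<Longrightarrow> f z \<noteq> f (across z k) \<longleftrightarrow> hex_face_edge z k \<in> J"
      and g: "\<And>z k. z \<in> hex_face_centres \<Longrightarrow> corner z k \<notin> \<Union>J \<Longrightarrow> g (corner z k) = f z"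
    have edge: "g u = g v" if "{u, v} \<in> hex_edges" "u \<notin> \<Union>J" "v \<notin> \<Union>J" for u v
      by (rule vertex_potential_edge[where f = f and X = "\<Union>J"]) (use g that in auto)
    have outer: "g (outer z m) = f (across z m)" if "outer z m \<notin> \<Union>J" for m
      using g[OF across_centre[OF centre], of m "m + 5"] that unfolding corner_across by blast
    have j_X: "corner z j \<notin> X" "corner z l \<notin> X"
      using corner_X[of j] corner_X[of l] ijk l nl by auto
    have reach_X: "v \<notin> X" if "connected_in G (corner z j) v" for v
      using that j_X connected_in_sym connected_in_trans unfolding X_def component_def by blast
    \<comment> \<open>Among the boundary vertices only \<open>b\<close> and \<open>b'\<close> can
      lie on a strand, and their strand contains \<open>z\<close>.\<close>
    have cycle_J: "v \<notin> \<Union>J" if "v \<in> \<Union>C" for v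
    proof (rule not_J)
      show "v \<noteq> corner z m" for m using that corner_not_in_cycle by blast
      show "v \<notin> X"
      proof
        assume v: "v \<in> X"
        show False
        proof (cases "v \<in> B")
          case True
          then have "{v, z} \<in> G" by (auto simp: G_def closed_up_def)
          then show False using X_closed[OF v] z_X by blast
        next
          case False
          have "v \<noteq> corner z i" using that corner_not_in_cycle by blast
          then have "v \<in> \<Union>G" using v connected_in_Union unfolding X_def component_def by blast
          moreover have "v \<notin> \<Union>\<omega>" using conf_avoids_cycle[OF \<omega> that False] .
          moreover have "v \<noteq> z" using v z_X by blast
          ultimately show False using False by (auto simp: G_def closed_up_def rest_def)
        qed
      qed
    qed
    have cycle_g: "g u = g v" if "u \<in> \<Union>C" "v \<in> \<Union>C" for u v
      using hex_cycle_connected[OF cycle that]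
    proof (induction rule: connected_in_induct)
      case (step p q)
      then have "{p, q} \<in> hex_edges" "p \<in> \<Union>C" "q \<in> \<Union>C" using C_hex by auto
      then show ?case using step edge[of p q] cycle_J by simp
    qed simp
    have B_g: "g b = g b'" if "b \<in> B" "b' \<in> B" for b b'
      using cycle_g that B_cycle by blast
    \<comment> \<open>The invariant along the strand from corner \<open>j\<close>. Corners may lie
      on \<open>J\<close>, so the value at corner \<open>l\<close> is read off at the outer end of
      its leg; \<open>z\<close> is not a lattice vertex, so there the values on \<open>B\<close>
      take over.\<close>
    define P where "P v \<longleftrightarrow> v = corner z j \<or> v = corner z l \<and> g (outer z l) = g (outer z j) \<or>
      v = z \<and> (\<forall>b\<in>B. g b = g (outer z j)) \<or>
      (\<forall>m. v \<noteq> corner z m) \<and> v \<noteq> z \<and> g v = g (outer z j)" for v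
    have corner_z: "corner z m \<noteq> z" for m
      using centre_not_vertex[OF centre, of "hex_face_edge z m"] face[of m] domain_hex
      by (auto simp: hex_face_edge_corner)
    have outer_z: "outer z m \<noteq> z" for m
      by (simp add: outer_def sixth_def cis_neq_zero)
    have P: "P v" if "connected_in G (corner z j) v" for v
      using that
    proof (induction rule: connected_in_induct)
      case refl
      then show ?case by (simp add: P_def)
    next
      case (step p q)
      have q: "connected_in G (corner z j) q" using step connected_in_edge connected_in_trans by blast
      consider m where "q = corner z m" "m < 6" | "q = z" | "\<And>m. q \<noteq> corner z m" "q \<noteq> z"
        using corner_mod6 by (metis mod_less_divisor zero_less_numeral)
      then show ?case
      proof cases
        case 1
        then have "m = j \<or> m = l"
          using partner_unique[OF \<omega>, of j m] q partners(2) ijk by (auto simp: G_def)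
        moreover have "P (corner z l)" if "m = l"
        proof -
          have "p = outer z l"
            using closed_rest_corner_edge[OF \<omega>, of l p] step(2) 1 that by (simp add: G_def insert_commute)
          then show ?thesis using step(3) outer_not_corner[of z l] outer_z[of l] by (auto simp: P_def)
        qed
        ultimately show ?thesis using 1 by (auto simp: P_def)
      next
        case 2
        then have "p \<in> B" using closed_rest_centre[OF \<omega>] step(2) by (simp add: G_def)
        then have "g p = g (outer z j)"
          using step(3) corner_not_in_B centre_not_in_B by (auto simp: P_def)
        then show ?thesis using B_g[OF \<open>p \<in> B\<close>] 2 by (auto simp: P_def)
      next
        case 3
        have "g q = g (outer z j)"
          using step(3) unfolding P_def
        proof (elim disjE conjE)
          assume "p = corner z j"
          then show ?thesis using closed_rest_corner_edge[OF \<omega>, of j q] step(2) by (simp add: G_def)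
        next
          assume "p = corner z l" "g (outer z l) = g (outer z j)"
          then show ?thesis using closed_rest_corner_edge[OF \<omega>, of l q] step(2) by (simp add: G_def)
        next
          assume "p = z" "\<forall>b\<in>B. g b = g (outer z j)"
          then show ?thesis using closed_rest_centre[OF \<omega>, of q] step(2) by (simp add: G_def insert_commute)
        next
          assume p: "\<forall>m. p \<noteq> corner z m" "p \<noteq> z" "g p = g (outer z j)"
          then have "{p, q} \<in> hex_edges" using closed_rest_hex[OF \<omega>] step(2) 3 by (simp add: G_def)
          moreover have "p \<notin> \<Union>J" "q \<notin> \<Union>J"
            using not_J[of p] not_J[of q] reach_X step(1) q p 3 by auto
          ultimately show ?thesis using edge p(3) by metis
        qed
        then show ?thesis using 3 by (simp add: P_def)
      qed
    qed
    have con: "connected_in G (corner z j) (corner z l)"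
      using partner_connected[OF \<omega>, of j] partners(2) ijk by (simp add: G_def)
    have "corner z l \<noteq> corner z j" using corner_eq_iff[OF l, of j z] partners(3) ijk by simp
    then have eq: "g (outer z l) = g (outer z j)" using P[OF con] corner_z by (auto simp: P_def)
    have outer_J: "outer z m \<notin> \<Union>J" if "leg z m \<in> \<omega>" "connected_in G (corner z j) (corner z m)" for m
    proof -
      have "{corner z m, outer z m} \<in> G"
        using that(1) leg_not_face_boundary[of m] by (auto simp: G_def closed_up_def rest_def leg_def)
      then have "connected_in G (corner z j) (outer z m)" using that(2) connected_in_edge connected_in_trans by blast
      then show ?thesis using reach_X not_J outer_not_corner[of z m] by blast
    qed
    have "leg z l \<in> \<omega>"
      using partner_eq_iff[OF \<omega> l] partner_partner[OF \<omega>, of j] partners ijk by auto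
    \<comment> \<open>Edge \<open>j\<close> belongs to the arc and edge \<open>l\<close> does not,
      so the outer ends of the two legs lie on different sides of \<open>J\<close>.\<close>
    then have "g (outer z l) = f (across z l)" using outer outer_J con by blast
    also have "\<dots> = f z" using f[OF centre, of l] in_J[OF l] nl by auto
    finally have "g (outer z l) = f z" .
    moreover have "g (outer z j) = f (across z j)" using outer outer_J[OF legs(2)] by blast
    moreover have "f z \<noteq> f (across z j)" using f[OF centre, of j] in_J[of j] ijk by simp
    ultimately show False using eq by simp
  qed
qed

text \<open>If the strand from \<open>i\<close> passes through \<open>z\<close>, the strand from
  \<open>j\<close> does not, and the two exchange roles.\<close>

lemma noncrossing_partners:
  assumes "\<omega> \<in> conf C B"
  shows "noncrossing (map (partner \<omega>) [0..<6])"
proof -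
  let ?G = "closed_up (rest \<omega>)"
  have "i \<le> partner \<omega> j \<and> partner \<omega> j \<le> partner \<omega> i" if "i < j" "j < partner \<omega> i" "j < 6" for i j
  proof (cases "partner \<omega> j = j")
    case False
    define k l where "k = partner \<omega> i" and "l = partner \<omega> j"
    have i: "i < 6" using that by simp
    have kl: "k < 6" "l < 6" "l \<noteq> j" using partner_less[OF assms] that i False by (auto simp: k_def l_def)
    have inv: "partner \<omega> k = i" "partner \<omega> l = j"
      using partner_partner[OF assms] that i by (auto simp: k_def l_def)
    show ?thesis
    proof (cases "connected_in ?G (corner z i) z")
      case False
      then show ?thesis
        using strands_do_not_cross[OF assms that(1) that(2)[folded k_def] kl(1,2)] kl(3) by (simp add: k_def l_def)
    next
      case True
      have nj: "\<not> connected_in ?G (corner z j) z"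
      proof
        assume "connected_in ?G (corner z j) z"
        with True have "connected_in ?G (corner z i) (corner z j)" using connected_in_sym connected_in_trans by blast
        then have "j = i \<or> j = partner \<omega> i" using partner_unique[OF assms i that(3)] by blast
        with that show False by auto
      qed
      have jl: "connected_in ?G (corner z j) (corner z l)" using partner_connected[OF assms that(3)] by (simp add: l_def)
      then have nl: "\<not> connected_in ?G (corner z l) z" using nj connected_in_trans by blast
      show ?thesis
      proof (rule ccontr)
        assume "\<not> ?thesis"
        \<comment> \<open>In the first case the separating strand runs from \<open>l\<close> to
          \<open>j\<close>, with \<open>i\<close> but not \<open>k\<close> between its ends; in the
          second it runs from \<open>j\<close> to \<open>l\<close>, with \<open>k\<close> but not
          \<open>i\<close> between them.\<close>
        then consider "l < i" | "k < l" by (fastforce simp: k_def l_def)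
        then show False
        proof cases
          case 1
          from strands_do_not_cross[OF assms 1 that(1,3) kl(1) inv(2) _ _ nl] that show False
            by (simp add: k_def)
        next
          case 2
          from strands_do_not_cross[OF assms that(2)[folded k_def] 2 kl(2) i _ inv(1) _ nj] that show False
            by (simp add: l_def k_def)
        qed
      qed
    qed
  qed (use that in auto)
  moreover have "partner \<omega> i = j \<longleftrightarrow> partner \<omega> j = i" if "i < 6" "j < 6" for i j
    using partner_partner[OF assms] that by auto
  ultimately show ?thesis
    using partner_less[OF assms] unfolding noncrossing_def by (simp add: nth_append del: upt_Suc)
qed

end

section \<open>Components and loops\<close>

text \<open>The number of values depends only on which arguments are identified. This replaces
  components by labels when counting.\<close>

lemma card_image_cong_kernel:
  assumes "\<And>x y. x \<in> A \<Longrightarrow> y \<in> A \<Longrightarrow> f x = f y \<longleftrightarrow> g x = g y"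
  shows "card (f ` A) = card (g ` A)"
proof (rule bij_betw_same_card[of "\<lambda>X. g (inv_into A f X)"], rule bij_betwI')
  fix X Y assume "X \<in> f ` A" "Y \<in> f ` A"
  then show "g (inv_into A f X) = g (inv_into A f Y) \<longleftrightarrow> X = Y"
    using assms inv_into_into[of _ f A] f_inv_into_f[of _ f A] by metis
next
  fix X assume "X \<in> f ` A"
  then show "g (inv_into A f X) \<in> g ` A" by (simp add: inv_into_into)
next
  fix Y assume "Y \<in> g ` A"
  then obtain x where "x \<in> A" "Y = g x" by blast
  moreover from this have "g (inv_into A f (f x)) = g x"
    using assms[of "inv_into A f (f x)" x] inv_into_into[of "f x" f A] f_inv_into_f[of "f x" f A] by simp
  ultimately show "\<exists>X\<in>f ` A. Y = g (inv_into A f X)" by (intro bexI[of _ "f x"]) simp_all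
qed

lemma num_classes_card:
  "num_classes lab s = card ((\<lambda>i. lab ! i) ` {i. i < 6 \<and> active s i})"
proof -
  have "set (map (\<lambda>i. lab ! i) (filter (active s) [0..<6])) = (\<lambda>i. lab ! i) ` {i. i < 6 \<and> active s i}"
    by auto
  then show ?thesis unfolding num_classes_def by (simp only: length_remdups_card_conv)
qed

lemma eis_mult: "eis a b * eis c d = eis (a * c - b * d) (a * d + b * c + b * d)"
proof -
  have "eis a b * eis c d = of_int (a * c) + of_int (a * d + b * c) * sixth + of_int (b * d) * sixth ^ 2"
    by (simp add: eis_def algebra_simps power2_eq_square)
  then show ?thesis by (simp add: sixth_power2 eis_def algebra_simps)
qed

lemma cis_minus_third: "cis (- (2 * pi / 3)) = eis 0 (-1)"
proof -
  have "eis (-1) 1 * eis 0 (-1) = 1" by (simp add: eis_mult) (simp add: eis_def)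
  then have "inverse (cis (2 * pi / 3)) = eis 0 (-1)" unfolding cis_third(1) by (rule inverse_unique)
  then show ?thesis by simp
qed

text \<open>Seen from edge \<open>k\<close> of the face, the neighbours on the inner side are
  corners and those on the outer side are ends of legs.\<close>

lemma nbr_corner:
  "nbr_ccw (corner z k) (corner z (Suc k)) = corner z (k + 5)"
  "nbr_cw (corner z k) (corner z (Suc k)) = outer z k"
  "nbr_ccw (corner z (Suc k)) (corner z k) = outer z (Suc k)"
  "nbr_cw (corner z (Suc k)) (corner z k) = corner z (k + 2)"
proof -
  obtain p q where pq: "sixth ^ k = eis p q" using sixth_power_cases[of k] by blast
  have two: "sixth ^ (k + 2) = eis (- p - q) p"
    using sixth_power_step(1)[OF sixth_power_step(1)[OF pq]] by simp
  note d = nbr_ccw_def nbr_cw_def cis_third(1) cis_minus_third corner_def outer_def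
  show "nbr_ccw (corner z k) (corner z (Suc k)) = corner z (k + 5)"
    "nbr_cw (corner z k) (corner z (Suc k)) = outer z k"
    "nbr_ccw (corner z (Suc k)) (corner z k) = outer z (Suc k)"
    "nbr_cw (corner z (Suc k)) (corner z k) = corner z (k + 2)"
    unfolding d sixth_power_step[OF pq] two pq sixth_power_step(3)[OF sixth_power_step(1)[OF pq]]
      add_diff_cancel_left eis_diff eis_mult add.assoc eis_add by (simp_all add: eis_double)
qed

context face_in_domain begin

section \<open>The state of the face in a configuration\<close>

definition sides :: "complex set set \<Rightarrow> bool list" where
  "sides \<omega> = map (\<lambda>k. hex_face_edge z k \<in> \<omega>) [0..<6]"

definition partners :: "complex set set \<Rightarrow> nat list" where
  "partners \<omega> = map (partner \<omega>) [0..<6]"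

lemma length_sides [simp]: "length (sides \<omega>) = 6" "length (partners \<omega>) = 6"
  by (simp_all add: sides_def partners_def)

lemma sides_mod: "sides \<omega> ! (k mod 6) \<longleftrightarrow> hex_face_edge z k \<in> \<omega>"
  using hex_face_edge_mod6[of z k] by (simp add: sides_def del: upt_Suc)

lemma sides_nth: "k < 6 \<Longrightarrow> sides \<omega> ! k \<longleftrightarrow> hex_face_edge z k \<in> \<omega>"
  using sides_mod[of \<omega> k] by simp

lemma partners_nth: "k < 6 \<Longrightarrow> partners \<omega> ! k = partner \<omega> k"
  by (simp add: partners_def del: upt_Suc)

text \<open>No corner is in \<open>B\<close>, so its degree is 0 or 2, and the leg makes up for a
  single occupied face edge.\<close>

lemma conf_corner:
  assumes "\<omega> \<in> conf C B"
  shows "leg z k \<in> \<omega> \<longleftrightarrow> (hex_face_edge z k \<in> \<omega>) \<noteq> (hex_face_edge z (k + 5) \<in> \<omega>)"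
    "degree_in \<omega> (corner z k) = (if hex_face_edge z k \<in> \<omega> \<or> hex_face_edge z (k + 5) \<in> \<omega> then 2 else 0)"
proof -
  note d = degree_in_corner[OF centre confD(2)[OF assms], of k]
  have "degree_in \<omega> (corner z k) \<in> {0, 2}" using confD(5)[OF assms corner_not_in_B] .
  then show "leg z k \<in> \<omega> \<longleftrightarrow> (hex_face_edge z k \<in> \<omega>) \<noteq> (hex_face_edge z (k + 5) \<in> \<omega>)"
    "degree_in \<omega> (corner z k) = (if hex_face_edge z k \<in> \<omega> \<or> hex_face_edge z (k + 5) \<in> \<omega> then 2 else 0)"
    unfolding d by (auto simp: of_bool_def split: if_splits)
qed

lemma active_sides: "active (sides \<omega>) (k mod 6) \<longleftrightarrow> hex_face_edge z k \<in> \<omega> \<or> hex_face_edge z (k + 5) \<in> \<omega>"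
proof -
  have "(k mod 6 + 5) mod 6 = (k + 5) mod 6" by presburger
  then show ?thesis unfolding active_def by (simp only: sides_mod)
qed

lemma compatible_sides:
  assumes "\<omega> \<in> conf C B" shows "compatible (partners \<omega>) (sides \<omega>)"
  unfolding compatible_def
proof (intro conjI allI impI)
  fix k :: nat assume k: "k < 6"
  show "(sides \<omega> ! k = sides \<omega> ! ((k + 5) mod 6)) = (partners \<omega> ! k = k)"
    unfolding sides_nth[OF k] sides_mod partners_nth[OF k] partner_eq_iff[OF assms k]
    using conf_corner(1)[OF assms, of k] by blast
qed simp

text \<open>The path from \<open>b\<close> ends at another vertex of degree one, and all such
  vertices are in \<open>B\<close>.\<close>

lemma B_connected:
  assumes "\<omega> \<in> conf C B" "b \<in> B" "b' \<in> B"
  shows "connected_in \<omega> b b'"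
proof (cases "b = b'")
  case False
  note \<omega> = confD[OF assms(1)]
  obtain v where v: "v \<noteq> b" "degree_in \<omega> v = 1" "connected_in \<omega> b v"
    using degree_one_partner[OF \<omega>(1) \<omega>(6) \<omega>(4)[OF assms(2)]] by blast
  have "v \<in> B" using \<omega>(5)[of v] v(2) by auto
  then have "v = b'" using B_cases assms(2,3) v(1) False by auto
  with v show ?thesis by simp
qed simp

text \<open>A passage through \<open>z\<close> can be replaced by the path in
  \<open>\<omega>\<close> that joins \<open>b\<close> and \<open>b'\<close>.\<close>

lemma connected_closed_up:
  assumes "\<omega> \<in> conf C B" "connected_in (closed_up \<omega>) u v" "u \<noteq> z" "v \<noteq> z"
  shows "connected_in \<omega> u v"
proof -
  have "(v \<noteq> z \<longrightarrow> connected_in \<omega> u v) \<and> (v = z \<longrightarrow> (\<forall>b\<in>B. connected_in \<omega> u b))"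
    using assms(2)
  proof (induction rule: connected_in_induct)
    case refl
    then show ?case using assms(3) by simp
  next
    case (step p q)
    consider "{p, q} \<in> \<omega>" | b where "b \<in> B" "{p, q} = {b, z}"
      using step(2) by (auto simp: closed_up_def)
    then show ?case
    proof cases
      case 1
      then have "{p, q} \<in> hex_edges" using confD(2)[OF assms(1)] by blast
      then have "p \<noteq> z" "q \<noteq> z" using centre_not_vertex[OF centre] by blast+
      then show ?thesis using step(3) 1 connected_in_edge connected_in_trans by blast
    next
      case 2
      then have b: "b \<noteq> z" using centre_not_in_B by blast
      from 2(2) consider "p = b" "q = z" | "p = z" "q = b" by (auto simp: doubleton_eq_iff)
      then show ?thesis
      proof cases
        case 1
        then have "connected_in \<omega> u b" using step(3) b by simp
        then have "\<forall>b'\<in>B. connected_in \<omega> u b'"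
          using B_connected[OF assms(1) 2(1)] connected_in_trans by blast
        then show ?thesis using 1 by simp
      next
        case 2
        then show ?thesis using step(3) \<open>b \<in> B\<close> b by simp
      qed
    qed
  qed
  then show ?thesis using assms(4) by simp
qed

lemma corner_not_centre: "corner z k \<noteq> z"
  by (simp add: corner_def sixth_def cis_neq_zero)

lemma links_partners:
  "(i, j) \<in> set (links (partners \<omega>) (sides \<omega>)) \<longleftrightarrow>
    i < 6 \<and> (j = partner \<omega> i \<or> hex_face_edge z i \<in> \<omega> \<and> j = Suc i mod 6)"
proof -
  have 1: "set (zip [0..<6] (partners \<omega>)) = {(i, partner \<omega> i) | i. i < 6}"
  proof -
    have "zip [0..<6] (partners \<omega>) = map (\<lambda>i. (i, partner \<omega> i)) [0..<6]"
      unfolding partners_def by (rule nth_equalityI) (simp_all del: upt_Suc)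
    then show ?thesis by (auto simp del: upt_Suc)
  qed
  have 2: "set (filter (\<lambda>e. sides \<omega> ! fst e) (map (\<lambda>i. (i, Suc i mod 6)) [0..<6])) =
      {(i, Suc i mod 6) | i. i < 6 \<and> hex_face_edge z i \<in> \<omega>}"
    using sides_nth by (auto simp del: upt_Suc)
  show ?thesis unfolding links_def set_append 1 2 by auto
qed

text \<open>A walk in \<open>\<omega>\<close> alternates between face edges and pieces of strands.
  The induction keeps a corner \<open>k\<close> that is linked to \<open>i\<close> and joined to the
  current vertex outside the face.\<close>

lemma connected_linked:
  assumes \<omega>: "\<omega> \<in> conf C B" and "i < 6" "j < 6"
  shows "connected_in \<omega> (corner z i) (corner z j) \<longleftrightarrow> linked (links (partners \<omega>) (sides \<omega>)) i j"
proof
  let ?L = "links (partners \<omega>) (sides \<omega>)"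
  have extend: "linked ?L i k" if "linked ?L i j" "(j, k) \<in> set ?L \<or> (k, j) \<in> set ?L" for i j k
    using that unfolding linked_def by (auto intro: rtrancl_into_rtrancl)
  assume "connected_in \<omega> (corner z i) (corner z j)"
  then have "\<exists>k<6. connected_in (closed_up (rest \<omega>)) (corner z k) (corner z j) \<and> linked ?L i k"
  proof (induction rule: connected_in_induct)
    case refl
    then show ?case using assms(2) by (intro exI[of _ i]) (auto simp: linked_def)
  next
    case (step p q)
    then obtain k where k: "k < 6" "connected_in (closed_up (rest \<omega>)) (corner z k) p" "linked ?L i k" by blast
    show ?case
    proof (cases "{p, q} \<in> face_boundary")
      case False
      then have "{p, q} \<in> closed_up (rest \<omega>)" using step(2) by (simp add: closed_up_def rest_def)
      then show ?thesis using k connected_in_edge connected_in_trans by blast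
    next
      case True
      then obtain m where m: "m < 6" "{p, q} = hex_face_edge z m" by (auto simp: face_boundary_eq)
      then have L: "(m, Suc m mod 6) \<in> set ?L" using step(2) by (simp add: links_partners)
      have "{p, q} = {corner z m, corner z (Suc m mod 6)}"
        unfolding m(2) hex_face_edge_corner using corner_mod6[of z "Suc m"] by simp
      then obtain c d where cd: "c < 6" "d < 6" "p = corner z c" "q = corner z d"
        "(c, d) \<in> set ?L \<or> (d, c) \<in> set ?L"
      proof -
        have m6: "Suc m mod 6 < 6" by simp
        from \<open>{p, q} = {corner z m, corner z (Suc m mod 6)}\<close> consider "p = corner z m" "q = corner z (Suc m mod 6)"
          | "p = corner z (Suc m mod 6)" "q = corner z m" by (auto simp only: doubleton_eq_iff)
        then show thesis using that m(1) m6 L by cases blast+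
      qed
      have "c = k \<or> c = partner \<omega> k" using partner_unique[OF \<omega> k(1) cd(1)] k(2) cd(3) by simp
      then have "linked ?L i c" using k(1,3) extend[OF k(3), of c] by (auto simp: links_partners)
      then have "linked ?L i d" using cd(5) extend by blast
      then show ?thesis using cd by blast
    qed
  qed
  then obtain k where k: "k < 6" "connected_in (closed_up (rest \<omega>)) (corner z k) (corner z j)" "linked ?L i k"
    by blast
  then have "j = k \<or> j = partner \<omega> k" using partner_unique[OF \<omega> _ assms(3)] by blast
  then show "linked ?L i j" using extend[OF k(3), of j] k(1,3) by (auto simp: links_partners)
next
  assume "linked (links (partners \<omega>) (sides \<omega>)) i j"
  then have "(i, j) \<in> (set (links (partners \<omega>) (sides \<omega>)) \<union> (set (links (partners \<omega>) (sides \<omega>)))\<inverse>)\<^sup>*"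
    by (simp add: linked_def)
  then show "connected_in \<omega> (corner z i) (corner z j)"
  proof (induction rule: rtrancl_induct)
    case (step p q)
    have *: "connected_in \<omega> (corner z p) (corner z q)" if "(p, q) \<in> set (links (partners \<omega>) (sides \<omega>))" for p q
    proof -
      from that consider "p < 6" "q = partner \<omega> p" | "p < 6" "hex_face_edge z p \<in> \<omega>" "q = Suc p mod 6"
        by (auto simp: links_partners)
      then show ?thesis
      proof cases
        case 1
        have "closed_up (rest \<omega>) \<subseteq> closed_up \<omega>" by (auto simp: closed_up_def rest_def)
        then have "connected_in (closed_up \<omega>) (corner z p) (corner z q)"
          using partner_connected[OF \<omega> 1(1)] 1(2) connected_in_mono by blast
        then show ?thesis using connected_closed_up[OF \<omega>] corner_not_centre by blast
      next
        case 2
        then have "{corner z p, corner z q} \<in> \<omega>"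
          using corner_mod6[of z "Suc p"] by (simp add: hex_face_edge_corner)
        then show ?thesis by (rule connected_in_edge)
      qed
    qed
    have "connected_in \<omega> (corner z p) (corner z q)"
      using step(2) *[of p q] *[of q p] connected_in_sym by blast
    then show ?case using step(3) connected_in_trans by blast
  qed simp
qed

lemma connected_labels:
  assumes "\<omega> \<in> conf C B" "i < 6" "j < 6"
  shows "labels (partners \<omega>) (sides \<omega>) ! i = labels (partners \<omega>) (sides \<omega>) ! j \<longleftrightarrow>
    connected_in \<omega> (corner z i) (corner z j)"
  unfolding connected_linked[OF assms]
  by (rule labels_eq_iff) (use assms partner_less partners_nth in auto)

definition outer_components :: "complex set set \<Rightarrow> complex set set" where
  "outer_components \<omega> = {X \<in> component \<omega> ` \<Union>\<omega>. \<forall>k. corner z k \<notin> X}"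

lemma face_boundary_corner: "e \<in> face_boundary \<Longrightarrow> v \<in> e \<Longrightarrow> \<exists>k. v = corner z k"
  by (auto simp: face_boundary_def hex_face_edge_corner)

text \<open>A component without corners contains no face edge, so it survives their removal, and
  removal creates no new component of this kind. Hence the number of such components depends only on
  \<open>rest \<omega>\<close>, which the flip preserves.\<close>

lemma outer_components_rest: "outer_components (rest \<omega>) = outer_components \<omega>"
proof -
  have mono: "component (rest \<omega>) v \<subseteq> component \<omega> v" for v
    unfolding component_def using connected_in_mono[of "rest \<omega>" v _ \<omega>] by (auto simp: rest_def)
  have eq: "component \<omega> v = component (rest \<omega>) v" if "\<And>k. corner z k \<notin> component (rest \<omega>) v" for v
  proof
    show "component \<omega> v \<subseteq> component (rest \<omega>) v"
    proof (rule component_subset)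
      fix p q assume p: "p \<in> component (rest \<omega>) v" and "{p, q} \<in> \<omega>"
      moreover have "{p, q} \<notin> face_boundary" using face_boundary_corner[of "{p, q}" p] p that by blast
      ultimately have "{p, q} \<in> rest \<omega>" by (simp add: rest_def)
      then show "q \<in> component (rest \<omega>) v"
        using p connected_in_edge connected_in_trans unfolding component_def by blast
    qed (simp add: component_def)
  qed (rule mono)
  have self: "v \<in> component \<omega> v" for v \<omega> by (simp add: component_def)
  have vertex: "v \<in> \<Union>(rest \<omega>)" if "v \<in> \<Union>\<omega>" "\<And>k. corner z k \<notin> component \<omega> v" for v
  proof -
    obtain e where e: "e \<in> \<omega>" "v \<in> e" using \<open>v \<in> \<Union>\<omega>\<close> by blast
    have "e \<notin> face_boundary" using face_boundary_corner[OF _ e(2)] that(2) self by blast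
    with e show ?thesis by (auto simp: rest_def)
  qed
  show ?thesis
  proof (intro equalityI subsetI)
    fix X assume "X \<in> outer_components (rest \<omega>)"
    then obtain v where v: "v \<in> \<Union>(rest \<omega>)" "X = component (rest \<omega>) v" "\<And>k. corner z k \<notin> X"
      unfolding outer_components_def by auto
    then have "X = component \<omega> v" using eq[of v] by simp
    moreover have "v \<in> \<Union>\<omega>" using v(1) by (auto simp: rest_def)
    ultimately show "X \<in> outer_components \<omega>" using v(3) by (simp add: outer_components_def)
  next
    fix X assume "X \<in> outer_components \<omega>"
    then obtain v where v: "v \<in> \<Union>\<omega>" "X = component \<omega> v" "\<And>k. corner z k \<notin> X"
      unfolding outer_components_def by auto
    have "corner z k \<notin> component (rest \<omega>) v" for k using v(2,3) mono[of v] by blast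
    then have "X = component (rest \<omega>) v" using v(2) eq[of v] by simp
    moreover have "v \<in> \<Union>(rest \<omega>)" using vertex[of v] v by simp
    ultimately show "X \<in> outer_components (rest \<omega>)"
      using v(3) unfolding outer_components_def by (intro CollectI conjI allI) (auto intro: imageI)
  qed
qed

lemma corner_in_Union:
  assumes "\<omega> \<in> conf C B"
  shows "corner z k \<in> \<Union>\<omega> \<longleftrightarrow> active (sides \<omega>) (k mod 6)"
proof -
  have "finite \<omega>" using confD(1)[OF assms] by (simp add: simple_graph_def)
  from degree_in_pos[OF this] show ?thesis
    unfolding active_sides using conf_corner(2)[OF assms, of k] by (metis less_numeral_extra(3) zero_less_numeral)
qed

text \<open>The components that meet the face correspond to the label classes of the active
  corners.\<close>

lemma card_components:
  assumes \<omega>: "\<omega> \<in> conf C B"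
  shows "card (component \<omega> ` \<Union>\<omega>) =
    card (outer_components \<omega>) + num_classes (labels (partners \<omega>) (sides \<omega>)) (sides \<omega>)"
proof -
  let ?A = "{i. i < 6 \<and> active (sides \<omega>) i}"
  have "finite \<omega>" "\<And>e. e \<in> \<omega> \<Longrightarrow> finite e"
    using confD(1)[OF \<omega>] unfolding simple_graph_def by auto
  then have fin: "finite (\<Union>\<omega>)" by (rule finite_Union)
  define inner where "inner = (\<lambda>i. component \<omega> (corner z i)) ` ?A"
  have inner: "inner = {X \<in> component \<omega> ` \<Union>\<omega>. \<exists>k. corner z k \<in> X}"
  proof (intro set_eqI iffI)
    fix X assume "X \<in> inner"
    then obtain i where i: "X = component \<omega> (corner z i)" "i < 6" "active (sides \<omega>) i" by (auto simp: inner_def)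
    then have "corner z i \<in> \<Union>\<omega>" using corner_in_Union[OF \<omega>, of i] by simp
    moreover have "corner z i \<in> X" by (simp add: i component_def)
    ultimately show "X \<in> {X \<in> component \<omega> ` \<Union>\<omega>. \<exists>k. corner z k \<in> X}" using i(1) by blast
  next
    fix X assume "X \<in> {X \<in> component \<omega> ` \<Union>\<omega>. \<exists>k. corner z k \<in> X}"
    then obtain v k where v: "v \<in> \<Union>\<omega>" "X = component \<omega> v" "connected_in \<omega> v (corner z k)"
      by (auto simp: component_def)
    then have "corner z k \<in> \<Union>\<omega>" using connected_in_Union by metis
    then have "k mod 6 \<in> ?A" using corner_in_Union[OF \<omega>] by simp
    moreover have "X = component \<omega> (corner z (k mod 6))"
      using v(2,3) component_eq_iff corner_mod6[of z k] by simp
    ultimately show "X \<in> inner" unfolding inner_def by blast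
  qed
  have "card inner = card ((\<lambda>i. labels (partners \<omega>) (sides \<omega>) ! i) ` ?A)"
    unfolding inner_def
    by (rule card_image_cong_kernel) (use connected_labels[OF \<omega>] in \<open>auto simp: component_eq_iff\<close>)
  then have "card inner = num_classes (labels (partners \<omega>) (sides \<omega>)) (sides \<omega>)"
    by (simp only: num_classes_card)
  moreover have "component \<omega> ` \<Union>\<omega> = outer_components \<omega> \<union> inner" "outer_components \<omega> \<inter> inner = {}"
    unfolding inner outer_components_def by blast+
  moreover have "finite (component \<omega> ` \<Union>\<omega>)" using fin by simp
  ultimately show ?thesis by (metis card_Un_disjoint finite_Un)
qed

text \<open>A component is a loop unless it meets \<open>B\<close>, and all of \<open>B\<close> lies
  in one component, the path.\<close>

lemma num_loops_components:
  assumes \<omega>: "\<omega> \<in> conf C B"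
  shows "num_loops \<omega> + of_bool (B \<noteq> {}) = card (component \<omega> ` \<Union>\<omega>)"
proof -
  note c = confD[OF \<omega>]
  have fin\<omega>: "finite \<omega>" "\<And>e. e \<in> \<omega> \<Longrightarrow> finite e"
    using c(1) unfolding simple_graph_def by auto
  then have fin: "finite (component \<omega> ` \<Union>\<omega>)" by (intro finite_imageI finite_Union)
  define good where "good = {X \<in> component \<omega> ` \<Union>\<omega>. \<forall>v\<in>X. degree_in \<omega> v = 2}"
  define bad where "bad = component \<omega> ` B"
  have B\<omega>: "B \<subseteq> \<Union>\<omega>"
  proof
    fix b assume "b \<in> B"
    then show "b \<in> \<Union>\<omega>" using c(4)[of b] degree_in_pos[OF fin\<omega>(1), of b] by simp
  qed
  have "X \<in> good \<longleftrightarrow> X \<notin> bad" if X: "X \<in> component \<omega> ` \<Union>\<omega>" for X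
  proof
    assume "X \<in> good"
    show "X \<notin> bad"
    proof
      assume "X \<in> bad"
      then obtain b where "b \<in> B" "b \<in> X" by (auto simp: bad_def component_def)
      with \<open>X \<in> good\<close> c(4)[of b] show False by (simp add: good_def)
    qed
  next
    assume nb: "X \<notin> bad"
    have "degree_in \<omega> v = 2" if "v \<in> X" for v
    proof -
      obtain u where u: "u \<in> \<Union>\<omega>" "X = component \<omega> u" using X by blast
      then have "connected_in \<omega> u v" using that by (simp add: component_def)
      then have "v \<in> \<Union>\<omega>" using u(1) connected_in_Union by metis
      then have "degree_in \<omega> v > 0" using degree_in_pos[OF fin\<omega>(1)] by simp
      moreover have "X = component \<omega> v" using u(2) \<open>connected_in \<omega> u v\<close> component_eq_iff by simp
      then have "v \<notin> B" using nb by (auto simp: bad_def)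
      ultimately show ?thesis using c(5)[of v] by auto
    qed
    then show "X \<in> good" using X by (simp add: good_def)
  qed
  then have "component \<omega> ` \<Union>\<omega> = good \<union> bad" "good \<inter> bad = {}"
    using B\<omega> by (auto simp: good_def bad_def)
  moreover have "card bad = of_bool (B \<noteq> {})"
  proof (cases "B = {}")
    case False
    then obtain b where b: "b \<in> B" by blast
    have *: "component \<omega> b' = component \<omega> b" if "b' \<in> B" for b'
      unfolding component_eq_iff by (rule B_connected[OF \<omega> that b])
    have "bad = {component \<omega> b}"
    proof (intro equalityI subsetI)
      fix X assume "X \<in> bad"
      then obtain b' where "b' \<in> B" "X = component \<omega> b'" unfolding bad_def by (rule imageE)
      then have "X = component \<omega> b" using *[OF \<open>b' \<in> B\<close>] by (simp only:)
      then show "X \<in> {component \<omega> b}" by simp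
    next
      fix X assume "X \<in> {component \<omega> b}"
      then show "X \<in> bad" unfolding bad_def using b by simp
    qed
    then show ?thesis using False by simp
  qed (simp add: bad_def)
  moreover have "num_loops \<omega> = card good"
    unfolding good_def by (rule num_loops_eq_components[OF c(1,2,6)])
  ultimately show ?thesis using fin by (metis card_Un_disjoint finite_Un)
qed

end

section \<open>Flipping the face\<close>

context face_in_domain begin

lemma face_edge_pairs:
  "{corner z k, nbr_ccw (corner z k) (corner z (Suc k))} = hex_face_edge z (k + 5)"
  "{corner z k, nbr_cw (corner z k) (corner z (Suc k))} = leg z k"
  "{corner z (Suc k), nbr_ccw (corner z (Suc k)) (corner z k)} = leg z (Suc k)"
  "{corner z (Suc k), nbr_cw (corner z (Suc k)) (corner z k)} = hex_face_edge z (Suc k)"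
  "{corner z k, corner z (Suc k)} = hex_face_edge z k"
  "{corner z (Suc k), corner z k} = hex_face_edge z k"
proof -
  have "Suc (k + 5) = k + 6" "k + 2 = Suc (Suc k)" by simp_all
  then show "{corner z k, nbr_ccw (corner z k) (corner z (Suc k))} = hex_face_edge z (k + 5)"
    "{corner z k, nbr_cw (corner z k) (corner z (Suc k))} = leg z k"
    "{corner z (Suc k), nbr_ccw (corner z (Suc k)) (corner z k)} = leg z (Suc k)"
    "{corner z (Suc k), nbr_cw (corner z (Suc k)) (corner z k)} = hex_face_edge z (Suc k)"
    "{corner z k, corner z (Suc k)} = hex_face_edge z k"
    "{corner z (Suc k), corner z k} = hex_face_edge z k"
    by (simp_all only: nbr_corner hex_face_edge_corner leg_def corner_add6 insert_commute)
qed

lemma ex_endpoints: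
  assumes "a \<noteq> b"
  shows "(\<exists>u v. {a, b} = {u, v} \<and> P u v) \<longleftrightarrow> P a b \<or> P b a"
  by (auto simp: doubleton_eq_iff)

lemma edge_conditions:
  "unequal_degrees (hex_face_edge z k) \<omega> \<longleftrightarrow> degree_in \<omega> (corner z k) \<noteq> degree_in \<omega> (corner z (Suc k))"
  "same_side_turn (hex_face_edge z k) \<omega> \<longleftrightarrow> hex_face_edge z k \<in> \<omega> \<and>
     (hex_face_edge z (k + 5) \<in> \<omega> \<and> hex_face_edge z (Suc k) \<in> \<omega> \<or> leg z k \<in> \<omega> \<and> leg z (Suc k) \<in> \<omega>)"
  "opposite_side_turn (hex_face_edge z k) \<omega> \<longleftrightarrow> hex_face_edge z k \<in> \<omega> \<and>
     (hex_face_edge z (k + 5) \<in> \<omega> \<and> leg z (Suc k) \<in> \<omega> \<or> leg z k \<in> \<omega> \<and> hex_face_edge z (Suc k) \<in> \<omega>)"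
  "all_four (hex_face_edge z k) \<omega> \<longleftrightarrow> hex_face_edge z (k + 5) \<in> \<omega> \<and> leg z k \<in> \<omega> \<and>
     leg z (Suc k) \<in> \<omega> \<and> hex_face_edge z (Suc k) \<in> \<omega>"
  "same_component (hex_face_edge z k) \<omega> \<longleftrightarrow> connected_in \<omega> (corner z k) (corner z (Suc k))"
proof -
  have ne: "corner z k \<noteq> corner z (Suc k)" by (rule corner_neighbours_distinct)
  note ex = ex_endpoints[OF ne, unfolded face_edge_pairs(5)]
  show "unequal_degrees (hex_face_edge z k) \<omega> \<longleftrightarrow> degree_in \<omega> (corner z k) \<noteq> degree_in \<omega> (corner z (Suc k))"
    unfolding unequal_degrees_def ex by auto
  show "same_component (hex_face_edge z k) \<omega> \<longleftrightarrow> connected_in \<omega> (corner z k) (corner z (Suc k))"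
    unfolding same_component_def ex using connected_in_sym by blast
  show "same_side_turn (hex_face_edge z k) \<omega> \<longleftrightarrow> hex_face_edge z k \<in> \<omega> \<and>
     (hex_face_edge z (k + 5) \<in> \<omega> \<and> hex_face_edge z (Suc k) \<in> \<omega> \<or> leg z k \<in> \<omega> \<and> leg z (Suc k) \<in> \<omega>)"
    unfolding same_side_turn_def ex face_edge_pairs by blast
  show "opposite_side_turn (hex_face_edge z k) \<omega> \<longleftrightarrow> hex_face_edge z k \<in> \<omega> \<and>
     (hex_face_edge z (k + 5) \<in> \<omega> \<and> leg z (Suc k) \<in> \<omega> \<or> leg z k \<in> \<omega> \<and> hex_face_edge z (Suc k) \<in> \<omega>)"
    unfolding opposite_side_turn_def ex face_edge_pairs by blast
  show "all_four (hex_face_edge z k) \<omega> \<longleftrightarrow> hex_face_edge z (k + 5) \<in> \<omega> \<and> leg z k \<in> \<omega> \<and>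
     leg z (Suc k) \<in> \<omega> \<and> hex_face_edge z (Suc k) \<in> \<omega>"
    unfolding all_four_def ex face_edge_pairs by blast
qed

text \<open>Chosen so that the number of loops is this plus \<open>N - 1\<close>, where
  \<open>N\<close> components meet the face; the path counts as a component but not as a loop.
  Adding 1 first keeps the subtraction from truncating.\<close>

definition offset :: "complex set set \<Rightarrow> nat" where
  "offset \<omega> = card (outer_components \<omega>) + 1 - of_bool (B \<noteq> {})"

lemma num_loops_offset:
  assumes "\<omega> \<in> conf C B"
  shows "num_loops \<omega> + 1 = offset \<omega> + num_classes (labels (partners \<omega>) (sides \<omega>)) (sides \<omega>)"
  using num_loops_components[OF assms] card_components[OF assms] by (auto simp: offset_def of_bool_def split: if_splits)

text \<open>In the separate case two components meet the face, so \<open>N \<ge> 2\<close> and the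
  factor \<open>1 / n\<close> is absorbed into the exponent. For \<open>n = 0\<close> this is
  precisely the convention in \<open>loops_times_t_edge\<close>.\<close>

lemma loops_times_t_edge_face:
  fixes n \<sigma> :: real
  assumes \<omega>: "\<omega> \<in> conf C B" and k: "k < 6"
  defines "lab \<equiv> labels (partners \<omega>) (sides \<omega>)"
  shows "loops_times_t_edge n \<sigma> (hex_face_edge z k) \<omega> = n ^ offset \<omega> *
    edge_value n (deriv_at_third wt_u1 \<sigma> / at_third wt_u1 \<sigma>) (deriv_at_third wt_u2 \<sigma> / at_third wt_u2 \<sigma>)
      (deriv_at_third wt_v \<sigma> / at_third wt_v \<sigma>) (deriv_at_third wt_w1 \<sigma> / at_third wt_w1 \<sigma>)
      (deriv_at_third wt_w2 \<sigma> / at_third wt_w1 \<sigma>)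
      (num_classes lab (sides \<omega>)) (edge_type lab (partners \<omega>) (sides \<omega>) k)"
proof -
  let ?U1 = "deriv_at_third wt_u1 \<sigma> / at_third wt_u1 \<sigma>"
  let ?U2 = "deriv_at_third wt_u2 \<sigma> / at_third wt_u2 \<sigma>"
  let ?V = "deriv_at_third wt_v \<sigma> / at_third wt_v \<sigma>"
  let ?w1 = "deriv_at_third wt_w1 \<sigma>" and ?w2 = "deriv_at_third wt_w2 \<sigma>" and ?w = "at_third wt_w1 \<sigma>"
  define N where "N = num_classes lab (sides \<omega>)"
  define M where "M = offset \<omega>"
  define j where "j = Suc k mod 6"
  \<comment> \<open>The status of the preceding edge, of the edge itself and of the next one. The
    legs and degrees at both ends are Boolean functions of these.\<close>
  define e0 e1 e2 where "e0 \<longleftrightarrow> hex_face_edge z (k + 5) \<in> \<omega>" and "e1 \<longleftrightarrow> hex_face_edge z k \<in> \<omega>"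
    and "e2 \<longleftrightarrow> hex_face_edge z (Suc k) \<in> \<omega>"
  have j: "j < 6" "corner z j = corner z (Suc k)"
    using corner_mod6[of z "Suc k"] by (simp_all add: j_def)
  have k5: "Suc k + 5 = k + 6" by simp
  have e1': "hex_face_edge z (Suc k + 5) = hex_face_edge z k"
    unfolding k5 using hex_face_edge_mod6[of z "k + 6"] hex_face_edge_mod6[of z k] by simp
  have legs: "leg z k \<in> \<omega> \<longleftrightarrow> e1 \<noteq> e0" "leg z (Suc k) \<in> \<omega> \<longleftrightarrow> e2 \<noteq> e1"
    using conf_corner(1)[OF \<omega>, of k] conf_corner(1)[OF \<omega>, of "Suc k"] e1' by (simp_all add: e0_def e1_def e2_def)
  have degs: "degree_in \<omega> (corner z k) = (if e1 \<or> e0 then 2 else 0)"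
    "degree_in \<omega> (corner z (Suc k)) = (if e2 \<or> e1 then 2 else 0)"
    using conf_corner(2)[OF \<omega>, of k] conf_corner(2)[OF \<omega>, of "Suc k"] e1' by (simp_all add: e0_def e1_def e2_def)
  have act: "active (sides \<omega>) k \<longleftrightarrow> e1 \<or> e0" "active (sides \<omega>) j \<longleftrightarrow> e2 \<or> e1"
    using active_sides[of \<omega> k] active_sides[of \<omega> "Suc k"] k e1' by (simp_all add: e0_def e1_def e2_def j_def)
  have leg_j: "leg z j = leg z (Suc k)"
    using corner_mod6[of z "Suc k"] outer_mod6[of z "Suc k"] by (simp add: leg_def j_def)
  have p: "partners \<omega> ! k = k \<longleftrightarrow> e1 = e0" "partners \<omega> ! j = j \<longleftrightarrow> e2 = e1"
    using partner_eq_iff[OF \<omega> k] partner_eq_iff[OF \<omega> j(1)] legs leg_j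
    by (auto simp: partners_nth[OF k] partners_nth[OF j(1)])
  have con: "lab ! k = lab ! j \<longleftrightarrow> connected_in \<omega> (corner z k) (corner z (Suc k))"
    unfolding lab_def j(2)[symmetric] by (rule connected_labels[OF \<omega> k j(1)])
  have type: "edge_type lab (partners \<omega>) (sides \<omega>) k =
     (if (e1 \<or> e0) \<noteq> (e2 \<or> e1) then Unequal else if \<not> (e1 \<or> e0) then Vacant
      else if e1 then (if (e1 = e0) = (e2 = e1) then Same_side else Opposite_side)
      else if connected_in \<omega> (corner z k) (corner z (Suc k)) then Joined else Separate)"
    unfolding edge_type_def Let_def j_def[symmetric] act p con sides_nth[OF k] e1_def[symmetric] ..
  have conds: "unequal_degrees (hex_face_edge z k) \<omega> \<longleftrightarrow> (e1 \<or> e0) \<noteq> (e2 \<or> e1)"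
    "same_side_turn (hex_face_edge z k) \<omega> \<longleftrightarrow> e1 \<and> (e0 \<and> e2 \<or> (e1 \<noteq> e0) \<and> (e2 \<noteq> e1))"
    "opposite_side_turn (hex_face_edge z k) \<omega> \<longleftrightarrow> e1 \<and> (e0 \<and> (e2 \<noteq> e1) \<or> (e1 \<noteq> e0) \<and> e2)"
    "all_four (hex_face_edge z k) \<omega> \<longleftrightarrow> e0 \<and> (e1 \<noteq> e0) \<and> (e2 \<noteq> e1) \<and> e2"
    unfolding edge_conditions legs degs e0_def[symmetric] e1_def[symmetric] e2_def[symmetric]
    by (auto split: if_splits)
  have loops: "num_loops \<omega> + 1 = M + N"
    using num_loops_offset[OF \<omega>] by (simp add: M_def N_def lab_def)
  let ?A = "(\<lambda>i. lab ! i) ` {i. i < 6 \<and> active (sides \<omega>) i}"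
  have N: "N = card ?A" unfolding N_def num_classes_card ..
  have fin: "finite ?A" by simp
  have N1: "N \<ge> 1" if "e0 \<or> e1 \<or> e2"
  proof -
    have "?A \<noteq> {}" using that act k j(1) by blast
    then show ?thesis unfolding N using fin card_gt_0_iff[of ?A] by linarith
  qed
  have N2: "N \<ge> 2" if "e0" "e2" "\<not> connected_in \<omega> (corner z k) (corner z (Suc k))"
  proof -
    have "{lab ! k, lab ! j} \<subseteq> ?A" using that(1,2) act k j(1) by blast
    moreover have "card {lab ! k, lab ! j} = 2" using that(3) con by simp
    ultimately show ?thesis unfolding N using card_mono[OF fin, of "{lab ! k, lab ! j}"] by simp
  qed
  have power1: "n ^ num_loops \<omega> = n ^ M * n ^ (N - 1)" if "N \<ge> 1"
  proof -
    have "num_loops \<omega> = M + (N - 1)" using that loops by simp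
    then show ?thesis by (simp only: power_add)
  qed
  have power2: "n ^ (num_loops \<omega> - 1) = n ^ M * n ^ (N - 2)" "n \<noteq> 0 \<Longrightarrow> n ^ num_loops \<omega> * inverse n = n ^ M * n ^ (N - 2)"
    if "N \<ge> 2"
  proof -
    have *: "num_loops \<omega> = Suc (M + (N - 2))" using that loops by simp
    then show "n ^ (num_loops \<omega> - 1) = n ^ M * n ^ (N - 2)" by (simp only: diff_Suc_1 power_add)
    show "n \<noteq> 0 \<Longrightarrow> n ^ num_loops \<omega> * inverse n = n ^ M * n ^ (N - 2)"
      unfolding * by (simp add: power_add)
  qed
  show ?thesis
    unfolding N_def[symmetric] M_def[symmetric] type
  proof (cases "e0 \<or> e1 \<or> e2")
    case False
    then show "loops_times_t_edge n \<sigma> (hex_face_edge z k) \<omega> = n ^ M * edge_value n ?U1 ?U2 ?V (?w1 / ?w) (?w2 / ?w) N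
     (if (e1 \<or> e0) \<noteq> (e2 \<or> e1) then Unequal else if \<not> (e1 \<or> e0) then Vacant
      else if e1 then (if (e1 = e0) = (e2 = e1) then Same_side else Opposite_side)
      else if connected_in \<omega> (corner z k) (corner z (Suc k)) then Joined else Separate)"
      by (simp add: loops_times_t_edge_def t_edge_def conds)
  next
    case True
    note p1 = power1[OF N1[OF True]]
    show "loops_times_t_edge n \<sigma> (hex_face_edge z k) \<omega> = n ^ M * edge_value n ?U1 ?U2 ?V (?w1 / ?w) (?w2 / ?w) N
     (if (e1 \<or> e0) \<noteq> (e2 \<or> e1) then Unequal else if \<not> (e1 \<or> e0) then Vacant
      else if e1 then (if (e1 = e0) = (e2 = e1) then Same_side else Opposite_side)
      else if connected_in \<omega> (corner z k) (corner z (Suc k)) then Joined else Separate)"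
    proof (cases "e0 \<and> e2 \<and> \<not> e1")
      case False
      then show ?thesis using True
        by (auto simp: loops_times_t_edge_def t_edge_def conds p1 split: if_splits)
    next
      case four: True
      show ?thesis
      proof (cases "connected_in \<omega> (corner z k) (corner z (Suc k))")
        case True
        have "n ^ N = n ^ (N - 1) * n" using N1 four by (cases N) auto
        then show ?thesis using four True
          by (simp add: loops_times_t_edge_def t_edge_def conds edge_conditions(5) p1 add_divide_distrib algebra_simps)
      next
        case False
        note q = power2[OF N2[OF _ _ False]]
        show ?thesis
        proof (cases "n = 0")
          case True
          then show ?thesis using four False p1 q(1)
            by (simp add: loops_times_t_edge_def conds edge_conditions(5) add_divide_distrib algebra_simps)
        next
          case nz: False
          have "loops_times_t_edge n \<sigma> (hex_face_edge z k) \<omega> =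
              (?w1 * n ^ num_loops \<omega> + ?w2 * (n ^ num_loops \<omega> * inverse n)) / ?w"
            using four False nz
            by (simp add: loops_times_t_edge_def t_edge_def conds edge_conditions(5) algebra_simps)
          then show ?thesis using four False p1 q(2)[OF _ _ nz]
            by (simp add: add_divide_distrib algebra_simps)
        qed
      qed
    qed
  qed
qed

section \<open>The flip and the cancellation\<close>

definition flip :: "complex set set \<Rightarrow> complex set set" where
  "flip \<omega> = rest \<omega> \<union> (face_boundary - \<omega>)"

lemma flip_flip: "flip (flip \<omega>) = \<omega>" and rest_flip: "rest (flip \<omega>) = rest \<omega>"
  and leg_flip: "leg z k \<in> flip \<omega> \<longleftrightarrow> leg z k \<in> \<omega>"
  and face_flip: "hex_face_edge z k \<in> flip \<omega> \<longleftrightarrow> hex_face_edge z k \<notin> \<omega>"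
  using leg_not_face_boundary[of k] by (auto simp: flip_def rest_def face_boundary_def)

lemma sides_flip: "sides (flip \<omega>) = map Not (sides \<omega>)"
  by (simp add: sides_def face_flip)

lemma partners_flip: "partners (flip \<omega>) = partners \<omega>"
  by (simp add: partners_def partner_def rest_flip leg_flip)

lemma offset_flip: "offset (flip \<omega>) = offset \<omega>"
  unfolding offset_def using outer_components_rest[of \<omega>] outer_components_rest[of "flip \<omega>"] by (simp add: rest_flip)

text \<open>If exactly one of the two face edges at a corner is occupied, this remains so; otherwise
  both or none are occupied before and after. Degrees elsewhere do not change.\<close>

lemma flip_conf:
  assumes "\<omega> \<in> conf C B"
  shows "flip \<omega> \<in> conf C B"
proof -
  note c = confD[OF assms]
  have sub: "flip \<omega> \<subseteq> domain_edges C - C"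
    using c(3) face_boundary_domain by (auto simp: flip_def rest_def)
  then have hex: "flip \<omega> \<subseteq> hex_edges" using domain_hex by blast
  have "degree_in (flip \<omega>) v = degree_in \<omega> v \<or> v \<notin> B \<and> degree_in (flip \<omega>) v \<in> {0, 2}" for v
  proof (cases "\<exists>k. v = corner z k")
    case True
    then obtain k where k: "v = corner z k" by blast
    have "degree_in (flip \<omega>) v \<in> {0, 2}"
      unfolding k degree_in_corner[OF centre hex] leg_flip face_flip conf_corner(1)[OF assms] by auto
    then show ?thesis using k corner_not_in_B by blast
  next
    case False
    then have "v \<notin> e" if "e \<in> face_boundary" for e using face_boundary_corner that by blast
    then have "{e \<in> flip \<omega>. v \<in> e} = {e \<in> \<omega>. v \<in> e}" by (auto simp: flip_def rest_def)
    then show ?thesis by (simp add: degree_in_def)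
  qed
  then have "if v \<in> B then degree_in (flip \<omega>) v = 1 else degree_in (flip \<omega>) v \<in> {0, 2}" for v
    using c(4,5)[of v] by (cases "v \<in> B") (metis (no_types))+
  then show ?thesis unfolding conf_def by (intro CollectI conjI ballI sub)
qed

lemma card_sides:
  assumes "finite \<omega>"
  shows "card \<omega> = card (rest \<omega>) + length (filter id (sides \<omega>))"
proof -
  have "inj_on (hex_face_edge z) {k. k < 6 \<and> hex_face_edge z k \<in> \<omega>}"
    by (rule inj_onI) (use hex_face_edge_inj in blast)
  moreover have "\<omega> \<inter> face_boundary = hex_face_edge z ` {k. k < 6 \<and> hex_face_edge z k \<in> \<omega>}"
    by (auto simp: face_boundary_eq)
  moreover have "length (filter id (sides \<omega>)) = card {k. k < 6 \<and> hex_face_edge z k \<in> \<omega>}"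
    unfolding sides_def filter_map length_map by (subst distinct_card[symmetric]) (auto intro: arg_cong[where f = card])
  ultimately have "card (\<omega> \<inter> face_boundary) = length (filter id (sides \<omega>))" by (simp add: card_image)
  moreover have "\<omega> = rest \<omega> \<union> (\<omega> \<inter> face_boundary)" "rest \<omega> \<inter> (\<omega> \<inter> face_boundary) = {}" by (auto simp: rest_def)
  ultimately show ?thesis using assms by (metis card_Un_disjoint finite_Un)
qed

lemma imbalance_scale: "imbalance (\<lambda>k. c * T k) i = c * imbalance T i"
  by (simp add: imbalance_def algebra_simps)

text \<open>A configuration and its flip share the factor
  \<open>x ^ card (rest \<omega>) * n ^ offset \<omega>\<close>, the matching of the legs and hence
  the polynomial identity of \<open>face_cancel\<close>.\<close>

lemma flip_cancels:
  fixes n x \<sigma> :: real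
  assumes params: "0 \<le> n" "n \<le> 2"
    "x = 1 / sqrt (2 + sqrt (2 - n)) \<and> \<sigma> = 1 - 3 / (4 * pi) * arccos (- n / 2) \<or>
     x = 1 / sqrt (2 - sqrt (2 - n)) \<and> \<sigma> = 1 - 3 / (4 * pi) * (2 * pi - arccos (- n / 2))"
    and \<omega>: "\<omega> \<in> conf C B" and i: "i < 2"
  defines "g \<equiv> \<lambda>\<omega>. imbalance (\<lambda>k. loops_times_t_edge n \<sigma> (hex_face_edge z k) \<omega> * x ^ card \<omega>) i"
  shows "g \<omega> + g (flip \<omega>) = 0"
proof -
  define \<alpha> where "\<alpha> = pi / 3 * (\<sigma> - 1)"
  note crit = critical_angle[OF params, folded \<alpha>_def]
  note ratios = weight_ratios[of \<sigma>, folded \<alpha>_def, OF crit(1,2)]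
  define r where "r = 2 * cos \<alpha>"
  define p where "p = partners \<omega>"
  define T where "T = (\<lambda>s k. x ^ length (filter id s) *
    edge_value n (deriv_at_third wt_u1 \<sigma> / at_third wt_u1 \<sigma>) (deriv_at_third wt_u2 \<sigma> / at_third wt_u2 \<sigma>)
      (deriv_at_third wt_v \<sigma> / at_third wt_v \<sigma>) (deriv_at_third wt_w1 \<sigma> / at_third wt_w1 \<sigma>)
      (deriv_at_third wt_w2 \<sigma> / at_third wt_w1 \<sigma>) (num_classes (labels p s) s) (edge_type (labels p s) p s k))"
  have zero: "imbalance (T (sides \<omega>)) i + imbalance (T (map Not (sides \<omega>))) i = 0"
  proof (rule face_cancel[OF _ _ i])
    show "noncrossing p" unfolding p_def partners_def by (rule noncrossing_partners[OF \<omega>])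
    show "compatible p (sides \<omega>)" unfolding p_def by (rule compatible_sides[OF \<omega>])
    show "r \<noteq> 0" using crit(2) by (simp add: r_def)
    show "x = 1 / r" "n = - (r ^ 4) + 4 * r ^ 2 - 2" using crit(3,4) by (simp_all only: r_def)
  qed (rule ratios[folded r_def] | simp only: T_def)+
  have g: "g \<eta> = x ^ card (rest \<omega>) * n ^ offset \<omega> * imbalance (T (sides \<eta>)) i"
    if \<eta>: "\<eta> \<in> conf C B" "partners \<eta> = p" "rest \<eta> = rest \<omega>" "offset \<eta> = offset \<omega>" for \<eta>
  proof -
    have "finite \<eta>" using confD(1)[OF \<eta>(1)] by (simp add: simple_graph_def)
    note card = card_sides[OF this, unfolded \<eta>(3)]
    have "loops_times_t_edge n \<sigma> (hex_face_edge z k) \<eta> * x ^ card \<eta> =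
        x ^ card (rest \<omega>) * n ^ offset \<omega> * T (sides \<eta>) k" if "k < 6" for k
      unfolding loops_times_t_edge_face[OF \<eta>(1) that] card T_def \<eta>(2,4) by (simp add: power_add)
    then have "g \<eta> = imbalance (\<lambda>k. x ^ card (rest \<omega>) * n ^ offset \<omega> * T (sides \<eta>) k) i"
      using i unfolding g_def imbalance_def by simp
    then show ?thesis by (simp only: imbalance_scale)
  qed
  have "g \<omega> + g (flip \<omega>) = x ^ card (rest \<omega>) * n ^ offset \<omega> *
      (imbalance (T (sides \<omega>)) i + imbalance (T (map Not (sides \<omega>))) i)"
    using g[OF \<omega>] g[OF flip_conf[OF \<omega>]] by (simp add: p_def partners_flip rest_flip offset_flip sides_flip algebra_simps)
  then show ?thesis unfolding zero by simp
qed

text \<open>Reindexing along the involution shows that the total contribution is its own negative.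
  The additive constant drops out because two edges enter with each sign.\<close>

lemma T_edge_balanced:
  fixes n x \<sigma> :: real
  assumes params: "0 \<le> n" "n \<le> 2"
    "x = 1 / sqrt (2 + sqrt (2 - n)) \<and> \<sigma> = 1 - 3 / (4 * pi) * arccos (- n / 2) \<or>
     x = 1 / sqrt (2 - sqrt (2 - n)) \<and> \<sigma> = 1 - 3 / (4 * pi) * (2 * pi - arccos (- n / 2))"
    and i: "i < 2"
  shows "imbalance (\<lambda>k. T_edge c n x \<sigma> C B (hex_face_edge z k)) i = 0"
proof -
  define g where "g \<omega> = imbalance (\<lambda>k. loops_times_t_edge n \<sigma> (hex_face_edge z k) \<omega> * x ^ card \<omega>) i" for \<omega>
  have "bij_betw flip (conf C B) (conf C B)"
    by (rule bij_betw_byWitness[of _ flip]) (auto simp: flip_flip flip_conf)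
  then have "(\<Sum>\<omega>\<in>conf C B. g (flip \<omega>)) = (\<Sum>\<omega>\<in>conf C B. g \<omega>)" by (rule sum.reindex_bij_betw)
  moreover have "(\<Sum>\<omega>\<in>conf C B. g \<omega> + g (flip \<omega>)) = 0"
    by (intro sum.neutral ballI) (simp only: g_def flip_cancels[OF params _ i])
  ultimately have "(\<Sum>\<omega>\<in>conf C B. g \<omega>) = 0" by (simp add: sum.distrib)
  moreover have "imbalance (\<lambda>k. T_edge c n x \<sigma> C B (hex_face_edge z k)) i =
      (\<Sum>\<omega>\<in>conf C B. g \<omega>) / partition_function n x C B"
    unfolding imbalance_def g_def T_edge_def expectation_t_edge_def
    by (simp add: sum.distrib sum_subtractf add_divide_distrib diff_divide_distrib)
  ultimately show ?thesis by simp
qed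

end

theorem proposition1p4:
  fixes n x \<sigma> :: real
    and c_edge :: "real \<Rightarrow> real \<Rightarrow> real"
    and C :: "complex set set"
    and B :: "complex set"
    and a b\<^sub>1 c d e f :: "complex set"
  assumes "0 \<le> n" and "n \<le> 2"
    and "x = 1 / sqrt (2 + sqrt (2 - n)) \<and> \<sigma> = 1 - 3 / (4 * pi) * arccos (- n / 2) \<or>
         x = 1 / sqrt (2 - sqrt (2 - n)) \<and> \<sigma> = 1 - 3 / (4 * pi) * (2 * pi - arccos (- n / 2))"
    and "hex_cycle C"
    and "boundary_condition C B"
    and "ccw_hex_face [a, b\<^sub>1, c, d, e, f]"
    and "{a, b\<^sub>1, c, d, e, f} \<subseteq> domain_edges C"
    and "{a, b\<^sub>1, c, d, e, f} \<inter> C = {}"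
  shows "T_edge c_edge n x \<sigma> C B d - T_edge c_edge n x \<sigma> C B a =
           T_edge c_edge n x \<sigma> C B b\<^sub>1 - T_edge c_edge n x \<sigma> C B e \<and>
         T_edge c_edge n x \<sigma> C B b\<^sub>1 - T_edge c_edge n x \<sigma> C B e =
           T_edge c_edge n x \<sigma> C B f - T_edge c_edge n x \<sigma> C B c"
proof -
  obtain z k where z: "z \<in> hex_face_centres"
    and es: "[a, b\<^sub>1, c, d, e, f] = map (\<lambda>j. hex_face_edge z (k + j)) [0..<6]"
    using assms(6) unfolding ccw_hex_face_def by (elim bexE exE) (rule that)
  have "[0..<6] = [0, 1, 2, 3, 4, 5::nat]" by (simp add: upt_conv_Cons)
  with es have abc: "a = hex_face_edge z (k + 0)" "b\<^sub>1 = hex_face_edge z (k + 1)" "c = hex_face_edge z (k + 2)"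
    "d = hex_face_edge z (k + 3)" "e = hex_face_edge z (k + 4)" "f = hex_face_edge z (k + 5)" by simp_all
  have mod: "hex_face_edge z i = hex_face_edge z j" if "i mod 6 = j mod 6" for i j
    using that hex_face_edge_mod6[of z i] hex_face_edge_mod6[of z j] by simp
  interpret face_in_domain C B z
  proof
    fix m
    \<comment> \<open>Modulo 6, \<open>5 * k\<close> is \<open>- k\<close>, so that
      \<open>k + j\<close> is congruent to \<open>m\<close>.\<close>
    define j where "j = (m + 5 * k) mod 6"
    have "(k + j) mod 6 = m mod 6" 
    proof -
      have "(k + (m + 5 * k) mod 6) mod 6 = (k + (m + 5 * k)) mod 6" by (rule mod_add_right_eq)
      also have "k + (m + 5 * k) = m + 6 * k" by simp
      finally show ?thesis by (simp add: j_def)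
    qed
    then have "hex_face_edge z m = hex_face_edge z (k + j)" by (intro mod) (rule sym)
    moreover have "j < 6" by (simp add: j_def)
    then have "hex_face_edge z (k + j) \<in> {a, b\<^sub>1, c, d, e, f}"
      unfolding abc less_6_cases by (elim disjE) simp_all
    ultimately show "hex_face_edge z m \<in> domain_edges C - C" using assms(7,8) by auto
  qed (use assms z in auto)
  define T where "T m = T_edge c_edge n x \<sigma> C B (hex_face_edge z m)" for m
  have period: "T i = T j" if "i mod 6 = j mod 6" for i j using mod[OF that] by (simp add: T_def)
  have "imbalance T 0 = 0" "imbalance T 1 = 0"
    unfolding T_def using T_edge_balanced[OF assms(1-3), of _ c_edge] by simp_all
  then have T: "T 3 + T 4 = T 0 + T 1" "T 4 + T 5 = T 1 + T 2" by (simp_all add: imbalance_def numeral_2_eq_2)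
  \<comment> \<open>The list may start at any edge of the face. By periodicity each of the six
    positions needs only the two equations in \<open>T\<close> and their difference
    \<open>T 5 + T 0 = T 2 + T 3\<close>.\<close>
  define r where "r = k mod 6"
  have "T (k + j) = T ((r + j) mod 6)" for j by (rule period) (simp add: r_def mod_add_left_eq)
  note shift = this
  have "r < 6" by (simp add: r_def)
  then have "T (k + 3) - T (k + 0) = T (k + 1) - T (k + 4) \<and> T (k + 1) - T (k + 4) = T (k + 5) - T (k + 2)"
    unfolding shift less_6_cases using T by (elim disjE) (simp_all flip: numeral_2_eq_2)
  then show ?thesis unfolding abc by (simp only: T_def)
qed

end
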